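(* Fix an integer $K\geq3$. As $m,n_1,\ldots,n_K\to\infty$ with $\lim m/n_i\in(2,K)$ for each $i\in\{1,\ldots,K\}$, writing $\mathbf{n}=(n_1,\ldots,n_K)$, $$\sum_{\ell=2}^m\mathbb{E}[Z^{(\ell)}_{m,\mathbf{n}}]=O\big(m^{-2K(\frac12-\frac1K)}\big)=O(m^{2-K}).$$
   Context: $\Psi_{m,\mathbf{n}}$ is the set of matrices $\Gamma=(A_1\ \cdots\ A_K)\in\mathbb{Z}_2^{m\times(n_1+\cdots+n_K)}$ with blocks $A_j\in\mathbb{Z}_2^{m\times n_j}$ having exactly one $1$ in each row and at least two $1$'s in each column. A critical row set of a matrix is a set of rows whose sum is the zero vector mod 2. $Z^{(\ell)}_{m,\mathbf{n}}(\Gamma)$ denotes the number of critical row sets of cardinality $\ell$ of $\Gamma$, where $\Gamma$ is uniformly distributed on $\Psi_{m,\mathbf{n}}$. *)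

theory Defs
  imports
    "HOL-Probability.Probability_Mass_Function"
    "HOL-Library.Landau_Symbols"
    "HOL-Library.Z2"
    "Jordan_Normal_Form.Matrix"
begin

text \<open>
  Matrices over \<open>\<int>\<^sub>2\<close> are matrices over the field \<^typ>\<open>bit\<close>. A block shape
  \<open>(n\<^sub>1, \<dots>, n\<^sub>K)\<close> is a function \<open>n\<close> of which only the values on \<open>{1..K}\<close> matter.
  Row and column indices start at 0, block indices at 1.
\<close>

definition total_cols :: "nat \<Rightarrow> (nat \<Rightarrow> nat) \<Rightarrow> nat" where
  "total_cols K n = (\<Sum>i\<in>{1..K}. n i)"

text \<open>The block \<open>A\<^sub>j\<close> of \<open>\<Gamma> = (A\<^sub>1 \<dots> A\<^sub>K)\<close> occupies the \<open>n\<^sub>j\<close> columns of \<open>\<Gamma>\<close>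
  that follow the first \<open>n\<^sub>1 + \<dots> + n\<^sub>j\<^sub>-\<^sub>1\<close> ones.\<close>

definition col_block :: "(nat \<Rightarrow> nat) \<Rightarrow> bit mat \<Rightarrow> nat \<Rightarrow> bit mat" where
  "col_block n \<Gamma> j =
     mat (dim_row \<Gamma>) (n j) (\<lambda>(r, c). \<Gamma> $$ (r, (\<Sum>i\<in>{1..<j}. n i) + c))"

definition Psi :: "nat \<Rightarrow> nat \<Rightarrow> (nat \<Rightarrow> nat) \<Rightarrow> bit mat set" where
  "Psi K m n = {\<Gamma> \<in> carrier_mat m (total_cols K n). \<forall>j\<in>{1..K}.
     (\<forall>r<m. card {c. c < n j \<and> col_block n \<Gamma> j $$ (r, c) = 1} = 1) \<and>
     (\<forall>c<n j. card {r. r < m \<and> col_block n \<Gamma> j $$ (r, c) = 1} \<ge> 2)}"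

text \<open>Rows are identified by their indices, so equal rows at different positions are
  different elements of a row set.\<close>

definition critical_row_set :: "bit mat \<Rightarrow> nat set \<Rightarrow> bool" where
  "critical_row_set \<Gamma> R \<longleftrightarrow> R \<subseteq> {0..<dim_row \<Gamma>} \<and>
     finsum_vec TYPE(bit) (dim_col \<Gamma>) (Matrix.row \<Gamma>) R = 0\<^sub>v (dim_col \<Gamma>)"

definition Z_crit :: "nat \<Rightarrow> bit mat \<Rightarrow> nat" where
  "Z_crit l \<Gamma> = card {R. critical_row_set \<Gamma> R \<and> card R = l}"

text \<open>The expectation over uniform \<open>\<Gamma>\<close> is only meaningful if \<open>Psi K m n\<close>, which is finite, is
  also nonempty; this is the case whenever \<open>1 \<le> n\<^sub>i\<close> and \<open>2 * n\<^sub>i \<le> m\<close> for all \<open>i\<close>.\<close>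

definition expected_Z :: "nat \<Rightarrow> nat \<Rightarrow> (nat \<Rightarrow> nat) \<Rightarrow> nat \<Rightarrow> real" where
  "expected_Z K m n l =
     measure_pmf.expectation (pmf_of_set (Psi K m n)) (\<lambda>\<Gamma>. real (Z_crit l \<Gamma>))"

end

theory Submission
  imports Defs "HOL-Analysis.Analysis" "HOL-Real_Asymp.Real_Asymp"
begin

text \<open>
  A matrix of the given shape is a tuple of maps \<open>\<phi>\<^sub>j\<close> from the \<open>m\<close> rows to the \<open>n\<^sub>j\<close> columns with
  all fibres of size at least two, and a row set \<open>R\<close> is critical iff it meets every fibre of every
  \<open>\<phi>\<^sub>j\<close> in an even number of rows. Hence the expectation is the sum over \<open>R\<close> of the product of the
  probabilities \<open>p\<^sub>j(R)\<close> that \<open>\<phi>\<^sub>j\<close> is even on \<open>R\<close>.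

  For \<open>|R| = l\<close> at most a small multiple of \<open>m\<close>, removing colliding pairs of rows one after the other
  gives \<open>p\<^sub>j(R) \<le> (C l / m)\<^bsup>l/2\<^esup>\<close>. The number of such \<open>R\<close> is at most \<open>(e m / l)\<^bsup>l\<^esup>\<close>, so the contribution of
  \<open>l\<close> is at most \<open>(C' (l / m)\<^bsup>K-2\<^esup>)\<^bsup>l/2\<^esup>\<close>; this is dominated by \<open>l = 2\<close>, which yields \<open>m\<^bsup>2-K\<^esup>\<close>.

  For larger \<open>l\<close> the generating function of the maps, with exponential variables \<open>a z\<close> for the rows in
  \<open>R\<close> and \<open>(1 - a) z\<close> for the others, is compared with \<open>f(z)\<^bsup>n\<^esup>\<close>, where \<open>f(z) = e\<^bsup>z\<^esup> - 1 - z\<close> and \<open>z\<close> is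
  (nearly) the saddle point \<open>z f'(z) / f(z) = m / n\<^sub>j\<close>. A sharpening of Clarkson's inequality,
  \<open>(1 + f((1 - 2 a) z) / f(z)) / 2 \<le> \<parallel>(a, 1 - a)\<parallel>\<^bsup>\<lambda>\<^esup>\<close> in the norm with exponent conjugate to
  \<open>\<kappa> \<ge> \<lambda> = z f'(z) / f(z)\<close>, gives \<open>p\<^sub>j(R) \<le> exp(o(m)) (m choose l)\<^bsup>-1/\<kappa>\<^esup>\<close>. For \<open>\<kappa> = K\<close> the product over
  the \<open>K\<close> blocks would just balance the number of sets \<open>R\<close>; since all limits are below \<open>K\<close>, some
  \<open>\<kappa> < K\<close> is admissible, and interpolating with the crude bound \<open>p\<^sub>1(R) \<le> exp(o(m)) \<rho>\<^bsup>m\<^esup>\<close> makes the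
  contribution of each such \<open>l\<close> exponentially small.
\<close>

section \<open>A two-point inequality\<close>

definition pow_diff :: "real \<Rightarrow> real \<Rightarrow> real" where
  "pow_diff t x = (1 + x) powr t - (1 - x) powr t"

definition pow_sum :: "real \<Rightarrow> real \<Rightarrow> real" where
  "pow_sum t x = (1 + x) powr t + (1 - x) powr t"

definition pow_ratio :: "real \<Rightarrow> real \<Rightarrow> real" where
  "pow_ratio t x = pow_diff t x / pow_sum t x"

text \<open>For \<open>a = (1 + x) / 2\<close> this is \<open>2 powr t\<close> times
  \<open>a powr (1 + t) + (1 - a) powr (1 + t)\<close>, a power of the norm of the pair (a, 1 -
  a).\<close>

definition pow_mean :: "real \<Rightarrow> real \<Rightarrow> real" where
  "pow_mean t x = ((1 + x) powr (1 + t) + (1 - x) powr (1 + t)) / 2"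

lemma one_minus_sq_pos: "1 - x^2 > 0" if "\<bar>x\<bar> < 1" for x :: real
  using that by (simp add: abs_square_less_1)

lemma pow_mean_eq:
  assumes "\<bar>x\<bar> < 1"
  shows "pow_mean t x = (pow_sum t x + x * pow_diff t x) / 2"
proof -
  have "1 + x > 0" "1 - x > 0" using assms by auto
  then show ?thesis
    unfolding pow_mean_def pow_sum_def pow_diff_def
    by (simp add: powr_add algebra_simps)
qed

lemma pow_diff_deriv:
  assumes "\<bar>x\<bar> < 1"
  shows "(pow_diff t has_real_derivative
    t * (pow_sum t x - x * pow_diff t x) / (1 - x^2)) (at x)"
proof -
  have pos: "1 + x > 0" "1 - x > 0" using assms by auto
  have D: "1 - x^2 = (1 + x) * (1 - x)" by (simp add: power2_eq_square algebra_simps)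
  have "(pow_diff t has_real_derivative
    t * (1+x) powr (t - 1) + t * (1-x) powr (t - 1)) (at x)"
    unfolding pow_diff_def using pos
    by (auto intro!: derivative_eq_intros simp: powr_diff field_simps)
  moreover have "t * (1+x) powr (t - 1) + t * (1-x) powr (t - 1)
    = t * (pow_sum t x - x * pow_diff t x) / (1 - x^2)"
    unfolding D pow_diff_def pow_sum_def using pos
    by (simp add: powr_diff field_simps)
  ultimately show ?thesis by simp
qed

lemma pow_sum_deriv:
  assumes "\<bar>x\<bar> < 1"
  shows "(pow_sum t has_real_derivative
    t * (pow_diff t x - x * pow_sum t x) / (1 - x^2)) (at x)"
proof -
  have pos: "1 + x > 0" "1 - x > 0" using assms by auto
  have D: "1 - x^2 = (1 + x) * (1 - x)" by (simp add: power2_eq_square algebra_simps)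
  have "(pow_sum t has_real_derivative
    t * (1+x) powr (t - 1) - t * (1-x) powr (t - 1)) (at x)"
    unfolding pow_sum_def using pos
    by (auto intro!: derivative_eq_intros simp: powr_diff field_simps)
  moreover have "t * (1+x) powr (t - 1) - t * (1-x) powr (t - 1)
    = t * (pow_diff t x - x * pow_sum t x) / (1 - x^2)"
    unfolding D pow_diff_def pow_sum_def using pos
    by (simp add: powr_diff field_simps)
  ultimately show ?thesis by simp
qed

lemma pow_sum_pos: "pow_sum t x > 0" if "\<bar>x\<bar> < 1"
  using that unfolding pow_sum_def by (simp add: add_pos_pos)

text \<open>Under \<open>x = tanh y\<close> this is the chain rule for \<open>tanh (t * y)\<close>.
  The derivative is again rational in \<open>x\<close> and \<open>pow_ratio t x\<close>, so no new
  powers arise when differentiating further.\<close>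

lemma pow_ratio_deriv:
  assumes "\<bar>x\<bar> < 1"
  shows "(pow_ratio t has_real_derivative t * (1 - (pow_ratio t x)^2) / (1 - x^2)) (at x)"
proof -
  have v: "pow_sum t x > 0" using pow_sum_pos[OF assms] .
  have D: "1 - x^2 > 0" using one_minus_sq_pos[OF assms] .
  let ?u = "pow_diff t x" and ?v = "pow_sum t x"
  have "(pow_ratio t has_real_derivative
    ((t * (?v - x * ?u) / (1 - x^2)) * ?v - ?u * (t * (?u - x * ?v) / (1 - x^2))) / (?v * ?v)) (at x)"
    unfolding pow_ratio_def[abs_def]
    by (rule DERIV_divide[OF pow_diff_deriv[OF assms] pow_sum_deriv[OF assms]]) (use v in simp)
  moreover have "((t * (?v - x * ?u) / (1 - x^2)) * ?v - ?u * (t * (?u - x * ?v) / (1 - x^2))) / (?v * ?v)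
     = t * (1 - (pow_ratio t x)^2) / (1 - x^2)"
  proof -
    have "(t * (?v - x * ?u) / (1 - x^2)) * ?v - ?u * (t * (?u - x * ?v) / (1 - x^2))
       = t * (?v^2 - ?u^2) / (1 - x^2)"
      by (simp add: diff_divide_distrib[symmetric] power2_eq_square algebra_simps)
    then have "(t * (?v - x * ?u) / (1 - x^2) * ?v - ?u * (t * (?u - x * ?v) / (1 - x^2))) / (?v * ?v)
       = t * ((?v^2 - ?u^2) / ?v^2) / (1 - x^2)"
      by (simp add: power2_eq_square)
    also have "(?v^2 - ?u^2) / ?v^2 = 1 - (pow_ratio t x)^2"
      unfolding pow_ratio_def using v by (simp add: power_divide diff_divide_distrib)
    finally show ?thesis .
  qed
  ultimately show ?thesis by simp
qed

lemma pow_mean_pos: "pow_mean t x > 0" if "\<bar>x\<bar> \<le> 1"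
proof (cases "1 + x > 0")
  case True
  then show ?thesis unfolding pow_mean_def by (simp add: add_pos_nonneg)
next
  case False
  then have "x = -1" using that by auto
  then show ?thesis unfolding pow_mean_def by simp
qed

lemma pow_mean_deriv:
  assumes "\<bar>x\<bar> < 1"
  shows "(pow_mean t has_real_derivative (1 + t) * pow_diff t x / 2) (at x)"
proof -
  have pos: "1 + x > 0" "1 - x > 0" using assms by auto
  have "((\<lambda>x. ((1 + x) powr (1 + t) + (1 - x) powr (1 + t)) / 2) has_real_derivative
     ((1 + t) * (1 + x) powr (1 + t - 1) - (1 + t) * (1 - x) powr (1 + t - 1)) / 2) (at x)"
    using pos by (auto intro!: derivative_eq_intros simp del: add_diff_cancel_left')
  then show ?thesis unfolding pow_mean_def pow_diff_def by (simp add: algebra_simps)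
qed

lemma pow_sum_diff_sq:
  assumes "\<bar>x\<bar> < 1"
  shows "(pow_sum t x)^2 - (pow_diff t x)^2 = 4 * (1 - x^2) powr t"
proof -
  have pos: "1 + x > 0" "1 - x > 0" using assms by auto
  have D: "1 - x^2 = (1 + x) * (1 - x)" by (simp add: power2_eq_square algebra_simps)
  have "(1 - x^2) powr t = (1 + x) powr t * (1 - x) powr t" unfolding D using pos by (simp add: powr_mult)
  then show ?thesis unfolding pow_sum_def pow_diff_def by (simp add: power2_eq_square algebra_simps)
qed

lemma pow_ratio_bounds:
  assumes "0 < x" "x < 1" "0 < t"
  shows "0 < pow_ratio t x" "pow_ratio t x < 1"
proof -
  have "(1 - x) powr t < (1 + x) powr t" using assms by (intro powr_less_mono2) auto
  moreover have "(1 - x) powr t > 0" "(1 + x) powr t > 0" using assms by auto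
  ultimately show "0 < pow_ratio t x" "pow_ratio t x < 1"
    unfolding pow_ratio_def pow_diff_def pow_sum_def by (simp_all add: add_pos_pos)
qed

lemma sinh_mult_le:
  assumes "0 \<le> t" "t \<le> 1" "0 \<le> y"
  shows "sinh (t * y) \<le> t * sinh (y::real)"
proof -
  let ?f = "\<lambda>y. t * sinh y - sinh (t * y)"
  have "?f 0 \<le> ?f y"
  proof (rule DERIV_nonneg_imp_nondecreasing[OF assms(3)])
    fix z :: real assume z: "0 \<le> z" "z \<le> y"
    have "(?f has_real_derivative t * (cosh z - cosh (t * z))) (at z)"
      by (auto intro!: derivative_eq_intros simp: algebra_simps)
    moreover have "cosh (t * z) \<le> cosh z"
      using assms z by (intro cosh_real_nonneg_le_iff[THEN iffD2]) (auto simp: mult_left_le_one_le)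
    ultimately show "\<exists>y'. (?f has_real_derivative y') (at z) \<and> 0 \<le> y'"
      using assms by (intro exI[of _ "t * (cosh z - cosh (t * z))"]) auto
  qed
  then show ?thesis by simp
qed

text \<open>Put \<open>x = tanh y\<close>, so that \<open>pow_ratio t x = tanh (t * y)\<close>.
  Since 1 - tanh^2 = 1 / cosh^2, the claim reduces to the square of
  \<open>sinh_mult_le\<close>.\<close>

lemma pow_ratio_sq_bound:
  assumes "0 < x" "x < 1" "0 < t" "t \<le> 1"
  shows "(pow_ratio t x)^2 * (1 - x^2) \<le> t^2 * x^2 * (1 - (pow_ratio t x)^2)"
proof -
  define y where "y = ln ((1 + x) / (1 - x)) / 2"
  have e: "exp (- 2 * y) = (1 - x) / (1 + x)"
    unfolding y_def using assms by (simp add: exp_minus)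
  have x: "x = tanh y" unfolding tanh_real_altdef e using assms by (simp add: field_simps)
  have y: "y > 0" using assms unfolding y_def by simp
  have c: "cosh y > 0" "cosh (t*y) > 0" by (simp_all)
  have p: "1 + x = exp y / cosh y" "1 - x = exp (-y) / cosh y"
    using c(1) unfolding x tanh_def by (simp_all add: field_simps sinh_def cosh_def)
  have e: "(1 + x) powr t = exp (t*y) / cosh y powr t" "(1 - x) powr t = exp (-(t*y)) / cosh y powr t"
    unfolding p by (simp_all add: powr_divide exp_powr_real mult.commute)
  have cp: "cosh y powr t > 0" using c by simp
  have r: "pow_ratio t x = tanh (t*y)"
    unfolding pow_ratio_def pow_diff_def pow_sum_def e
    using cp by (simp add: diff_divide_distrib[symmetric] add_divide_distrib[symmetric]
      tanh_altdef)
  have s: "sinh (t*y) \<le> t * sinh y" using sinh_mult_le[of t y] assms y by auto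
  have "sinh (t*y) \<ge> 0" using assms y by simp
  then have "(sinh (t*y))^2 \<le> (t * sinh y)^2" using s by (intro power_mono) auto
  then have "(sinh (t*y))^2 / ((cosh (t*y))^2 * (cosh y)^2) \<le> (t * sinh y)^2 / ((cosh (t*y))^2 * (cosh y)^2)"
    by (intro divide_right_mono) auto
  moreover have "1 - (sinh z / cosh z)^2 = 1 / (cosh z)^2" for z :: real
  proof -
    have "cosh z > 0" by simp
    then have "1 - (sinh z / cosh z)^2 = ((cosh z)^2 - (sinh z)^2) / (cosh z)^2"
      by (simp add: power_divide diff_divide_distrib)
    then show ?thesis by (simp add: hyperbolic_pythagoras)
  qed
  ultimately show ?thesis
    unfolding r unfolding x tanh_def by (simp add: power_divide power_mult_distrib mult.commute)
qed

section \<open>Log-convexity of the second derivative of the norm side\<close>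

text \<open>
  \<open>log_curv t l\<close> is, up to an additive constant, the logarithm of the second derivative of
  \<open>x \<mapsto> pow_mean t x powr (l / (1 + t))\<close>; \<open>log_curv1\<close> and \<open>log_curv2\<close> are its first two derivatives.
  They are rational in \<open>x\<close> and \<open>pow_ratio t x = tanh (t artanh x)\<close>.
\<close>

definition curv_ratio :: "real \<Rightarrow> real \<Rightarrow> real \<Rightarrow> real" where
  "curv_ratio t l x = t * (l - 1) * (pow_ratio t x)^2 * (1 - x^2) / (t^2 * (1 - (pow_ratio t x)^2))"

definition log_curv1 :: "real \<Rightarrow> real \<Rightarrow> real \<Rightarrow> real" where
  "log_curv1 t l x = (l - 2 - 2 * t) * pow_ratio t x / (1 + x * pow_ratio t x)
   + 2 * (1 - t) * x / (1 - x^2)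
   + 2 * (t / pow_ratio t x - x) * curv_ratio t l x / ((1 - x^2) * (1 + curv_ratio t l x))"

definition log_curv2 :: "real \<Rightarrow> real \<Rightarrow> real \<Rightarrow> real" where
  "log_curv2 t l x = (l - 2 - 2 * t) * (t * (1 - (pow_ratio t x)^2) - (pow_ratio t x)^2 * (1 - x^2)) / ((1 - x^2) * (1 + x * pow_ratio t x)^2)
   + (2 * (1 - t) * (1 + x^2) - 2 * (1 - t^2) * curv_ratio t l x / (1 + curv_ratio t l x)
      + 2 * (t / pow_ratio t x - x)^2 * curv_ratio t l x * (1 - curv_ratio t l x) / (1 + curv_ratio t l x)^2) / (1 - x^2)^2"

definition log_curv :: "real \<Rightarrow> real \<Rightarrow> real \<Rightarrow> real" where
  "log_curv t l x = (l / (1 + t) - 2) * ln (pow_mean t x) - (1 - t) * ln (1 - x^2) + ln (1 + curv_ratio t l x)"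

context
  fixes t l :: real
  assumes t: "0 < t" "t \<le> 5/9"
    and l: "2 \<le> l" "t * (l - 1) \<le> 1"
begin

text \<open>The upper bound combines \<open>t * (l - 1) \<le> 1\<close> with
  \<open>pow_ratio_sq_bound\<close>. It keeps \<open>curv_ratio\<close> below 1, which gives the
  last summand of \<open>log_curv2\<close> its sign.\<close>

lemma curv_ratio_bounds:
  assumes "0 < x" "x < 1"
  shows "0 < curv_ratio t l x" "curv_ratio t l x \<le> x^2"
proof -
  note r = pow_ratio_bounds[OF assms t(1)]
  have r2: "0 < 1 - (pow_ratio t x)^2" "(pow_ratio t x)^2 > 0"
    using r by (auto simp: abs_square_less_1)
  have D: "0 < 1 - x^2" using assms by (simp add: abs_square_less_1)
  show "0 < curv_ratio t l x" unfolding curv_ratio_def using r2 D t l by (auto intro!: divide_pos_pos mult_pos_pos)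
  have "curv_ratio t l x = t * (l - 1) * ((pow_ratio t x)^2 * (1 - x^2)) / (t^2 * (1 - (pow_ratio t x)^2))"
    by (simp add: curv_ratio_def mult.assoc)
  also have "\<dots> \<le> 1 * (t^2 * x^2 * (1 - (pow_ratio t x)^2)) / (t^2 * (1 - (pow_ratio t x)^2))"
  proof (intro divide_right_mono mult_mono[OF l(2)])
    show "(pow_ratio t x)^2 * (1 - x^2) \<le> t^2 * x^2 * (1 - (pow_ratio t x)^2)"
      using pow_ratio_sq_bound[OF assms t(1)] t by simp
  qed (use r2 D in auto)
  also have "\<dots> = x^2" using r2 t by simp
  finally show "curv_ratio t l x \<le> x^2" .
qed

text \<open>This is logarithmic differentiation: with r = \<open>pow_ratio t x\<close>, the
  contributions of r^2 and of 1 / (1 - r^2) add up to 2 t / (r (1 - x^2)), and 1 - x^2 contributes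
  -2 x / (1 - x^2).\<close>

lemma curv_ratio_deriv:
  assumes "0 < x" "x < 1"
  shows "(curv_ratio t l has_real_derivative 2 * (t / pow_ratio t x - x) * curv_ratio t l x / (1 - x^2)) (at x)"
proof -
  note r = pow_ratio_bounds[OF assms t(1)]
  let ?r = "pow_ratio t x"
  have r2: "0 < 1 - ?r^2" using r by (auto simp: abs_square_less_1)
  have D: "0 < 1 - x^2" using assms by (simp add: abs_square_less_1)
  have rd: "(pow_ratio t has_real_derivative t * (1 - ?r^2) / (1 - x^2)) (at x)"
    using pow_ratio_deriv assms by simp
  let ?rd = "t * (1 - ?r^2) / (1 - x^2)"
  have "(curv_ratio t l has_real_derivative
     (t * (l-1) * ((2 * ?r * ?rd) * (1 - x^2) + ?r^2 * (- 2 * x)) * (t^2 * (1 - ?r^2))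
        - (t * (l-1) * ?r^2 * (1 - x^2)) * (t^2 * (- (2 * ?r * ?rd)))) / (t^2 * (1 - ?r^2))^2) (at x)"
  proof -
    have "((\<lambda>x. t * (l - 1) * (pow_ratio t x)^2 * (1 - x^2)) has_real_derivative
        t * (l-1) * ((2 * ?r * ?rd) * (1 - x^2) + ?r^2 * (- 2 * x))) (at x)"
    proof -
      define d where "d = ?rd"
      have "(pow_ratio t has_real_derivative d) (at x)" using rd by (simp add: d_def)
      note [derivative_intros] = this
      show ?thesis unfolding d_def[symmetric]
        by (auto intro!: derivative_eq_intros simp: algebra_simps)
    qed
    moreover have "((\<lambda>x. t^2 * (1 - (pow_ratio t x)^2)) has_real_derivative
        t^2 * (- (2 * ?r * ?rd))) (at x)"
      by (auto intro!: derivative_eq_intros rd)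
    ultimately show ?thesis
      unfolding curv_ratio_def[abs_def] power2_eq_square[of "t^2 * (1 - ?r^2)"] using r2 t
      by (intro DERIV_divide) auto
  qed
  moreover have "(t * (l-1) * ((2 * ?r * ?rd) * (1 - x^2) + ?r^2 * (- 2 * x)) * (t^2 * (1 - ?r^2))
        - (t * (l-1) * ?r^2 * (1 - x^2)) * (t^2 * (- (2 * ?r * ?rd)))) / (t^2 * (1 - ?r^2))^2
    = 2 * (t / ?r - x) * curv_ratio t l x / (1 - x^2)"
  proof -
    define E where "E = 1 - ?r^2"
    define D where "D = 1 - x^2"
    have ED: "E > 0" "D > 0" "?r > 0" using r2 D r by (auto simp: E_def D_def)
    have rE: "?r^2 = 1 - E" "x^2 = 1 - D" by (auto simp: E_def D_def)
    have num: "t * (l-1) * ((2 * ?r * (t * E / D)) * D + ?r^2 * (- 2 * x)) * (t^2 * E)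
        - (t * (l-1) * ?r^2 * D) * (t^2 * (- (2 * ?r * (t * E / D))))
       = 2 * t^3 * (l-1) * E * ?r * (t - ?r * x)"
    proof -
      have "t * (l-1) * ((2 * ?r * (t * E / D)) * D + ?r^2 * (- 2 * x)) * (t^2 * E)
        - (t * (l-1) * ?r^2 * D) * (t^2 * (- (2 * ?r * (t * E / D))))
        = t * (l-1) * (2 * ?r * (t * E) + ?r^2 * (- 2 * x)) * (t^2 * E)
        + t * (l-1) * ?r^2 * (t^2 * (2 * ?r * (t * E)))" using ED by simp
      also have "\<dots> = 2 * t^3 * (l-1) * E * ?r * (t * (E + ?r^2) - ?r * x)"
        by (simp add: power2_eq_square power3_eq_cube algebra_simps)
      also have "E + ?r^2 = 1" by (simp add: E_def)
      finally show ?thesis by simp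
    qed
    have tr: "t / ?r - x = (t - ?r * x) / ?r" using ED by (simp add: diff_divide_distrib)
    show ?thesis unfolding curv_ratio_def E_def[symmetric] D_def[symmetric] num tr
      using ED t by (simp add: power2_eq_square power3_eq_cube)
  qed
  ultimately show ?thesis by simp
qed

lemma log_curv_deriv:
  assumes "0 < x" "x < 1"
  shows "(log_curv t l has_real_derivative log_curv1 t l x) (at x)"
proof -
  note r = pow_ratio_bounds[OF assms t(1)]
  let ?r = "pow_ratio t x"
  have D: "0 < 1 - x^2" using assms by (simp add: abs_square_less_1)
  have m: "pow_mean t x > 0" using pow_mean_pos assms by simp
  have md: "(pow_mean t has_real_derivative (1 + t) * pow_diff t x / 2) (at x)"
    using pow_mean_deriv assms by simp
  have v: "pow_sum t x > 0" using pow_sum_pos assms by simp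
  have J: "0 < curv_ratio t l x" using curv_ratio_bounds assms by simp
  have Q: "pow_diff t x / pow_mean t x = 2 * ?r / (1 + x * ?r)"
  proof -
    have d: "pow_diff t x = ?r * pow_sum t x" using v by (simp add: pow_ratio_def)
    then have m:  "pow_mean t x = pow_sum t x * (1 + x * ?r) / 2"
      using pow_mean_eq[of x t] assms by (simp add: algebra_simps)
    show ?thesis unfolding m d using v by simp
  qed
  have "(log_curv t l has_real_derivative (l / (1 + t) - 2) * ((1 + t) * pow_diff t x / 2 / pow_mean t x)
      - (1 - t) * (- 2 * x / (1 - x^2)) + 2 * (t / ?r - x) * curv_ratio t l x / (1 - x^2) / (1 + curv_ratio t l x)) (at x)"
    unfolding log_curv_def[abs_def] using m D J
    by (auto intro!: derivative_eq_intros md curv_ratio_deriv[OF assms] simp: mult_ac)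
  moreover have "(l / (1 + t) - 2) * ((1 + t) * pow_diff t x / 2 / pow_mean t x)
     = (l - 2 - 2 * t) * ?r / (1 + x * ?r)"
  proof -
    have "(l / (1 + t) - 2) * ((1 + t) * pow_diff t x / 2 / pow_mean t x)
       = (l / (1 + t) - 2) * (1 + t) / 2 * (pow_diff t x / pow_mean t x)" by simp
    also have "(l / (1 + t) - 2) * (1 + t) = l - 2 - 2 * t" using t by (simp add: field_simps)
    finally show ?thesis unfolding Q by simp
  qed
  moreover have "(1 - t) * (- 2 * x / (1 - x^2)) = - (2 * (1 - t) * x / (1 - x^2))"
    using D by (simp add: field_simps)
  moreover have "2 * (t / ?r - x) * curv_ratio t l x / (1 - x^2) / (1 + curv_ratio t l x) = 2 * (t / ?r - x) * curv_ratio t l x / ((1 - x^2) * (1 + curv_ratio t l x))"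
    by simp
  ultimately have "(log_curv t l has_real_derivative (l - 2 - 2 * t) * ?r / (1 + x * ?r)
      - (- (2 * (1 - t) * x / (1 - x^2))) + 2 * (t / ?r - x) * curv_ratio t l x / ((1 - x^2) * (1 + curv_ratio t l x))) (at x)"
    by (simp only:)
  then show ?thesis unfolding log_curv1_def by (simp only: diff_minus_eq_add)
qed

lemma log_curv1_deriv:
  assumes "0 < x" "x < 1"
  shows "(log_curv1 t l has_real_derivative log_curv2 t l x) (at x)"
proof -
  note r = pow_ratio_bounds[OF assms t(1)]
  let ?r = "pow_ratio t x"
  have D: "0 < 1 - x^2" using assms by (simp add: abs_square_less_1)
  have J: "0 < curv_ratio t l x" using curv_ratio_bounds assms by simp
  have rd: "(pow_ratio t has_real_derivative t * (1 - ?r^2) / (1 - x^2)) (at x)"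
    using pow_ratio_deriv assms by simp
  have rx: "1 + x * ?r > 0" using r assms by (simp add: add_pos_pos)
  have 1: "((\<lambda>x. (l - 2 - 2 * t) * pow_ratio t x / (1 + x * pow_ratio t x)) has_real_derivative
     (l - 2 - 2 * t) * (t * (1 - ?r^2) - ?r^2 * (1 - x^2)) / ((1 - x^2) * (1 + x * ?r)^2)) (at x)"
  proof -
    have "((\<lambda>x. (l - 2 - 2 * t) * pow_ratio t x / (1 + x * pow_ratio t x)) has_real_derivative
      ((l - 2 - 2 * t) * (t * (1 - ?r^2) / (1 - x^2)) * (1 + x * ?r) -
        (l - 2 - 2 * t) * ?r * (?r + x * (t * (1 - ?r^2) / (1 - x^2)))) / (1 + x * ?r)^2) (at x)"
    proof -
      have "((\<lambda>x. (l - 2 - 2 * t) * pow_ratio t x) has_real_derivative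
          (l - 2 - 2 * t) * (t * (1 - ?r^2) / (1 - x^2))) (at x)"
        by (intro DERIV_cmult rd)
      moreover have "((\<lambda>x. 1 + x * pow_ratio t x) has_real_derivative
          (?r + x * (t * (1 - ?r^2) / (1 - x^2)))) (at x)"
        by (auto intro!: derivative_eq_intros rd)
      ultimately show ?thesis
        unfolding power2_eq_square[of "1 + x * pow_ratio t x"] using rx by (intro DERIV_divide) auto
    qed
    moreover have "(l - 2 - 2 * t) * (t * (1 - ?r^2) / (1 - x^2)) * (1 + x * ?r) -
        (l - 2 - 2 * t) * ?r * (?r + x * (t * (1 - ?r^2) / (1 - x^2)))
       = (l - 2 - 2 * t) * (t * (1 - ?r^2) / (1 - x^2) - ?r^2)"
    proof -
      define T where "T = t * (1 - ?r^2) / (1 - x^2)"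
      show ?thesis unfolding T_def[symmetric] by (simp add: algebra_simps power2_eq_square)
    qed
    moreover have "t * (1 - ?r^2) / (1 - x^2) - ?r^2 = (t * (1 - ?r^2) - ?r^2 * (1 - x^2)) / (1 - x^2)"
      using D by (simp add: diff_divide_distrib)
    ultimately show ?thesis by simp
  qed
  have 2: "((\<lambda>x. 2 * (1 - t) * x / (1 - x^2)) has_real_derivative
      2 * (1 - t) * (1 + x^2) / (1 - x^2)^2) (at x)"
    using D by (auto intro!: derivative_eq_intros simp: power2_eq_square algebra_simps add_divide_distrib diff_divide_distrib)
  \<comment> \<open>The function \<open>w\<close> satisfies a Riccati equation. Hence the derivative
    of the third summand of \<open>log_curv1\<close> is expressed through \<open>w\<close>,
    \<open>x\<close> and \<open>curv_ratio\<close> alone.\<close>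
  define w where "w = (\<lambda>x. t / pow_ratio t x - x)"
  have wd: "(w has_real_derivative (- ((w x)^2) - 2 * w x * x - (1 - t^2)) / (1 - x^2)) (at x)"
  proof -
    have "(w has_real_derivative (- (t * (t * (1 - ?r^2) / (1 - x^2))) / ?r^2 - 1)) (at x)"
      unfolding w_def using r by (auto intro!: derivative_eq_intros rd simp: power2_eq_square)
    moreover have "- (t * (t * (1 - ?r^2) / (1 - x^2))) / ?r^2 - 1 =
       (- ((w x)^2) - 2 * w x * x - (1 - t^2)) / (1 - x^2)"
    proof -
      have "- ((w x)^2) - 2 * w x * x - (1 - t^2) = - ((w x + x)^2) + t^2 - (1 - x^2)"
        by (simp add: power2_eq_square algebra_simps)
      also have "w x + x = t / ?r" by (simp add: w_def)
      also have "- ((t / ?r)^2) + t^2 - (1 - x^2) = - (t * (t * (1 - ?r^2))) / ?r^2 - (1 - x^2)"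
        using r by (simp add: field_simps power2_eq_square)
      finally have e: "- ((w x)^2) - 2 * w x * x - (1 - t^2) = - (t * (t * (1 - ?r^2))) / ?r^2 - (1 - x^2)" .
      define A where "A = t * (t * (1 - ?r^2))"
      have A: "t * (t * (1 - ?r^2) / (1 - x^2)) = A / (1 - x^2)" by (simp add: A_def)
      show ?thesis unfolding e A A_def[symmetric]
        using D diff_divide_distrib[of "- A / ?r^2" "1 - x^2" "1 - x^2"] by (simp add: mult.commute)
    qed
    ultimately show ?thesis by simp
  qed
  have Jd: "(curv_ratio t l has_real_derivative 2 * w x * curv_ratio t l x / (1 - x^2)) (at x)"
    using curv_ratio_deriv[OF assms] by (simp add: w_def)
  have 3: "((\<lambda>x. 2 * w x * curv_ratio t l x / ((1 - x^2) * (1 + curv_ratio t l x))) has_real_derivative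
     (- 2 * (1 - t^2) * curv_ratio t l x / (1 + curv_ratio t l x)
      + 2 * (w x)^2 * curv_ratio t l x * (1 - curv_ratio t l x) / (1 + curv_ratio t l x)^2) / (1 - x^2)^2) (at x)"
  proof -
    let ?D = "1 - x^2" and ?w = "w x" and ?j = "curv_ratio t l x"
    let ?wd = "(- (?w^2) - 2 * ?w * x - (1 - t^2)) / ?D" and ?jd = "2 * ?w * ?j / ?D"
    have "((\<lambda>x. 2 * w x * curv_ratio t l x / ((1 - x^2) * (1 + curv_ratio t l x))) has_real_derivative
      ((2 * ?wd * ?j + 2 * ?w * ?jd) * (?D * (1 + ?j)) - 2 * ?w * ?j * ((- 2 * x) * (1 + ?j) + ?D * ?jd))
        / (?D * (1 + ?j))^2) (at x)"
    proof -
      have "((\<lambda>x. 2 * w x * curv_ratio t l x) has_real_derivative (2 * ?wd * ?j + 2 * ?w * ?jd)) (at x)"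
      proof -
        define a where "a = ?wd"
        define b where "b = ?jd"
        have "(w has_real_derivative a) (at x)" "(curv_ratio t l has_real_derivative b) (at x)"
          using wd Jd by (simp_all add: a_def b_def)
        note [derivative_intros] = this
        show ?thesis unfolding a_def[symmetric] b_def[symmetric]
          by (auto intro!: derivative_eq_intros simp: algebra_simps)
      qed
      moreover have "((\<lambda>x. (1 - x^2) * (1 + curv_ratio t l x)) has_real_derivative
          ((- 2 * x) * (1 + ?j) + ?D * ?jd)) (at x)"
      proof -
        define b where "b = ?jd"
        have "(curv_ratio t l has_real_derivative b) (at x)"
          using Jd by (simp add: b_def)
        note [derivative_intros] = this
        show ?thesis unfolding b_def[symmetric]
          by (auto intro!: derivative_eq_intros simp: algebra_simps)
      qed
      ultimately show ?thesis
        unfolding power2_eq_square[of "?D * (1 + ?j)"] using D J by (intro DERIV_divide) auto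
    qed
    moreover have "((2 * ?wd * ?j + 2 * ?w * ?jd) * (?D * (1 + ?j)) - 2 * ?w * ?j * ((- 2 * x) * (1 + ?j) + ?D * ?jd))
        / (?D * (1 + ?j))^2 = (- 2 * (1 - t^2) * ?j / (1 + ?j)
      + 2 * ?w^2 * ?j * (1 - ?j) / (1 + ?j)^2) / ?D^2"
    proof -
      define d where "d = ?D"
      define k where "k = 1 + ?j"
      have dk: "d > 0" "k > 0" using D J by (auto simp: d_def k_def)
      have a: "?wd * ?D = - (?w^2) - 2 * ?w * x - (1 - t^2)" "?jd * ?D = 2 * ?w * ?j" using D by auto
      have "(2 * ?wd * ?j + 2 * ?w * ?jd) * (?D * (1 + ?j)) - 2 * ?w * ?j * ((- 2 * x) * (1 + ?j) + ?D * ?jd)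
        = (2 * (?wd * ?D) * ?j + 2 * ?w * (?jd * ?D)) * (1 + ?j) - 2 * ?w * ?j * ((- 2 * x) * (1 + ?j) + ?jd * ?D)"
        by (simp only: ac_simps distrib_left distrib_right)
      also have "\<dots> = (- 2 * (1 - t^2) * ?j * (1 + ?j) + 2 * ?w^2 * ?j * (1 - ?j))"
        unfolding a by (simp add: power2_eq_square algebra_simps)
      finally show ?thesis unfolding d_def[symmetric] k_def[symmetric]
        using dk by (simp add: add_divide_distrib power2_eq_square mult_ac)
    qed
    ultimately show ?thesis by simp
  qed
  have "(log_curv1 t l has_real_derivative
     (l - 2 - 2 * t) * (t * (1 - ?r^2) - ?r^2 * (1 - x^2)) / ((1 - x^2) * (1 + x * ?r)^2)
     + 2 * (1 - t) * (1 + x^2) / (1 - x^2)^2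
     + (- 2 * (1 - t^2) * curv_ratio t l x / (1 + curv_ratio t l x)
      + 2 * (w x)^2 * curv_ratio t l x * (1 - curv_ratio t l x) / (1 + curv_ratio t l x)^2) / (1 - x^2)^2) (at x)"
    unfolding log_curv1_def[abs_def] using DERIV_add[OF DERIV_add[OF 1 2] 3] by (simp add: w_def)
  then show ?thesis unfolding log_curv2_def w_def
    by (simp add: add_divide_distrib diff_divide_distrib algebra_simps)
qed

text \<open>After multiplication by (1 - x^2)^2 the three parts are at least -2 t^2, 3/2 (1 - t) and
  0, and 2 t^2 \<le> 3/2 (1 - t) for t \<le> 5/9. In terms of the conjugate exponent \<kappa> = 1 +
  1/t, the assumptions say \<kappa> \<ge> 14/5 and l \<le> \<kappa>.\<close>

lemma log_curv2_nonneg: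
  assumes "0 < x" "x < 1"
  shows "log_curv2 t l x \<ge> 0"
proof -
  note r = pow_ratio_bounds[OF assms t(1)]
  define r where "r = pow_ratio t x"
  define D where "D = 1 - x^2"
  define j where "j = curv_ratio t l x"
  have r01: "0 < r" "r < 1" using r by (auto simp: r_def)
  have r2: "0 < 1 - r^2" using r01 by (auto simp: abs_square_less_1)
  have D: "0 < D" "D \<le> 1" using assms by (simp_all add: abs_square_less_1 D_def)
  have j: "0 < j" "j \<le> x^2" "j \<le> 1" using curv_ratio_bounds[OF assms] D by (auto simp: j_def D_def)
  have rD: "r^2 * D \<le> t^2 * x^2 * (1 - r^2)"
    using pow_ratio_sq_bound[OF assms t(1)] t by (simp add: r_def D_def)
  have tx: "t^2 * x^2 \<le> t"
  proof -
    have "t * (t * x^2) \<le> t * 1" using t D by (intro mult_left_mono mult_le_one) (auto simp: D_def)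
    then show ?thesis by (simp add: power2_eq_square)
  qed
  have q: "1 \<le> (1 + x * r)^2" using assms r01 by (intro one_le_power) simp
  define U where "U = t * (1 - r^2) - r^2 * D"
  have U0: "0 \<le> U"
    using mult_right_mono[OF tx, of "1 - r^2"] r2 rD unfolding U_def by linarith
  have U1: "U \<le> t"
  proof -
    have "t * (1 - r^2) \<le> t * 1" using t r2 by (intro mult_left_mono) auto
    moreover have "0 \<le> r^2 * D" using D by simp
    ultimately show ?thesis by (simp add: U_def)
  qed
  \<comment> \<open>This is the coefficient of \<open>l - 2 - 2 * t\<close> in (1 - x^2)^2 times
    \<open>log_curv2\<close>.\<close>
  define V where "V = D * U / (1 + x * r)^2"
  have V: "0 \<le> V" "V \<le> t"
  proof -
    show "0 \<le> V" using U0 D by (simp add: V_def)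
    have "D * U \<le> 1 * t" using U0 U1 D by (intro mult_mono) auto
    also have "1 * t \<le> t * (1 + x * r)^2" using q t by simp
    finally show "V \<le> t" unfolding V_def using q t by (simp add: divide_le_eq)
  qed
  have first: "(l - 2 - 2 * t) * V \<ge> - 2 * t^2"
  proof (cases "l - 2 - 2 * t \<ge> 0")
    case True
    have "0 \<le> (l - 2 - 2 * t) * V" by (rule mult_nonneg_nonneg[OF True V(1)])
    moreover have "0 \<le> t^2" by simp
    ultimately show ?thesis by linarith
  next
    case False
    have "(2 + 2 * t - l) * V \<le> (2 * t) * t" using False V l t by (intro mult_mono) auto
    then show ?thesis by (simp add: power2_eq_square algebra_simps)
  qed
  have second: "2 * (1 - t) * (1 + x^2) - 2 * (1 - t^2) * j / (1 + j) \<ge> 3/2 * (1 - t)"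
  proof -
    \<comment> \<open>At t = 5/9 the difference (1 + j)^2 - 3/4 (1 + j) - (1 + t) j equals j^2 -
      11/36 j + 1/4, whose minimum is at j = 11/72.\<close>
    have "0 \<le> (j - 11/72)^2" by simp
    also have "(j - 11/72)^2 = j * j - 11/36 * j + 121/5184" by (simp add: power2_eq_square algebra_simps)
    finally have "0 \<le> j * j - 11/36 * j + 121/5184" .
    moreover have "t * j \<le> 5/9 * j" using t j by (intro mult_right_mono) auto
    moreover have "(1 + j)^2 = 1 + 2 * j + j * j" "(1 + t) * j = j + t * j"
      by (simp_all add: power2_eq_square algebra_simps)
    ultimately have "3/4 * (1 + j) + (1 + t) * j \<le> (1 + j)^2" by argo
    then have "3/4 \<le> (1 + j) - (1 + t) * j / (1 + j)"
      using j by (simp add: field_simps power2_eq_square)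
    also have "\<dots> \<le> (1 + x^2) - (1 + t) * j / (1 + j)" using j by simp
    finally have "2 * (1 - t) * (3/4) \<le> 2 * (1 - t) * ((1 + x^2) - (1 + t) * j / (1 + j))"
      using t by (intro mult_left_mono) auto
    also have "\<dots> = 2 * (1 - t) * (1 + x^2) - 2 * (1 - t^2) * j / (1 + j)"
      by (simp add: algebra_simps power2_eq_square diff_divide_distrib add_divide_distrib)
    finally show ?thesis by simp
  qed
  have third: "2 * (t / r - x)^2 * j * (1 - j) / (1 + j)^2 \<ge> 0" using j by simp
  have num: "3/2 * (1 - t) \<ge> 2 * t^2"
  proof -
    have "t * t \<le> 5/9 * (5/9)" using t by (intro mult_mono) auto
    then show ?thesis using t by (simp add: power2_eq_square)
  qed
  have "log_curv2 t l x = ((l - 2 - 2 * t) * V + (2 * (1 - t) * (1 + x^2) - 2 * (1 - t^2) * j / (1 + j)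
      + 2 * (t / r - x)^2 * j * (1 - j) / (1 + j)^2)) / D^2"
    unfolding log_curv2_def r_def[symmetric] D_def[symmetric] j_def[symmetric] V_def U_def[symmetric]
    using D by (simp add: add_divide_distrib power2_eq_square)
  also have "\<dots> \<ge> 0" using first second third num by (intro divide_nonneg_nonneg) auto
  finally show ?thesis .
qed

end

section \<open>The truncated exponential and its comparison with the norm side\<close>

definition exp_tail :: "real \<Rightarrow> real" where "exp_tail z = exp z - 1 - z"

lemma exp_tail_pos: "z \<noteq> 0 \<Longrightarrow> exp_tail z > 0"
  using exp_ge_add_one_self_aux exp_gt_one[of z]
  unfolding exp_tail_def by (smt (verit) exp_minus_greater)

text \<open>
  A negative value of \<open>h\<close> would force its second derivative to change sign as \<open>-, +, -\<close>.
\<close>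

lemma nonneg_if_second_derivative_pattern:
  fixes h h1 h2 :: "real \<Rightarrow> real"
  assumes c: "continuous_on {0..1} h" and c1: "continuous_on {0..1} h1"
    and d: "\<And>x. 0 < x \<Longrightarrow> x < 1 \<Longrightarrow> (h has_real_derivative h1 x) (at x)"
    and d1: "\<And>x. 0 < x \<Longrightarrow> x < 1 \<Longrightarrow> (h1 has_real_derivative h2 x) (at x)"
    and ends: "0 \<le> h 0" "h1 0 = 0" "h 1 = 0" "h1 1 = 0"
    and pattern: "\<And>x y z. 0 < x \<Longrightarrow> x < y \<Longrightarrow> y < z \<Longrightarrow> z < 1 \<Longrightarrow> h2 x < 0 \<Longrightarrow> h2 z < 0 \<Longrightarrow> h2 y \<le> 0"
    and x: "0 \<le> x" "x \<le> 1"
  shows "0 \<le> h x"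
proof (rule ccontr)
  assume "\<not> 0 \<le> h x"
  then have neg: "h x < 0" by simp
  then have x01: "0 < x" "x < 1" using ends x by (auto simp: less_le)
  have mvt: "\<exists>z. a < z \<and> z < b \<and> k b - k a = (b - a) * k' z"
    if "a < b" "0 \<le> a" "b \<le> 1" "continuous_on {0..1} k"
      "\<And>x. 0 < x \<Longrightarrow> x < 1 \<Longrightarrow> (k has_real_derivative k' x) (at x)" for a b k k'
  proof -
    have "continuous_on {a..b} k" using that(4) by (rule continuous_on_subset) (use that in auto)
    moreover have "(k has_derivative (*) (k' z)) (at z)" if "a < z" "z < b" for z
      using that \<open>0 \<le> a\<close> \<open>b \<le> 1\<close> \<open>\<And>x. 0 < x \<Longrightarrow> x < 1 \<Longrightarrow> (k has_real_derivative k' x) (at x)\<close>[of z]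
      by (simp add: has_field_derivative_def)
    ultimately show ?thesis using mvt[OF \<open>a < b\<close>, of k "\<lambda>z. (*) (k' z)"] by (metis mult.commute)
  qed
  \<comment> \<open>The function falls from \<open>h 0\<close> to a negative value and rises back to
    0, so \<open>h1\<close> is negative at some \<open>a\<close> left of \<open>x\<close> and
    positive at some \<open>b\<close> right of it. As \<open>h1\<close> vanishes at both ends,
    \<open>h2\<close> is negative before \<open>a\<close>, positive between \<open>a\<close> and
    \<open>b\<close>, and negative after \<open>b\<close>.\<close>
  obtain a where a: "0 < a" "a < x" "h x - h 0 = (x - 0) * h1 a"
    using mvt[OF x01(1) _ _ c d] x01 by auto
  obtain b where b: "x < b" "b < 1" "h 1 - h x = (1 - x) * h1 b"
    using mvt[OF x01(2) _ _ c d] x01 by auto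
  have "x * h1 a < 0" using a(3) ends(1) neg by auto
  then have ha: "h1 a < 0" using x01 by (simp add: mult_less_0_iff)
  have "0 < (1 - x) * h1 b" using b(3) ends(3) neg by auto
  then have hb: "h1 b > 0" using x01 by (simp add: zero_less_mult_iff)
  obtain p where p: "0 < p" "p < a" "h1 a - h1 0 = (a - 0) * h2 p"
    using mvt[OF a(1) _ _ c1 d1] x01 a by auto
  obtain q where q: "a < q" "q < b" "h1 b - h1 a = (b - a) * h2 q"
    using mvt[OF _ _ _ c1 d1, of a b] x01 a b by auto
  obtain r where r: "b < r" "r < 1" "h1 1 - h1 b = (1 - b) * h2 r"
    using mvt[OF b(2) _ _ c1 d1] x01 b by auto
  have "a * h2 p < 0" using p(3) ends(2) ha by auto
  then have "h2 p < 0" using a by (simp add: mult_less_0_iff)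
  moreover have "(1 - b) * h2 r < 0" using r(3) ends(4) hb by auto
  then have "h2 r < 0" using b by (simp add: mult_less_0_iff)
  moreover have "0 < (b - a) * h2 q" using q(3) ha hb by auto
  then have "h2 q > 0" using a b by (simp add: zero_less_mult_iff)
  ultimately show False using pattern[of p q r] p q r by auto
qed

lemma log_curv_convex:
  assumes "0 < t" "t \<le> 5/9" "2 \<le> l" "t * (l - 1) \<le> 1"
  shows "convex_on {0<..<1} (log_curv t l)"
  using log_curv_deriv[OF assms] log_curv1_deriv[OF assms] log_curv2_nonneg[OF assms]
  by (intro f''_ge0_imp_convex[where f' = "log_curv1 t l" and f'' = "log_curv2 t l"]) auto

text \<open>
  Both sides agree to first order at \<open>x = 1\<close> by the choice of \<open>l\<close>. The second derivative of the left-hand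
  side is a multiple of \<open>exp (x z)\<close>, hence log-linear, whereas that of the right-hand side is log-convex;
  so the difference has no \<open>-, +, -\<close> pattern of curvature.
\<close>

lemma two_point_inequality:
  fixes z t l x :: real
  assumes z: "z > 0" and l_def: "z * (exp z - 1) = l * exp_tail z"
    and t: "0 < t" "t \<le> 5/9" and l: "2 \<le> l" "t * (l - 1) \<le> 1"
    and x: "0 \<le> x" "x \<le> 1"
  shows "1 + exp_tail (x * z) / exp_tail z \<le> 2 powr (1 - l * t / (1 + t)) * pow_mean t x powr (l / (1 + t))"
proof -
  define C where "C = 2 powr (1 - l * t / (1 + t))"
  define e where "e = l / (1 + t)"
  have C: "C > 0" by (simp add: C_def)
  have el: "e * (1 + t) = l" using t by (simp add: e_def)
  have fz: "exp_tail z > 0" using exp_tail_pos z by simp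
  define h where "h = (\<lambda>x. C * pow_mean t x powr e - 1 - exp_tail (x * z) / exp_tail z)"
  define h1 where "h1 = (\<lambda>x. C * (l / 2) * pow_mean t x powr (e - 1) * pow_diff t x - z * (exp (x * z) - 1) / exp_tail z)"
  define h2 where "h2 = (\<lambda>x. C * l * t * exp (log_curv t l x) - z^2 * exp (x * z) / exp_tail z)"
  have m: "pow_mean t x > 0" if "0 \<le> x" "x \<le> 1" for x using that pow_mean_pos by simp
  have "0 \<le> h x"
  proof (rule nonneg_if_second_derivative_pattern[where h = h and ?h1.0 = h1 and ?h2.0 = h2])
    have cm: "continuous_on {0..1} (pow_mean t)"
      unfolding pow_mean_def using t by (intro continuous_intros continuous_on_powr') auto
    have cd: "continuous_on {0..1} (pow_diff t)"
      unfolding pow_diff_def using t by (intro continuous_intros continuous_on_powr') auto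
    have cp: "continuous_on {0..1} (\<lambda>x. pow_mean t x powr a)" for a
      using m by (intro continuous_on_powr cm continuous_on_const) (auto simp: less_imp_neq[THEN not_sym])
    show "continuous_on {0..1} h" unfolding h_def exp_tail_def[of "_ * z"]
      by (intro continuous_intros cp) (use fz in auto)
    show "continuous_on {0..1} h1" unfolding h1_def
      by (intro continuous_intros cp cd) (use fz in auto)
  next
    fix x :: real assume x: "0 < x" "x < 1"
    have md: "(pow_mean t has_real_derivative (1 + t) * pow_diff t x / 2) (at x)"
      using pow_mean_deriv x by simp
    have dd: "(pow_diff t has_real_derivative
       t * (pow_sum t x - x * pow_diff t x) / (1 - x^2)) (at x)" using pow_diff_deriv x by simp
    have mp: "pow_mean t x > 0" using m x by simp
    have pd: "((\<lambda>x. pow_mean t x powr a) has_real_derivative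
       a * pow_mean t x powr (a - 1) * ((1 + t) * pow_diff t x / 2)) (at x)" for a
      using mp by (auto intro!: derivative_eq_intros md simp: powr_diff)
    have "(h has_real_derivative C * (e * pow_mean t x powr (e - 1) * ((1 + t) * pow_diff t x / 2))
        - z * (exp (x * z) - 1) / exp_tail z) (at x)"
    proof -
      have "((\<lambda>x. exp_tail (x * z) / exp_tail z) has_real_derivative (z * (exp (x * z) - 1)) / exp_tail z) (at x)"
      proof (rule DERIV_cdivide)
        show "((\<lambda>x. exp_tail (x * z)) has_real_derivative z * (exp (x * z) - 1)) (at x)"
          unfolding exp_tail_def by (auto intro!: derivative_eq_intros simp: algebra_simps)
      qed
      from DERIV_diff[OF DERIV_diff[OF DERIV_cmult[OF pd[of e], of C] DERIV_const[of 1]] this]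
      show ?thesis unfolding h_def by simp
    qed
    moreover have "C * (e * pow_mean t x powr (e - 1) * ((1 + t) * pow_diff t x / 2))
      = C * ((e * (1 + t)) / 2) * pow_mean t x powr (e - 1) * pow_diff t x" by simp
    ultimately show "(h has_real_derivative h1 x) (at x)" unfolding h1_def el by (simp only:)
    define u where "u = pow_diff t x"
    define v where "v = pow_sum t x"
    define D where "D = 1 - x^2"
    define Q where "Q = pow_mean t x"
    have D: "D > 0" using x by (simp add: D_def abs_square_less_1)
    have v: "v > 0" using pow_sum_pos x by (simp add: v_def)
    have uv: "v^2 - u^2 = 4 * D powr t" using pow_sum_diff_sq[of x t] x by (simp add: u_def v_def D_def)
    have Q: "Q = (v + x * u) / 2" "Q > 0" using pow_mean_eq[of x t] x mp by (simp_all add: u_def v_def Q_def)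
    have "(h1 has_real_derivative
        C * (l / 2) * ((e - 1) * Q powr (e - 2) * ((1 + t) * u / 2) * u +
         Q powr (e - 1) * (t * (v - x * u) / D)) - z^2 * exp (x * z) / exp_tail z) (at x)"
    proof -
      have "((\<lambda>x. pow_mean t x powr (e - 1)) has_real_derivative
        (e - 1) * Q powr (e - 2) * ((1 + t) * u / 2)) (at x)"
        using pd[of "e - 1"] by (simp add: Q_def u_def)
      note mult = DERIV_cmult[OF DERIV_mult[OF this dd], of "C * (l / 2)"]
      have ex: "((\<lambda>x. z * (exp (x * z) - 1) / exp_tail z) has_real_derivative (z^2 * exp (x * z)) / exp_tail z) (at x)"
      proof (rule DERIV_cdivide)
        show "((\<lambda>x. z * (exp (x * z) - 1)) has_real_derivative z^2 * exp (x * z)) (at x)"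
          by (auto intro!: derivative_eq_intros simp: power2_eq_square)
      qed
      have "C * (l / 2) * ((e - 1) * Q powr (e - 2) * ((1 + t) * u / 2) * pow_diff t x +
          t * (pow_sum t x - x * pow_diff t x) / (1 - x^2) * pow_mean t x powr (e - 1))
        = C * (l / 2) * ((e - 1) * Q powr (e - 2) * ((1 + t) * u / 2) * u + Q powr (e - 1) * (t * (v - x * u) / D))"
        by (simp add: u_def v_def D_def Q_def mult.commute)
      then show ?thesis using DERIV_diff[OF mult ex] unfolding h1_def by (simp only: mult.assoc)
    qed
    moreover have "(l / 2) * ((e - 1) * Q powr (e - 2) * ((1 + t) * u / 2) * u +
         Q powr (e - 1) * (t * (v - x * u) / D)) = l * t * exp (log_curv t l x)"
    proof -
      \<comment> \<open>Once \<open>Q powr (e - 2)\<close> is factored out, both sides reduce to the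
        same sum by \<open>v^2 - u^2 = 4 * D powr t\<close>.\<close>
      have "Q powr (e - 1) = Q powr (e - 2) * Q powr 1" unfolding powr_add[symmetric] by simp
      then have Qe: "Q powr (e - 1) = Q powr (e - 2) * Q" using Q(2) by simp
      have "curv_ratio t l x = t * (l - 1) * (u^2 / v^2) * D / (t^2 * (1 - u^2 / v^2))"
        unfolding curv_ratio_def pow_ratio_def by (simp add: u_def v_def D_def power_divide)
      also have "1 - u^2 / v^2 = 4 * D powr t / v^2" unfolding uv[symmetric] using v by (simp add: diff_divide_distrib)
      also have "t * (l - 1) * (u^2 / v^2) * D / (t^2 * (4 * D powr t / v^2))
         = t * (l - 1) * u^2 * D / (4 * t^2 * D powr t)" using v by simp
      finally have J: "curv_ratio t l x = t * (l - 1) * u^2 * D / (4 * t^2 * D powr t)" .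
      have Jp: "0 < curv_ratio t l x" using curv_ratio_bounds[OF t l x] by simp
      have "exp (log_curv t l x) = Q powr (e - 2) * (1 + curv_ratio t l x) * (D powr t / D)"
      proof -
        have "exp (log_curv t l x) = exp ((e - 2) * ln Q) * exp (ln (1 + curv_ratio t l x)) * exp ((t - 1) * ln D)"
          unfolding log_curv_def exp_add[symmetric] Q_def D_def e_def by (simp add: algebra_simps)
        moreover have "exp ((e - 2) * ln Q) = Q powr (e - 2)" "exp ((t - 1) * ln D) = D powr t / D"
          using Q(2) D by (simp_all add: powr_def left_diff_distrib exp_diff)
        ultimately show ?thesis using Jp by simp
      qed
      also have "\<dots> = Q powr (e - 2) * ((1 + curv_ratio t l x) * (D powr t / D))" by simp
      also have "(1 + curv_ratio t l x) * (D powr t / D) = D powr t / D + (l - 1) * u^2 / (4 * t)"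
        unfolding J using D t by (simp add: field_simps power2_eq_square)
      finally have E: "exp (log_curv t l x) = Q powr (e - 2) * (D powr t / D + (l - 1) * u^2 / (4 * t))" .
      have "(l / 2) * ((e - 1) * Q powr (e - 2) * ((1 + t) * u / 2) * u + Q powr (e - 1) * (t * (v - x * u) / D))
         = l * Q powr (e - 2) * (((e * (1 + t)) - 1 - t) * u^2 / 4 + t * (Q * 2) * (v - x * u) / (4 * D))"
        unfolding Qe using D by (simp add: field_simps power2_eq_square)
      also have "\<dots> = l * Q powr (e - 2) * ((l - 1 - t) * u^2 / 4 + t * ((v^2 - u^2) + D * u^2) / (4 * D))"
      proof -
        have q2: "Q * 2 = v + x * u" by (simp add: Q(1))
        have "Q * 2 * (v - x * u) = (v^2 - u^2) + D * u^2"
          unfolding q2 D_def by (simp add: algebra_simps power2_eq_square)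
        then have "t * (Q * 2) * (v - x * u) = t * ((v^2 - u^2) + D * u^2)" by (simp only: mult.assoc)
        then show ?thesis unfolding el by (simp only:)
      qed
      also have "\<dots> = l * Q powr (e - 2) * (t * (D powr t / D + (l - 1) * u^2 / (4 * t)))"
      proof -
        define P where "P = Q powr (e - 2)"
        show ?thesis unfolding uv P_def[symmetric] using D t by (simp add: field_simps)
      qed
      finally show ?thesis unfolding E by (simp add: algebra_simps)
    qed
    ultimately show "(h1 has_real_derivative h2 x) (at x)"
      unfolding h2_def by (simp only: mult.assoc)
  next
    have C1: "1 \<le> C"
    proof -
      have "l * t \<le> 1 + t" using l t by (simp add: algebra_simps)
      then show ?thesis unfolding C_def using t by (intro ge_one_powr_ge_zero) (auto simp: field_simps)
    qed
    then show "0 \<le> h 0" by (simp add: h_def pow_mean_def exp_tail_def)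
    show "h1 0 = 0" by (simp add: h1_def pow_diff_def)
    have m1: "pow_mean t 1 = 2 powr t" using t by (simp add: pow_mean_def powr_add)
    have d1: "pow_diff t 1 = 2 powr t" using t by (simp add: pow_diff_def)
    \<comment> \<open>The constant \<open>C\<close> is normalised so that both sides of the
      inequality equal 2 at \<open>x = 1\<close>. The equation \<open>h1 1 = 0\<close> is then the
      assumption \<open>l_def\<close>.\<close>
    have Ce: "C * 2 powr (t * e) = 2"
      unfolding C_def powr_add[symmetric] by (simp add: e_def mult.commute)
    show "h 1 = 0"
      unfolding h_def m1 powr_powr Ce using fz by simp
    have "t * (e - 1) + t = t * e" by (simp add: algebra_simps)
    then have "C * 2 powr (t * (e - 1)) * 2 powr t = 2"
      using Ce by (simp add: mult.assoc powr_add[symmetric])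
    then have "C * (l / 2) * 2 powr (t * (e - 1)) * 2 powr t = l" by simp
    then show "h1 1 = 0"
      unfolding h1_def m1 d1 powr_powr using l_def fz by simp
  next
    fix x y w :: real
    assume xyw: "0 < x" "x < y" "y < w" "w < 1" "h2 x < 0" "h2 w < 0"
    \<comment> \<open>\<open>L\<close> is the logarithm of the quotient of the two terms of
      \<open>h2\<close>, so it has the same sign as \<open>h2\<close>. It is convex as the sum of
      \<open>log_curv\<close> and an affine function.\<close>
    define L where "L = (\<lambda>x. log_curv t l x + ((- z) * x - ln (z^2 / exp_tail z / (C * l * t))))"
    have pos: "C * l * t > 0" using C l t by simp
    have k: "z^2 / exp_tail z / (C * l * t) > 0" using fz z pos by simp
    have iff: "(h2 x < 0 \<longleftrightarrow> L x < 0) \<and> (h2 x \<le> 0 \<longleftrightarrow> L x \<le> 0)" for x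
    proof -
      define k where "k = z^2 / exp_tail z / (C * l * t)"
      have kp: "k > 0" using k by (simp add: k_def)
      have "h2 x = C * l * t * (exp (log_curv t l x) - k * exp (x * z))"
        unfolding h2_def k_def using C l t by (simp add: field_simps)
      moreover have "k * exp (x * z) = exp (ln k + x * z)" using kp by (simp add: exp_add)
      ultimately have "h2 x = C * l * t * (exp (log_curv t l x) - exp (ln k + x * z))" by simp
      moreover have "L x = log_curv t l x - (ln k + x * z)" by (simp add: L_def k_def)
      moreover have "A * (exp X - exp Y) < 0 \<longleftrightarrow> X - Y < 0" "A * (exp X - exp Y) \<le> 0 \<longleftrightarrow> X - Y \<le> 0"
        if "A > 0" for A X Y :: real
        using that by (simp_all add: mult_less_0_iff mult_le_0_iff)
      ultimately show ?thesis using pos by metis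
    qed
    have cl: "convex_on {0<..<1} L" unfolding L_def
      by (intro convex_on_add log_curv_convex t l)
         (auto simp: convex_on_def algebra_simps simp flip: distrib_right)
    define p where "p = (y - x) / (w - x)"
    have p: "0 \<le> p" "p \<le> 1" using xyw by (auto simp: p_def)
    have "p * (w - x) = y - x" using xyw by (simp add: p_def)
    then have "y = (1 - p) *\<^sub>R x + p *\<^sub>R w" by (simp add: algebra_simps)
    then have "L y = L ((1 - p) *\<^sub>R x + p *\<^sub>R w)" by (rule arg_cong)
    also have "\<dots> \<le> (1 - p) * L x + p * L w"
      using xyw p by (intro convex_onD[OF cl]) auto
    also have "\<dots> \<le> 0" using xyw iff p
      by (intro add_nonpos_nonpos mult_nonneg_nonpos) (auto simp: less_imp_le)
    finally show "h2 y \<le> 0" using iff[of y] by simp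
  qed (use x in auto)
  then show ?thesis by (simp add: h_def C_def e_def)
qed

section \<open>Maps with large fibres and even intersections\<close>

text \<open>For \<open>R = {}\<close> the parity condition is vacuous and only the condition on the
  fibre sizes remains.\<close>

definition even_maps :: "'a set \<Rightarrow> 'b set \<Rightarrow> 'a set \<Rightarrow> ('a \<Rightarrow> 'b) set" where
  "even_maps M C R = {\<phi> \<in> M \<rightarrow>\<^sub>E C. \<forall>c\<in>C. 2 \<le> card {r \<in> M. \<phi> r = c} \<and> even (card {r \<in> R. \<phi> r = c})}"

lemma finite_even_maps: "finite M \<Longrightarrow> finite C \<Longrightarrow> finite (even_maps M C R)"
  unfolding even_maps_def by (rule finite_subset[of _ "M \<rightarrow>\<^sub>E C"]) (auto intro: finite_PiE)

section \<open>Generating-function bound by recursion over the columns\<close>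

lemma card_even_maps_no_cols: "card (even_maps M ({} :: 'b set) R) = (if M = {} then 1 else 0)"
proof (cases "M = {}")
  case True
  then have "even_maps M ({} :: 'b set) R = {\<lambda>_. undefined}" by (auto simp: even_maps_def)
  then show ?thesis using True by simp
next
  case False
  then have "even_maps M ({} :: 'b set) R = {}" by (auto simp: even_maps_def)
  then show ?thesis using False by simp
qed

text \<open>A map is determined by the fibre \<open>S\<close> of the new column and its restriction
  to the rows outside \<open>S\<close>; gluing these two is the inverse. The conditions on the
  remaining columns involve only the restriction.\<close>

lemma card_even_maps_insert:
  assumes "finite M" "finite C" "c \<notin> C" "R \<subseteq> M"
  shows "card (even_maps M (insert c C) R)
    = (\<Sum>S | S \<subseteq> M \<and> 2 \<le> card S \<and> even (card (S \<inter> R)). card (even_maps (M - S) C (R - S)))"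
proof -
  let ?I = "{S. S \<subseteq> M \<and> 2 \<le> card S \<and> even (card (S \<inter> R))}"
  have fI: "finite ?I" using assms by auto
  have "bij_betw (\<lambda>\<phi>. ({r \<in> M. \<phi> r = c}, restrict \<phi> (M - {r \<in> M. \<phi> r = c})))
     (even_maps M (insert c C) R) (SIGMA S:?I. even_maps (M - S) C (R - S))"
  proof (rule bij_betw_byWitness[where f' = "\<lambda>(S, \<psi>) r. if r \<in> S then c else \<psi> r"])
    show "\<forall>\<phi>\<in>even_maps M (insert c C) R.
       (\<lambda>(S, \<psi>) r. if r \<in> S then c else \<psi> r) ({r \<in> M. \<phi> r = c}, restrict \<phi> (M - {r \<in> M. \<phi> r = c})) = \<phi>"
      by (auto simp: even_maps_def fun_eq_iff PiE_def extensional_def)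
    show "\<forall>p\<in>SIGMA S:?I. even_maps (M - S) C (R - S).
       ({r \<in> M. (case p of (S, \<psi>) \<Rightarrow> \<lambda>r. if r \<in> S then c else \<psi> r) r = c},
        restrict (case p of (S, \<psi>) \<Rightarrow> \<lambda>r. if r \<in> S then c else \<psi> r)
          (M - {r \<in> M. (case p of (S, \<psi>) \<Rightarrow> \<lambda>r. if r \<in> S then c else \<psi> r) r = c})) = p"
    proof
      fix p assume "p \<in> (SIGMA S:?I. even_maps (M - S) C (R - S))"
      then obtain S \<psi> where p_eq: "p = (S, \<psi>)" and S: "S \<subseteq> M"
        and p: "\<psi> \<in> even_maps (M - S) C (R - S)" by auto
      have "\<psi> r \<noteq> c" if "r \<in> M - S" for r using p that assms(3) by (auto simp: even_maps_def)
      then have e: "{r \<in> M. (if r \<in> S then c else \<psi> r) = c} = S" using S by auto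
      have "restrict (\<lambda>r. if r \<in> S then c else \<psi> r) (M - S) = \<psi>"
        using p by (auto simp: even_maps_def fun_eq_iff PiE_def extensional_def)
      then show "({r \<in> M. (case p of (S, \<psi>) \<Rightarrow> \<lambda>r. if r \<in> S then c else \<psi> r) r = c},
        restrict (case p of (S, \<psi>) \<Rightarrow> \<lambda>r. if r \<in> S then c else \<psi> r)
          (M - {r \<in> M. (case p of (S, \<psi>) \<Rightarrow> \<lambda>r. if r \<in> S then c else \<psi> r) r = c})) = p"
        by (simp add: e p_eq)
    qed
    show "(\<lambda>\<phi>. ({r \<in> M. \<phi> r = c}, restrict \<phi> (M - {r \<in> M. \<phi> r = c}))) ` even_maps M (insert c C) R
       \<subseteq> (SIGMA S:?I. even_maps (M - S) C (R - S))"
    proof safe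
      fix \<phi> assume p: "\<phi> \<in> even_maps M (insert c C) R"
      let ?S = "{r \<in> M. \<phi> r = c}"
      show "2 \<le> card ?S" using p by (simp add: even_maps_def)
      have "?S \<inter> R = {r \<in> R. \<phi> r = c}" using assms(4) by auto
      then show "even (card (?S \<inter> R))" using p by (simp add: even_maps_def)
      have "restrict \<phi> (M - ?S) \<in> (M - ?S) \<rightarrow>\<^sub>E C" using p by (auto simp: even_maps_def)
      moreover have "{r \<in> M - ?S. restrict \<phi> (M - ?S) r = d} = {r \<in> M. \<phi> r = d}"
         "{r \<in> R - ?S. restrict \<phi> (M - ?S) r = d} = {r \<in> R. \<phi> r = d}" if "d \<in> C" for d
        using that assms(3,4) by auto
      ultimately show "restrict \<phi> (M - ?S) \<in> even_maps (M - ?S) C (R - ?S)"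
        using p by (simp add: even_maps_def)
    qed
    show "(\<lambda>(S, \<psi>) r. if r \<in> S then c else \<psi> r) ` (SIGMA S:?I. even_maps (M - S) C (R - S))
       \<subseteq> even_maps M (insert c C) R"
    proof safe
      fix S \<psi> assume S: "S \<subseteq> M" "2 \<le> card S" "even (card (S \<inter> R))" and p: "\<psi> \<in> even_maps (M - S) C (R - S)"
      let ?\<phi> = "\<lambda>r. if r \<in> S then c else \<psi> r"
      have nc: "\<psi> r \<noteq> c" if "r \<in> M - S" for r using p that assms(3) by (auto simp: even_maps_def)
      have "\<psi> r \<in> C" if "r \<in> M - S" for r using p that by (auto simp: even_maps_def)
      then have 1: "?\<phi> \<in> M \<rightarrow>\<^sub>E insert c C" using p S by (auto simp: even_maps_def PiE_def extensional_def)
      have 2: "{r \<in> M. ?\<phi> r = c} = S" "{r \<in> R. ?\<phi> r = c} = S \<inter> R" using nc S assms(4) by auto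
      have 3: "{r \<in> M. ?\<phi> r = d} = {r \<in> M - S. \<psi> r = d}"
        "{r \<in> R. ?\<phi> r = d} = {r \<in> R - S. \<psi> r = d}" if "d \<in> C" for d
        using that assms(3) by auto
      show "?\<phi> \<in> even_maps M (insert c C) R"
        using 1 2 3 S p unfolding even_maps_def by auto
    qed
  qed
  then have "card (even_maps M (insert c C) R) = card (SIGMA S:?I. even_maps (M - S) C (R - S))"
    by (rule bij_betw_same_card)
  also have "\<dots> = (\<Sum>S\<in>?I. card (even_maps (M - S) C (R - S)))"
    using assms fI by (intro card_SigmaI) (auto intro: finite_even_maps)
  finally show ?thesis .
qed

lemma sum_Pow_card:
  assumes "finite X"
  shows "(\<Sum>A\<in>Pow X. g (card A)) = (\<Sum>i\<le>card X. of_nat (card X choose i) * (g i :: real))"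
proof -
  have "(\<Sum>A\<in>Pow X. g (card A)) = (\<Sum>i\<le>card X. \<Sum>A | A \<in> Pow X \<and> card A = i. g (card A))"
    using assms by (intro sum.group[symmetric]) (auto intro: card_mono)
  also have "\<dots> = (\<Sum>i\<le>card X. of_nat (card X choose i) * g i)"
    using n_subsets[OF assms] by (intro sum.cong) auto
  finally show ?thesis .
qed

lemma sum_Pow_card_two:
  assumes "finite M" "R \<subseteq> M"
  shows "(\<Sum>S\<in>Pow M. g (card (S \<inter> R)) (card (S - R)))
    = (\<Sum>i\<le>card R. \<Sum>j\<le>card (M - R). of_nat (card R choose i) * of_nat (card (M - R) choose j) * (g i j :: real))"
proof -
  have "(\<Sum>S\<in>Pow M. g (card (S \<inter> R)) (card (S - R)))
     = (\<Sum>(A,B)\<in>Pow R \<times> Pow (M - R). g (card A) (card B))"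
    using assms
    by (intro sum.reindex_bij_witness[where i = "\<lambda>(A,B). A \<union> B" and j = "\<lambda>S. (S \<inter> R, S - R)"])
      (auto intro!: arg_cong2[of _ _ _ _ g] arg_cong[of _ _ card])
  also have "\<dots> = (\<Sum>A\<in>Pow R. \<Sum>B\<in>Pow (M - R). g (card A) (card B))"
    by (simp add: sum.cartesian_product)
  also have "\<dots> = (\<Sum>A\<in>Pow R. \<Sum>j\<le>card (M - R). of_nat (card (M - R) choose j) * g (card A) j)"
    using assms by (intro sum.cong sum_Pow_card) auto
  also have "\<dots> = (\<Sum>i\<le>card R. of_nat (card R choose i) * (\<Sum>j\<le>card (M - R). of_nat (card (M - R) choose j) * g i j))"
    using assms finite_subset by (intro sum_Pow_card) auto
  finally show ?thesis by (simp add: sum_distrib_left mult.assoc)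
qed

text \<open>The full double series over even \<open>i\<close> is \<open>cosh x * exp y\<close>. The
  terms of total degree below two that it contains are 1 and y; the term x is already excluded by
  parity.\<close>

lemma sum_even_exp_terms_le:
  fixes x y :: real
  assumes "x \<ge> 0" "y \<ge> 0"
  shows "(\<Sum>i\<le>a. \<Sum>j\<le>b. if even i \<and> 2 \<le> i + j then x^i / fact i * (y^j / fact j) else 0)
    \<le> cosh x * exp y - 1 - y"
proof -
  let ?p = "\<lambda>i. if even i then x^i / fact i else 0" and ?q = "\<lambda>j. y^j / fact j"
  let ?T = "\<lambda>i j. if even i \<and> 2 \<le> i + j then x^i / fact i * (y^j / fact j) else 0"
  have p: "?p i \<ge> 0" and q: "?q i \<ge> 0" for i using assms by auto
  have "(\<lambda>n. if even n then x^n /\<^sub>R fact n else 0) sums cosh x" by (rule cosh_converges)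
  then have sp: "?p sums cosh x" by (simp add: divide_inverse mult.commute if_distrib cong: if_cong)
  have sq: "?q sums exp y" using exp_converges[of y] by (simp add: divide_inverse mult.commute)
  \<comment> \<open>Enlarging both ranges by two ensures that the terms for \<open>i = 0\<close> and
    \<open>j < 2\<close>, which are subtracted next, really occur.\<close>
  have "(\<Sum>i\<le>a. \<Sum>j\<le>b. ?T i j) \<le> (\<Sum>i\<le>a+2. \<Sum>j\<le>b+2. ?T i j)"
    using assms by (intro order_trans[OF sum_mono sum_mono2] sum_mono2 sum_nonneg) auto
  also have "\<dots> = (\<Sum>i\<le>a+2. \<Sum>j\<le>b+2. ?p i * ?q j - (if i = 0 \<and> j < 2 then y^j else 0))"
  proof (intro sum.cong refl)
    fix i j :: nat
    show "?T i j = ?p i * ?q j - (if i = 0 \<and> j < 2 then y^j else 0)"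
      by (cases "i = 0"; cases "j = 0"; cases "j = 1"; cases "i = 1") auto
  qed
  also have "\<dots> = (\<Sum>i\<le>a+2. ?p i) * (\<Sum>j\<le>b+2. ?q j) - (\<Sum>i\<le>a+2. \<Sum>j\<le>b+2. if i = 0 \<and> j < 2 then y^j else 0)"
    by (simp only: sum_subtractf sum_product)
  also have "(\<Sum>i\<le>a+2. \<Sum>j\<le>b+2. if i = 0 \<and> j < 2 then y^j else 0) = (\<Sum>i\<in>{0::nat}. \<Sum>j<2. y^j)"
  proof -
    have "(\<Sum>i\<le>a+2. \<Sum>j\<le>b+2. if i = 0 \<and> j < 2 then y^j else 0)
       = (\<Sum>i\<le>a+2. if i = 0 then (\<Sum>j\<le>b+2. if j < 2 then y^j else 0) else 0)"
      by (intro sum.cong) auto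
    also have "\<dots> = (\<Sum>j\<le>b+2. if j < 2 then y^j else 0)" by (simp add: sum.delta)
    also have "\<dots> = (\<Sum>j<2. y^j)"
      by (rule sum.mono_neutral_cong_right) auto
    finally show ?thesis by simp
  qed
  also have "\<dots> = 1 + y" by (simp add: numeral_2_eq_2)
  also have "(\<Sum>i\<le>a+2. ?p i) * (\<Sum>j\<le>b+2. ?q j) \<le> cosh x * exp y"
  proof (intro mult_mono)
    show "(\<Sum>i\<le>a+2. ?p i) \<le> cosh x"
      unfolding sums_unique[OF sp] using p by (intro sum_le_suminf sums_summable[OF sp]) auto
    show "(\<Sum>j\<le>b+2. ?q j) \<le> exp y"
      unfolding sums_unique[OF sq] using q by (intro sum_le_suminf sums_summable[OF sq]) auto
    show "0 \<le> (\<Sum>j\<le>b+2. ?q j)" using q by (intro sum_nonneg) simp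
  qed simp
  finally show ?thesis by simp
qed

text \<open>One coefficient of a power series with nonnegative coefficients, times its monomial, is
  at most the value of the series. Each column contributes one factor, the exponential generating
  function of fibres with at least two rows and an even number of rows in \<open>R\<close>, where
  \<open>x\<close> marks the rows in \<open>R\<close> and \<open>y\<close> the others. The induction
  removes one column together with its fibre.\<close>

lemma card_even_maps_gf_bound:
  fixes x y :: real
  assumes "finite C" "finite M" "R \<subseteq> M" "x \<ge> 0" "y \<ge> 0"
  shows "real (card (even_maps M C R)) * (x ^ card R / fact (card R)) * (y ^ card (M - R) / fact (card (M - R)))
    \<le> (cosh x * exp y - 1 - y) ^ card C"
  using assms(1-3)
proof (induction C arbitrary: M R rule: finite_induct)
  case empty
  then show ?case by (auto simp: card_even_maps_no_cols)
next
  case (insert c C)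
  let ?r = "card R" and ?q = "card (M - R)" and ?H = "cosh x * exp y - 1 - y"
  define e where "e = (\<lambda>(x::real) n. x ^ n / fact n)"
  have e0: "e x n \<ge> 0" if "x \<ge> 0" for x n using that by (simp add: e_def)
  have fR: "finite R" using insert finite_subset by auto
  define W where "W = (\<lambda>i j::nat. if even i \<and> 2 \<le> i + j then (1::real) else 0)"
  have H0: "?H \<ge> 0" using sum_even_exp_terms_le[OF assms(4,5), of 0 0] by simp
  have "real (card (even_maps M (insert c C) R)) * e x ?r * e y ?q
    = (\<Sum>S | S \<subseteq> M \<and> 2 \<le> card S \<and> even (card (S \<inter> R)). real (card (even_maps (M - S) C (R - S))) * e x ?r * e y ?q)"
    using card_even_maps_insert[OF insert.prems(1) insert.hyps(1,2) insert.prems(2)]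
    by (simp add: sum_distrib_right)
  also have "\<dots> = (\<Sum>S\<in>Pow M. W (card (S \<inter> R)) (card (S - R)) * (real (card (even_maps (M - S) C (R - S))) * e x ?r * e y ?q))"
  proof (rule sum.mono_neutral_cong_left)
    have cS: "card S = card (S \<inter> R) + card (S - R)" if "S \<subseteq> M" for S
      using that insert.prems finite_subset[of S M] by (subst card_Un_disjoint[symmetric]) (auto intro: arg_cong[of _ _ card])
    show "\<forall>i\<in>Pow M - {S. S \<subseteq> M \<and> 2 \<le> card S \<and> even (card (S \<inter> R))}.
       W (card (i \<inter> R)) (card (i - R)) * (real (card (even_maps (M - i) C (R - i))) * e x ?r * e y ?q) = 0"
    proof
      fix S assume S: "S \<in> Pow M - {S. S \<subseteq> M \<and> 2 \<le> card S \<and> even (card (S \<inter> R))}"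
      then have "card S = card (S \<inter> R) + card (S - R)" using cS[of S] by blast
      then have "W (card (S \<inter> R)) (card (S - R)) = 0" using S unfolding W_def by auto
      then show "W (card (S \<inter> R)) (card (S - R)) * (real (card (even_maps (M - S) C (R - S))) * e x ?r * e y ?q) = 0"
        by simp
    qed
    show "real (card (even_maps (M - S) C (R - S))) * e x ?r * e y ?q =
      W (card (S \<inter> R)) (card (S - R)) * (real (card (even_maps (M - S) C (R - S))) * e x ?r * e y ?q)"
      if "S \<in> {S. S \<subseteq> M \<and> 2 \<le> card S \<and> even (card (S \<inter> R))}" for S
    proof -
      have "card S = card (S \<inter> R) + card (S - R)" using that cS[of S] by blast
      then have "W (card (S \<inter> R)) (card (S - R)) = 1" using that unfolding W_def by auto
      then show ?thesis by simp
    qed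
  qed (use insert.prems in auto)
  also have "\<dots> \<le> (\<Sum>S\<in>Pow M. W (card (S \<inter> R)) (card (S - R)) * (?H ^ card C *
      (e x (card (S \<inter> R)) / of_nat (?r choose card (S \<inter> R)) *
      (e y (card (S - R)) / of_nat (?q choose card (S - R))))))"
  proof (intro sum_mono mult_left_mono)
    fix S assume "S \<in> Pow M"
    then have S: "S \<subseteq> M" by simp
    let ?i = "card (S \<inter> R)" and ?j = "card (S - R)"
    have i: "?i \<le> ?r" "?j \<le> ?q"
      by (rule card_mono, use insert.prems S fR in auto)+
    have cR: "card (R - S) = ?r - ?i"
      using fR card_Diff_subset_Int[of R S] by (simp add: Int_commute)
    have "M - S - (R - S) = (M - R) - (S - R)" by auto
    moreover have "card ((M - R) - (S - R)) = ?q - ?j"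
      using insert.prems S finite_subset[of S M] by (intro card_Diff_subset) auto
    ultimately have cM: "card (M - S - (R - S)) = ?q - ?j" by simp
    have "real (card (even_maps (M - S) C (R - S))) * e x (?r - ?i) * e y (?q - ?j) \<le> ?H ^ card C"
      using insert.IH[of "M - S" "R - S"] insert.prems unfolding cR cM e_def by auto
    then have "real (card (even_maps (M - S) C (R - S))) * e x (?r - ?i) * e y (?q - ?j) *
       (e x ?i / of_nat (?r choose ?i) * (e y ?j / of_nat (?q choose ?j))) \<le>
       ?H ^ card C * (e x ?i / of_nat (?r choose ?i) * (e y ?j / of_nat (?q choose ?j)))"
      using e0 assms by (intro mult_right_mono) auto
    \<comment> \<open>The weight factors into that of the rows outside the fibre and that of the
      fibre divided by a binomial coefficient. This coefficient cancels against the number of fibres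
      with the same intersection sizes.\<close>
    moreover have split: "e x k = e x (k - i) * (e x i / of_nat (k choose i))" if "i \<le> k" for x k i
      using that by (simp add: e_def binomial_fact power_add[symmetric])
    have sx: "e x ?r = e x (?r - ?i) * (e x ?i / of_nat (?r choose ?i))" by (rule split[OF i(1)])
    have sy: "e y ?q = e y (?q - ?j) * (e y ?j / of_nat (?q choose ?j))" by (rule split[OF i(2)])
    have "real (card (even_maps (M - S) C (R - S))) * e x ?r * e y ?q =
       real (card (even_maps (M - S) C (R - S))) * e x (?r - ?i) * e y (?q - ?j) *
       (e x ?i / of_nat (?r choose ?i) * (e y ?j / of_nat (?q choose ?j)))"
      by (subst sx, subst sy) (simp only: mult_ac)
    ultimately show "real (card (even_maps (M - S) C (R - S))) * e x ?r * e y ?q \<le>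
       ?H ^ card C * (e x ?i / of_nat (?r choose ?i) * (e y ?j / of_nat (?q choose ?j)))"
      by simp
  qed (auto simp: W_def)
  also have "\<dots> = (\<Sum>i\<le>?r. \<Sum>j\<le>?q. of_nat (?r choose i) * of_nat (?q choose j) *
      (W i j * (?H ^ card C * (e x i / of_nat (?r choose i) * (e y j / of_nat (?q choose j))))))"
    using insert.prems by (rule sum_Pow_card_two)
  also have "\<dots> = (\<Sum>i\<le>?r. \<Sum>j\<le>?q. ?H ^ card C * (if even i \<and> 2 \<le> i + j then e x i * e y j else 0))"
    by (intro sum.cong refl) (auto simp: W_def)
  also have "\<dots> = ?H ^ card C * (\<Sum>i\<le>?r. \<Sum>j\<le>?q. if even i \<and> 2 \<le> i + j then e x i * e y j else 0)"
    by (simp add: sum_distrib_left)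
  also have "\<dots> \<le> ?H ^ card C * ?H"
    unfolding e_def by (intro mult_left_mono sum_even_exp_terms_le assms) (use H0 in simp)
  finally show ?case using insert.hyps by (simp add: e_def mult.commute)
qed

section \<open>Exponential generating function of maps with fibres of size at least two\<close>

definition exp_tail_fps :: "real fps" where "exp_tail_fps = fps_exp 1 - 1 - fps_X"

lemma exp_tail_fps_nth: "fps_nth exp_tail_fps k = (if 2 \<le> k then 1 / fact k else 0)"
  by (cases k; cases "k - 1") (auto simp: exp_tail_fps_def field_simps)

text \<open>
  By \<open>card_even_maps_empty\<close> below, this counts the maps from \<open>m\<close> rows to \<open>n\<close> columns whose fibres all
  have at least two elements.
\<close>

definition cover_num :: "nat \<Rightarrow> nat \<Rightarrow> real" where
  "cover_num m n = fact m * fps_nth (exp_tail_fps ^ n) m"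

lemma cover_num_nonneg: "0 \<le> cover_num m n"
proof -
  have "0 \<le> fps_nth (exp_tail_fps ^ n) m" for m
    by (induction n arbitrary: m) (auto simp: fps_mult_nth exp_tail_fps_nth intro!: sum_nonneg)
  then show ?thesis by (simp add: cover_num_def)
qed

lemma card_even_maps_empty:
  assumes "finite C" "finite M"
  shows "real (card (even_maps M C {})) = cover_num (card M) (card C)"
  using assms
proof (induction C arbitrary: M rule: finite_induct)
  case empty
  then show ?case by (auto simp: card_even_maps_no_cols cover_num_def)
next
  case (insert c C)
  let ?m = "card M" and ?n = "card C"
  have "real (card (even_maps M (insert c C) {}))
     = (\<Sum>S | S \<subseteq> M \<and> 2 \<le> card S. cover_num (card (M - S)) ?n)"
    using card_even_maps_insert[OF insert.prems insert.hyps(1,2), of "{}"] insert.IH insert.prems by simp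
  also have "\<dots> = (\<Sum>S\<in>Pow M. if 2 \<le> card S then cover_num (?m - card S) ?n else 0)"
    using insert.prems
    by (intro sum.mono_neutral_cong_left) (auto simp: card_Diff_subset finite_subset)
  also have "\<dots> = (\<Sum>k\<le>?m. of_nat (?m choose k) * (if 2 \<le> k then cover_num (?m - k) ?n else 0))"
    using insert.prems by (intro sum_Pow_card[where g = "\<lambda>k. if 2 \<le> k then cover_num (?m - k) ?n else 0"])
  also have "\<dots> = (\<Sum>k\<le>?m. fact ?m * (fps_nth exp_tail_fps k * fps_nth (exp_tail_fps ^ ?n) (?m - k)))"
    by (intro sum.cong) (auto simp: cover_num_def exp_tail_fps_nth binomial_fact)
  also have "\<dots> = cover_num ?m (Suc ?n)"
    by (simp add: cover_num_def fps_mult_nth sum_distrib_left atLeast0AtMost)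
  finally show ?case using insert.hyps by simp
qed

text \<open>The series f = \<open>exp_tail_fps\<close> satisfies f' = f + X; compare coefficients in
  the derivative of its power. Combinatorially, the last row chooses a column and either joins a
  fibre that is large enough without it or forms a fibre of size two with one of the other
  \<open>m\<close> rows.\<close>

lemma cover_num_Suc_Suc:
  "cover_num (Suc m) (Suc n) = real (Suc n) * (cover_num m (Suc n) + real m * cover_num (m - 1) n)"
proof -
  have "fps_deriv exp_tail_fps = exp_tail_fps + fps_X"
    by (simp add: exp_tail_fps_def)
  then have "fps_deriv (exp_tail_fps ^ Suc n) = fps_const (real (Suc n)) * (exp_tail_fps ^ Suc n + fps_X * exp_tail_fps ^ n)"
    using fps_deriv_power[of exp_tail_fps "Suc n"] by (simp add: algebra_simps del: of_nat_Suc)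
  then have "fps_nth (fps_deriv (exp_tail_fps ^ Suc n)) m
     = fps_nth (fps_const (real (Suc n)) * (exp_tail_fps ^ Suc n + fps_X * exp_tail_fps ^ n)) m"
    by simp
  then have "real (Suc m) * fps_nth (exp_tail_fps ^ Suc n) (Suc m) = real (Suc n) *
     (fps_nth (exp_tail_fps ^ Suc n) m + (if m = 0 then 0 else fps_nth (exp_tail_fps ^ n) (m - 1)))"
    by (simp del: power_Suc of_nat_Suc)
  then have "fact m * (real (Suc m) * fps_nth (exp_tail_fps ^ Suc n) (Suc m)) = fact m * (real (Suc n) *
     (fps_nth (exp_tail_fps ^ Suc n) m + (if m = 0 then 0 else fps_nth (exp_tail_fps ^ n) (m - 1))))"
    by simp
  then show ?thesis unfolding cover_num_def
    by (cases m) (simp_all add: algebra_simps del: power_Suc)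
qed

text \<open>Each of the two nonnegative summands of the recurrence is at most their sum. These
  inequalities price the removal of a row and of a two-element fibre, respectively.\<close>

lemma cover_num_removal:
  assumes "0 < n" "1 < m"
  shows "real n * cover_num (m - 1) n \<le> cover_num m n"
    and "real n * cover_num (m - 2) (n - 1) \<le> cover_num m n / real (m - 1)"
proof -
  obtain n' where n: "n = Suc n'" using assms by (cases n) auto
  obtain m' where m: "m = Suc (Suc m')" using assms by (cases m; cases "m - 1") auto
  have e: "cover_num m n = real n * cover_num (m - 1) n + real (m - 1) * (real n * cover_num (m - 2) (n - 1))"
    using cover_num_Suc_Suc[of "Suc m'" n'] unfolding n m by (simp add: algebra_simps)
  show "real n * cover_num (m - 1) n \<le> cover_num m n"
    unfolding e using cover_num_nonneg by simp
  show "real n * cover_num (m - 2) (n - 1) \<le> cover_num m n / real (m - 1)"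
    using assms cover_num_nonneg[of "m - 1" n] unfolding e by (simp add: le_divide_eq mult_ac)
qed

section \<open>Small row sets: successive removal of colliding pairs\<close>

text \<open>
  Either the common fibre of \<open>r\<close> and \<open>r'\<close> has a third element and \<open>r\<close> may be dropped, or the fibre is
  \<open>{r, r'}\<close> and disappears together with its column.
\<close>

lemma card_even_maps_pair:
  assumes M: "finite M" "finite C" "R \<subseteq> M" and r: "r \<in> R" "r' \<in> R" "r \<noteq> r'"
  shows "card {\<phi> \<in> even_maps M C R. \<phi> r' = \<phi> r}
    \<le> card (even_maps (M - {r}) C (R - {r, r'})) + (\<Sum>c\<in>C. card (even_maps (M - {r, r'}) (C - {c}) (R - {r, r'})))"
proof -
  let ?P = "{\<phi> \<in> even_maps M C R. \<phi> r' = \<phi> r}"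
  let ?R = "R - {r, r'}"
  define A where "A = {\<phi> \<in> ?P. 3 \<le> card {x \<in> M. \<phi> x = \<phi> r}}"
  define B where "B = (\<lambda>c. {\<phi> \<in> ?P. \<phi> r = c \<and> card {x \<in> M. \<phi> x = c} = 2})"
  have rM: "r \<in> M" "r' \<in> M" using assms by auto
  have fR: "finite R" using M finite_subset by auto
  have fin: "finite (even_maps M C R)" by (rule finite_even_maps[OF M(1,2)])
  \<comment> \<open>Both \<open>r\<close> and \<open>r'\<close> leave \<open>R\<close>, even in the
    case where \<open>r'\<close> stays a row. Since they lie in the same fibre, every parity is
    preserved.\<close>
  have even_R: "even (card {x \<in> ?R. \<phi> x = d})" if "\<phi> \<in> ?P" "d \<in> C" for \<phi> d
  proof (cases "d = \<phi> r")
    case True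
    have "{x \<in> ?R. \<phi> x = d} = {x \<in> R. \<phi> x = d} - {r, r'}" by auto
    moreover have "card ({x \<in> R. \<phi> x = d} - {r, r'}) = card {x \<in> R. \<phi> x = d} - 2"
      using that r True fR by (subst card_Diff_subset) auto
    moreover have "even (card {x \<in> R. \<phi> x = d})" using that by (simp add: even_maps_def)
    ultimately show ?thesis by simp
  next
    case False
    then have "{x \<in> ?R. \<phi> x = d} = {x \<in> R. \<phi> x = d}" using that by auto
    then show ?thesis using that by (simp add: even_maps_def)
  qed
  have "card A \<le> card (even_maps (M - {r}) C ?R)"
  proof (rule card_inj_on_le[where f = "\<lambda>\<phi>. restrict \<phi> (M - {r})"])
    show "inj_on (\<lambda>\<phi>. restrict \<phi> (M - {r})) A"
    proof
      fix \<phi> \<psi> assume h: "\<phi> \<in> A" "\<psi> \<in> A" "restrict \<phi> (M - {r}) = restrict \<psi> (M - {r})"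
      have e: "\<phi> x = \<psi> x" if "x \<in> M - {r}" for x using fun_cong[OF h(3), of x] that by simp
      have "\<phi> r = \<psi> r" using e[of r'] h(1,2) rM r by (simp add: A_def)
      then have "\<phi> x = \<psi> x" if "x \<in> M" for x using e that by (cases "x = r") auto
      moreover have "\<phi> \<in> M \<rightarrow>\<^sub>E C" "\<psi> \<in> M \<rightarrow>\<^sub>E C" using h by (auto simp: A_def even_maps_def)
      ultimately show "\<phi> = \<psi>" by (intro PiE_ext) auto
    qed
    show "(\<lambda>\<phi>. restrict \<phi> (M - {r})) ` A \<subseteq> even_maps (M - {r}) C ?R"
    proof clarify
      fix \<phi> assume p: "\<phi> \<in> A"
      then have pP: "\<phi> \<in> ?P" and p3: "3 \<le> card {x \<in> M. \<phi> x = \<phi> r}" by (auto simp: A_def)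
      have "2 \<le> card {x \<in> M - {r}. \<phi> x = d}" if d: "d \<in> C" for d
      proof (cases "d = \<phi> r")
        case True
        have "{x \<in> M - {r}. \<phi> x = d} = {x \<in> M. \<phi> x = d} - {r}" by auto
        then show ?thesis using p3 True rM by (simp add: card_Diff_singleton)
      next
        case False
        then have "{x \<in> M - {r}. \<phi> x = d} = {x \<in> M. \<phi> x = d}" by auto
        then show ?thesis using pP d by (simp add: even_maps_def)
      qed
      moreover have "{x \<in> M - {r}. restrict \<phi> (M - {r}) x = d} = {x \<in> M - {r}. \<phi> x = d}"
        "{x \<in> ?R. restrict \<phi> (M - {r}) x = d} = {x \<in> ?R. \<phi> x = d}" for d
        using M by auto
      moreover have "restrict \<phi> (M - {r}) \<in> (M - {r}) \<rightarrow>\<^sub>E C" using pP by (auto simp: even_maps_def)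
      ultimately show "restrict \<phi> (M - {r}) \<in> even_maps (M - {r}) C ?R"
        using even_R[OF pP] by (simp add: even_maps_def)
    qed
  qed (use M in \<open>auto intro: finite_even_maps\<close>)
  moreover have "card (B c) \<le> card (even_maps (M - {r, r'}) (C - {c}) ?R)" if c: "c \<in> C" for c
  proof (rule card_inj_on_le[where f = "\<lambda>\<phi>. restrict \<phi> (M - {r, r'})"])
    show "inj_on (\<lambda>\<phi>. restrict \<phi> (M - {r, r'})) (B c)"
    proof
      fix \<phi> \<psi> assume h: "\<phi> \<in> B c" "\<psi> \<in> B c" "restrict \<phi> (M - {r, r'}) = restrict \<psi> (M - {r, r'})"
      have e: "\<phi> x = \<psi> x" if "x \<in> M - {r, r'}" for x using fun_cong[OF h(3), of x] that by simp
      have "\<phi> r = \<psi> r" "\<phi> r' = \<psi> r'" using h(1,2) by (auto simp: B_def)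
      then have "\<phi> x = \<psi> x" if "x \<in> M" for x using e that by (cases "x = r"; cases "x = r'") auto
      moreover have "\<phi> \<in> M \<rightarrow>\<^sub>E C" "\<psi> \<in> M \<rightarrow>\<^sub>E C" using h by (auto simp: B_def even_maps_def)
      ultimately show "\<phi> = \<psi>" by (intro PiE_ext) auto
    qed
    show "(\<lambda>\<phi>. restrict \<phi> (M - {r, r'})) ` B c \<subseteq> even_maps (M - {r, r'}) (C - {c}) ?R"
    proof clarify
      fix \<phi> assume p: "\<phi> \<in> B c"
      then have pP: "\<phi> \<in> ?P" and p2: "\<phi> r = c" "card {x \<in> M. \<phi> x = c} = 2" by (auto simp: B_def)
      have "{r, r'} \<subseteq> {x \<in> M. \<phi> x = c}" using rM p2 pP by auto
      moreover have "card {r, r'} = 2" using r by simp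
      ultimately have fib: "{x \<in> M. \<phi> x = c} = {r, r'}"
        using p2(2) M by (metis (no_types, lifting) card_subset_eq finite_Collect_conjI finite_subset mem_Collect_eq subsetI)
      have nc: "\<phi> x \<noteq> c" if "x \<in> M - {r, r'}" for x using fib that by auto
      have "2 \<le> card {x \<in> M - {r, r'}. \<phi> x = d}" if d: "d \<in> C - {c}" for d
      proof -
        have "{x \<in> M - {r, r'}. \<phi> x = d} = {x \<in> M. \<phi> x = d}" using d p2 pP by auto
        then show ?thesis using pP d by (simp add: even_maps_def)
      qed
      moreover have "{x \<in> M - {r, r'}. restrict \<phi> (M - {r, r'}) x = d} = {x \<in> M - {r, r'}. \<phi> x = d}"
        "{x \<in> ?R. restrict \<phi> (M - {r, r'}) x = d} = {x \<in> ?R. \<phi> x = d}" for d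
        using M by auto
      moreover have "restrict \<phi> (M - {r, r'}) \<in> (M - {r, r'}) \<rightarrow>\<^sub>E (C - {c})"
        using pP nc by (auto simp: even_maps_def)
      ultimately show "restrict \<phi> (M - {r, r'}) \<in> even_maps (M - {r, r'}) (C - {c}) ?R"
        using even_R[OF pP] by (simp add: even_maps_def)
    qed
  qed (use M in \<open>auto intro: finite_even_maps\<close>)
  then have "(\<Sum>c\<in>C. card (B c)) \<le> (\<Sum>c\<in>C. card (even_maps (M - {r, r'}) (C - {c}) ?R))"
    by (intro sum_mono)
  moreover have "?P \<subseteq> A \<union> (\<Union>c\<in>C. B c)"
  proof
    fix \<phi> assume p: "\<phi> \<in> ?P"
    then have c: "\<phi> r \<in> C" using rM by (auto simp: even_maps_def)
    then have "2 \<le> card {x \<in> M. \<phi> x = \<phi> r}" using p by (simp add: even_maps_def)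
    then consider "3 \<le> card {x \<in> M. \<phi> x = \<phi> r}" | "card {x \<in> M. \<phi> x = \<phi> r} = 2" by linarith
    then show "\<phi> \<in> A \<union> (\<Union>c\<in>C. B c)" using p c by cases (auto simp: A_def B_def)
  qed
  then have "card ?P \<le> card (A \<union> (\<Union>c\<in>C. B c))"
    using fin M by (intro card_mono) (auto simp: A_def B_def)
  moreover have "card (A \<union> (\<Union>c\<in>C. B c)) \<le> card A + (\<Sum>c\<in>C. card (B c))"
    by (rule order_trans[OF card_Un_le add_left_mono[OF card_UN_le[OF M(2)]]])
  ultimately show ?thesis by linarith
qed

text \<open>The fibre of a fixed \<open>r\<close> in \<open>R\<close> meets \<open>R\<close> in an
  even number of rows, so it contains a second element of \<open>R\<close>, for which there are at
  most \<open>L\<close> choices. By \<open>card_even_maps_pair\<close> and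
  \<open>cover_num_removal\<close> each choice costs a factor 1/n0 + 1/m0. The numbers
  \<open>n0\<close> and \<open>m0\<close> bound the columns and rows left throughout all
  \<open>q\<close> removals.\<close>

lemma card_even_maps_small:
  assumes "finite M" "finite C" "R \<subseteq> M" "card R = 2 * q" "2 * q \<le> L"
    and "n0 + q \<le> card C" "m0 + 2 * q \<le> card M" and pos: "0 < n0" "0 < m0"
  shows "real (card (even_maps M C R)) \<le> (real L * (1 / real n0 + 1 / real m0)) ^ q * cover_num (card M) (card C)"
  using assms(1-7)
proof (induction q arbitrary: M C R)
  case 0
  then have "R = {}" using finite_subset[OF 0(3,1)] by simp
  then show ?case using card_even_maps_empty[OF 0(2,1)] by simp
next
  case (Suc q)
  let ?X = "real L * (1 / real n0 + 1 / real m0)"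
  let ?m = "card M" and ?n = "card C"
  have fR: "finite R" using Suc finite_subset by auto
  obtain r where r: "r \<in> R" using Suc.prems(4) by fastforce
  have X: "?X ^ q \<ge> 0" using pos by simp
  have n: "0 < ?n" "n0 \<le> ?n" and m: "1 < ?m" "m0 \<le> ?m - 1" using Suc.prems pos by auto
  let ?P = "\<lambda>r'. {\<phi> \<in> even_maps M C R. \<phi> r' = \<phi> r}"
  have "even_maps M C R \<subseteq> (\<Union>r'\<in>R - {r}. ?P r')"
  proof
    fix \<phi> assume p: "\<phi> \<in> even_maps M C R"
    then have "\<phi> r \<in> C" using r Suc.prems by (auto simp: even_maps_def)
    then have e: "even (card {x \<in> R. \<phi> x = \<phi> r})" using p by (simp add: even_maps_def)
    have "{x \<in> R. \<phi> x = \<phi> r} \<noteq> {r}" using e by auto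
    then obtain r' where "r' \<in> R" "\<phi> r' = \<phi> r" "r' \<noteq> r" using r by blast
    then show "\<phi> \<in> (\<Union>r'\<in>R - {r}. ?P r')" using p by auto
  qed
  then have "card (even_maps M C R) \<le> card (\<Union>r'\<in>R - {r}. ?P r')"
    using fR Suc.prems by (intro card_mono) (auto simp: finite_even_maps)
  also have "\<dots> \<le> (\<Sum>r'\<in>R - {r}. card (?P r'))" using fR by (intro card_UN_le) auto
  finally have "real (card (even_maps M C R)) \<le> real (\<Sum>r'\<in>R - {r}. card (?P r'))"
    by (rule of_nat_mono)
  also have "\<dots> = (\<Sum>r'\<in>R - {r}. real (card (?P r')))" by (rule of_nat_sum)
  also have "\<dots> \<le> (\<Sum>r'\<in>R - {r}. ?X ^ q * ((1 / real n0 + 1 / real m0) * cover_num ?m ?n))"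
  proof (intro sum_mono)
    fix r' assume r': "r' \<in> R - {r}"
    let ?R = "R - {r, r'}"
    have sub: "{r, r'} \<subseteq> R" "{r, r'} \<subseteq> M" "card {r, r'} = 2" using r r' Suc.prems(3) by auto
    have cR: "card ?R = 2 * q" using card_Diff_subset[OF _ sub(1)] sub(3) Suc.prems(4) by simp
    have rM: "r \<in> M" "r' \<in> M" using r r' Suc.prems by auto
    have subs: "?R \<subseteq> M - {r}" "?R \<subseteq> M - {r, r'}" using Suc.prems(3) by auto
    have c1: "card (M - {r}) = ?m - 1" using rM by simp
    have c2: "card (M - {r, r'}) = ?m - 2" using card_Diff_subset[OF _ sub(2)] sub(3) by simp
    have "real (card (?P r')) \<le> real (card (even_maps (M - {r}) C ?R) + (\<Sum>c\<in>C. card (even_maps (M - {r, r'}) (C - {c}) ?R)))"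
      using card_even_maps_pair[of M C R r r'] r r' Suc.prems by (intro of_nat_mono) auto
    also have "\<dots> = real (card (even_maps (M - {r}) C ?R)) + (\<Sum>c\<in>C. real (card (even_maps (M - {r, r'}) (C - {c}) ?R)))"
      by simp
    also have "\<dots> \<le> ?X ^ q * cover_num (?m - 1) ?n + (\<Sum>c\<in>C. ?X ^ q * cover_num (?m - 2) (?n - 1))"
    proof (intro add_mono sum_mono)
      show "real (card (even_maps (M - {r}) C ?R)) \<le> ?X ^ q * cover_num (?m - 1) ?n"
        using Suc.IH[of "M - {r}" C ?R] Suc.prems cR c1 subs by simp
      show "real (card (even_maps (M - {r, r'}) (C - {c}) ?R)) \<le> ?X ^ q * cover_num (?m - 2) (?n - 1)" if "c \<in> C" for c
        using Suc.IH[of "M - {r, r'}" "C - {c}" ?R] Suc.prems cR c2 that subs by simp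
    qed
    also have "\<dots> = ?X ^ q * (cover_num (?m - 1) ?n + real ?n * cover_num (?m - 2) (?n - 1))"
      by (simp add: algebra_simps)
    also have "\<dots> \<le> ?X ^ q * ((1 / real n0 + 1 / real m0) * cover_num ?m ?n)"
    proof (intro mult_left_mono X)
      have "cover_num (?m - 1) ?n \<le> cover_num ?m ?n / real ?n"
        using cover_num_removal(1)[OF n(1) m(1)] n by (simp add: field_simps)
      also have "\<dots> \<le> cover_num ?m ?n / real n0"
        using n pos cover_num_nonneg by (intro divide_left_mono) auto
      finally have 1: "cover_num (?m - 1) ?n \<le> cover_num ?m ?n / real n0" .
      have "real ?n * cover_num (?m - 2) (?n - 1) \<le> cover_num ?m ?n / real (?m - 1)"
        by (rule cover_num_removal(2)[OF n(1) m(1)])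
      also have "\<dots> \<le> cover_num ?m ?n / real m0"
        using m pos cover_num_nonneg by (intro divide_left_mono) auto
      finally show "cover_num (?m - 1) ?n + real ?n * cover_num (?m - 2) (?n - 1) \<le> (1 / real n0 + 1 / real m0) * cover_num ?m ?n"
        using 1 by (simp add: algebra_simps)
    qed
    finally show "real (card (?P r')) \<le> ?X ^ q * ((1 / real n0 + 1 / real m0) * cover_num ?m ?n)" .
  qed
  also have "\<dots> = real (card (R - {r})) * (?X ^ q * ((1 / real n0 + 1 / real m0) * cover_num ?m ?n))" by simp
  also have "\<dots> \<le> real L * (?X ^ q * ((1 / real n0 + 1 / real m0) * cover_num ?m ?n))"
    using Suc.prems r fR X pos cover_num_nonneg by (intro mult_right_mono) auto
  finally show ?case by (simp add: mult_ac)
qed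

section \<open>Expected number of critical row sets\<close>

definition block_offset :: "(nat \<Rightarrow> nat) \<Rightarrow> nat \<Rightarrow> nat" where
  "block_offset n j = (\<Sum>i\<in>{1..<j}. n i)"

lemma block_offset_Suc: "1 \<le> j \<Longrightarrow> block_offset n (Suc j) = block_offset n j + n j"
  by (simp add: block_offset_def)

lemma block_offset_mono: "i \<le> j \<Longrightarrow> block_offset n i \<le> block_offset n j"
  unfolding block_offset_def by (intro sum_mono2) auto

lemma total_cols_eq: "total_cols K n = block_offset n (Suc K)"
  by (simp add: total_cols_def block_offset_def atLeastLessThanSuc_atLeastAtMost)

lemma block_offset_less_total:
  assumes "j \<in> {1..K}" "c < n j"
  shows "block_offset n j + c < total_cols K n"
  using block_offset_mono[of "Suc j" "Suc K" n] block_offset_Suc[of j n] assms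
  by (simp add: total_cols_eq)

lemma block_offset_inj:
  assumes "1 \<le> j" "1 \<le> j'" "c < n j" "c' < n j'" "block_offset n j + c = block_offset n j' + c'"
  shows "j = j' \<and> c = c'"
proof -
  have False if "i < i'" "1 \<le> i" "b < n i" "block_offset n i + b = block_offset n i' + b'" for i i' b b'
    using block_offset_mono[of "Suc i" i' n] block_offset_Suc[of i n] that by simp
  then have "j = j'" using assms by (metis linorder_neqE_nat)
  then show ?thesis using assms by simp
qed

lemma block_offset_surj:
  assumes "k < total_cols K n"
  shows "\<exists>j\<in>{1..K}. \<exists>c<n j. k = block_offset n j + c"
  using assms unfolding total_cols_eq
proof (induction K)
  case 0
  then show ?case by (simp add: block_offset_def)
next
  case (Suc K)
  show ?case
  proof (cases "k < block_offset n (Suc K)")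
    case True
    then show ?thesis using Suc.IH by force
  next
    case False
    then have "k = block_offset n (Suc K) + (k - block_offset n (Suc K))"
      "k - block_offset n (Suc K) < n (Suc K)"
      using Suc.prems block_offset_Suc[of "Suc K" n] by auto
    then show ?thesis by (intro bexI[of _ "Suc K"]) auto
  qed
qed

definition maps_matrix :: "nat \<Rightarrow> nat \<Rightarrow> (nat \<Rightarrow> nat) \<Rightarrow> (nat \<Rightarrow> nat \<Rightarrow> nat) \<Rightarrow> bit mat" where
  "maps_matrix K m n \<phi> = mat m (total_cols K n)
     (\<lambda>(r, k). if \<exists>j\<in>{1..K}. k = block_offset n j + \<phi> j r then 1 else 0)"

definition block_maps :: "nat \<Rightarrow> nat \<Rightarrow> (nat \<Rightarrow> nat) \<Rightarrow> nat set \<Rightarrow> (nat \<Rightarrow> nat \<Rightarrow> nat) set" where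
  "block_maps K m n R = (\<Pi>\<^sub>E j\<in>{1..K}. even_maps {..<m} {..<n j} R)"

lemma maps_matrix_entry:
  assumes "\<And>j. j \<in> {1..K} \<Longrightarrow> \<phi> j r < n j" "j \<in> {1..K}" "c < n j" "r < m"
  shows "maps_matrix K m n \<phi> $$ (r, block_offset n j + c) = (if \<phi> j r = c then 1 else 0)"
proof -
  have "(\<exists>i\<in>{1..K}. block_offset n j + c = block_offset n i + \<phi> i r) \<longleftrightarrow> \<phi> j r = c"
  proof
    assume "\<exists>i\<in>{1..K}. block_offset n j + c = block_offset n i + \<phi> i r"
    then obtain i where i: "i \<in> {1..K}" "block_offset n j + c = block_offset n i + \<phi> i r" by auto
    then have "j = i \<and> c = \<phi> i r" using assms by (intro block_offset_inj[of _ _ _ n]) auto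
    then show "\<phi> j r = c" by simp
  qed (use assms in auto)
  then show ?thesis
    using assms block_offset_less_total[of j K c n] by (simp add: maps_matrix_def)
qed

lemma col_block_entry:
  "r < dim_row \<Gamma> \<Longrightarrow> c < n j \<Longrightarrow> col_block n \<Gamma> j $$ (r, c) = \<Gamma> $$ (r, block_offset n j + c)"
  by (simp add: col_block_def block_offset_def)

lemma Psi_iff:
  "\<Gamma> \<in> Psi K m n \<longleftrightarrow> \<Gamma> \<in> carrier_mat m (total_cols K n) \<and> (\<forall>j\<in>{1..K}.
     (\<forall>r<m. card {c. c < n j \<and> \<Gamma> $$ (r, block_offset n j + c) = 1} = 1) \<and>
     (\<forall>c<n j. 2 \<le> card {r. r < m \<and> \<Gamma> $$ (r, block_offset n j + c) = 1}))"
proof -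
  have "{c. c < n j \<and> col_block n \<Gamma> j $$ (r, c) = 1} = {c. c < n j \<and> \<Gamma> $$ (r, block_offset n j + c) = 1}"
    if "\<Gamma> \<in> carrier_mat m (total_cols K n)" "r < m" for r j
    using that by (auto simp: col_block_entry)
  moreover have "{r. r < m \<and> col_block n \<Gamma> j $$ (r, c) = 1} = {r. r < m \<and> \<Gamma> $$ (r, block_offset n j + c) = 1}"
    if "\<Gamma> \<in> carrier_mat m (total_cols K n)" "c < n j" for c j
    using that by (auto simp: col_block_entry)
  ultimately show ?thesis unfolding Psi_def by auto
qed

lemma block_maps_bound:
  assumes "\<phi> \<in> block_maps K m n R" "j \<in> {1..K}" "r < m"
  shows "\<phi> j r < n j"
  using assms by (auto simp: block_maps_def even_maps_def PiE_def Pi_def)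

lemma block_maps_mono: "block_maps K m n R \<subseteq> block_maps K m n {}"
  unfolding block_maps_def by (intro PiE_mono) (auto simp: even_maps_def)

text \<open>The single 1 in row \<open>r\<close> of block \<open>j\<close> sits in column
  \<open>\<phi> j r\<close>, and the rows with a 1 in a given column form a fibre. So the column
  condition of \<open>Psi\<close> is the condition on fibre sizes.\<close>

lemma bij_betw_maps_matrix: "bij_betw (maps_matrix K m n) (block_maps K m n {}) (Psi K m n)"
proof (intro bij_betw_imageI)
  show "inj_on (maps_matrix K m n) (block_maps K m n {})"
  proof
    fix \<phi> \<psi> assume h: "\<phi> \<in> block_maps K m n {}" "\<psi> \<in> block_maps K m n {}"
      "maps_matrix K m n \<phi> = maps_matrix K m n \<psi>"
    have "\<phi> j r = \<psi> j r" if "j \<in> {1..K}" "r < m" for j r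
    proof -
      have "maps_matrix K m n \<phi> $$ (r, block_offset n j + \<psi> j r) = (if \<phi> j r = \<psi> j r then 1 else 0)"
        using h that by (intro maps_matrix_entry) (auto intro: block_maps_bound)
      moreover have "maps_matrix K m n \<psi> $$ (r, block_offset n j + \<psi> j r) = (if \<psi> j r = \<psi> j r then 1 else 0)"
        using h that by (intro maps_matrix_entry) (auto intro: block_maps_bound)
      ultimately show ?thesis using h(3) by (auto split: if_splits)
    qed
    moreover have "\<phi> j \<in> {..<m} \<rightarrow>\<^sub>E {..<n j}" "\<psi> j \<in> {..<m} \<rightarrow>\<^sub>E {..<n j}" if "j \<in> {1..K}" for j
      using PiE_mem[OF h(1)[unfolded block_maps_def] that] PiE_mem[OF h(2)[unfolded block_maps_def] that]
      by (simp_all add: even_maps_def)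
    ultimately have "\<phi> j = \<psi> j" if "j \<in> {1..K}" for j
      using that by (intro PiE_ext[where k = "{..<m}" and s = "\<lambda>_. {..<n j}"]) auto
    then show "\<phi> = \<psi>" using h(1,2) unfolding block_maps_def by (intro PiE_ext) auto
  qed
  show "maps_matrix K m n ` block_maps K m n {} = Psi K m n"
  proof
    show "maps_matrix K m n ` block_maps K m n {} \<subseteq> Psi K m n"
    proof clarify
      fix \<phi> assume h: "\<phi> \<in> block_maps K m n {}"
      have e: "maps_matrix K m n \<phi> $$ (r, block_offset n j + c) = (if \<phi> j r = c then 1 else 0)"
        if "j \<in> {1..K}" "c < n j" "r < m" for j c r
        using that block_maps_bound[OF h] by (intro maps_matrix_entry) auto
      have "card {c. c < n j \<and> maps_matrix K m n \<phi> $$ (r, block_offset n j + c) = 1} = 1"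
        if "j \<in> {1..K}" "r < m" for j r
      proof -
        have "{c. c < n j \<and> maps_matrix K m n \<phi> $$ (r, block_offset n j + c) = 1} = {\<phi> j r}"
          using block_maps_bound[OF h that] e[OF that(1) _ that(2)] by (auto split: if_splits)
        then show ?thesis by simp
      qed
      moreover have "2 \<le> card {r. r < m \<and> maps_matrix K m n \<phi> $$ (r, block_offset n j + c) = 1}"
        if "j \<in> {1..K}" "c < n j" for j c
      proof -
        have "{r. r < m \<and> maps_matrix K m n \<phi> $$ (r, block_offset n j + c) = 1} = {r \<in> {..<m}. \<phi> j r = c}"
          using that by (auto simp: e split: if_splits)
        then show ?thesis using h that by (auto simp: block_maps_def even_maps_def PiE_def Pi_def)
      qed
      ultimately show "maps_matrix K m n \<phi> \<in> Psi K m n"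
        unfolding Psi_iff by (auto simp: maps_matrix_def)
    qed
    show "Psi K m n \<subseteq> maps_matrix K m n ` block_maps K m n {}"
    proof
      fix \<Gamma> assume G: "\<Gamma> \<in> Psi K m n"
      \<comment> \<open>The description is unique because each row of a block has exactly one 1.
        Both levels are restricted to their index sets, as membership in the extensional function
        spaces demands.\<close>
      define \<phi> where "\<phi> = (\<lambda>j\<in>{1..K}. \<lambda>r\<in>{..<m}. THE c. c < n j \<and> \<Gamma> $$ (r, block_offset n j + c) = 1)"
      have dims: "dim_row \<Gamma> = m" "dim_col \<Gamma> = total_cols K n" using G by (auto simp: Psi_iff)
      have p: "\<phi> j r < n j \<and> (\<forall>c<n j. \<Gamma> $$ (r, block_offset n j + c) = 1 \<longleftrightarrow> \<phi> j r = c)"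
        if j: "j \<in> {1..K}" and r: "r < m" for j r
      proof -
        have "card {c. c < n j \<and> \<Gamma> $$ (r, block_offset n j + c) = 1} = 1"
          using G that by (auto simp: Psi_iff)
        then obtain c0 where c0: "{c. c < n j \<and> \<Gamma> $$ (r, block_offset n j + c) = 1} = {c0}"
          by (auto simp: card_1_singleton_iff)
        have c0': "(c < n j \<and> \<Gamma> $$ (r, block_offset n j + c) = 1) \<longleftrightarrow> c = c0" for c
          using eqset_imp_iff[OF c0, of c] by simp
        have "\<phi> j r = (THE c. c < n j \<and> \<Gamma> $$ (r, block_offset n j + c) = 1)"
          using that by (simp add: \<phi>_def)
        also have "\<dots> = c0" unfolding c0' by simp
        finally have e: "\<phi> j r = c0" .
        show ?thesis
        proof (intro conjI allI impI)
          show "\<phi> j r < n j" using c0'[of c0] e by simp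
          show "\<Gamma> $$ (r, block_offset n j + c) = 1 \<longleftrightarrow> \<phi> j r = c" if "c < n j" for c
          proof -
            have "\<Gamma> $$ (r, block_offset n j + c) = 1 \<longleftrightarrow> c = c0"
              using c0'[of c] that by (simp only: True_implies_equals simp_thms)
            then show ?thesis unfolding e by (simp only: eq_commute[of c c0])
          qed
        qed
      qed
      have "\<phi> \<in> block_maps K m n {}"
      proof -
        have "\<phi> j \<in> even_maps {..<m} {..<n j} {}" if j: "j \<in> {1..K}" for j
        proof -
          have "2 \<le> card {r \<in> {..<m}. \<phi> j r = c}" if "c < n j" for c
          proof -
            have "\<Gamma> $$ (r, block_offset n j + c) = 1 \<longleftrightarrow> \<phi> j r = c" if "r < m" for r
              using p[OF j that] \<open>c < n j\<close> by blast
            then have "{r \<in> {..<m}. \<phi> j r = c} = {r. r < m \<and> \<Gamma> $$ (r, block_offset n j + c) = 1}"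
              by blast
            moreover have "2 \<le> card {r. r < m \<and> \<Gamma> $$ (r, block_offset n j + c) = 1}"
              using G j that unfolding Psi_iff by blast
            ultimately show ?thesis by simp
          qed
          moreover have "\<phi> j \<in> {..<m} \<rightarrow>\<^sub>E {..<n j}" using p[OF j] j by (auto simp: \<phi>_def)
          ultimately show ?thesis by (auto simp: even_maps_def)
        qed
        then show ?thesis unfolding block_maps_def by (auto simp: \<phi>_def)
      qed
      moreover have "\<Gamma> = maps_matrix K m n \<phi>"
      proof (rule eq_matI)
        fix r k assume "r < dim_row (maps_matrix K m n \<phi>)" "k < dim_col (maps_matrix K m n \<phi>)"
        then have r: "r < m" and k: "k < total_cols K n" by (auto simp: maps_matrix_def)
        obtain j c where jc: "j \<in> {1..K}" "c < n j" "k = block_offset n j + c"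
          using block_offset_surj[OF k] by auto
        have "maps_matrix K m n \<phi> $$ (r, k) = (if \<phi> j r = c then 1 else 0)"
          unfolding jc(3) using p r jc by (intro maps_matrix_entry) auto
        also have "\<dots> = \<Gamma> $$ (r, k)"
          using p[OF jc(1) r] jc(2,3) by (cases "\<Gamma> $$ (r, k)") auto
        finally show "\<Gamma> $$ (r, k) = maps_matrix K m n \<phi> $$ (r, k)" by simp
      qed (use dims in \<open>auto simp: maps_matrix_def\<close>)
      ultimately show "\<Gamma> \<in> maps_matrix K m n ` block_maps K m n {}" by auto
    qed
  qed
qed

section \<open>Criticality as parity, and linearity of expectation\<close>

lemma of_nat_bit_eq_0_iff: "(of_nat k :: bit) = 0 \<longleftrightarrow> even k"
  by (induction k) auto

text \<open>In column \<open>c\<close> of block \<open>j\<close> the sum of the rows in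
  \<open>R\<close> is the number of rows of \<open>R\<close> that are mapped to \<open>c\<close>,
  taken mod 2.\<close>

lemma critical_row_set_maps_matrix:
  assumes h: "\<phi> \<in> block_maps K m n {}"
  shows "critical_row_set (maps_matrix K m n \<phi>) R \<longleftrightarrow> R \<subseteq> {..<m} \<and> \<phi> \<in> block_maps K m n R"
proof (cases "R \<subseteq> {..<m}")
  case True
  let ?G = "maps_matrix K m n \<phi>"
  have fR: "finite R" using True finite_subset by auto
  have dims: "dim_row ?G = m" "dim_col ?G = total_cols K n" by (auto simp: maps_matrix_def)
  have rows: "Matrix.row ?G \<in> R \<rightarrow> carrier_vec (total_cols K n)" by (intro Pi_I carrier_vecI) (simp add: dims)
  have "critical_row_set ?G R \<longleftrightarrow> finsum_vec TYPE(bit) (total_cols K n) (Matrix.row ?G) R = 0\<^sub>v (total_cols K n)"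
    using True dims by (auto simp: critical_row_set_def)
  also have "\<dots> \<longleftrightarrow> (\<forall>k<total_cols K n. (\<Sum>r\<in>R. Matrix.row ?G r $ k) = 0)"
  proof -
    have "finsum_vec TYPE(bit) (total_cols K n) (Matrix.row ?G) R \<in> carrier_vec (total_cols K n)"
      using rows by (rule finsum_vec_closed)
    then show ?thesis using index_finsum_vec[OF fR _ rows] by (auto simp: vec_eq_iff)
  qed
  also have "\<dots> \<longleftrightarrow> (\<forall>j\<in>{1..K}. \<forall>c<n j. (\<Sum>r\<in>R. Matrix.row ?G r $ (block_offset n j + c)) = 0)"
    (is "?L \<longleftrightarrow> ?R")
  proof
    assume ?L
    then show ?R using block_offset_less_total[of _ K _ n] by simp
  next
    assume R: ?R
    show ?L
    proof (intro allI impI)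
      fix k assume "k < total_cols K n"
      then obtain j c where "j \<in> {1..K}" "c < n j" "k = block_offset n j + c"
        using block_offset_surj[of k K n] by auto
      then show "(\<Sum>r\<in>R. Matrix.row ?G r $ k) = 0" using R by simp
    qed
  qed
  also have "\<dots> \<longleftrightarrow> (\<forall>j\<in>{1..K}. \<forall>c<n j. even (card {r \<in> R. \<phi> j r = c}))"
  proof (intro ball_cong all_cong refl)
    fix j c assume jc: "j \<in> {1..K}" "c < n j"
    have "(\<Sum>r\<in>R. Matrix.row ?G r $ (block_offset n j + c)) = (\<Sum>r\<in>R. if \<phi> j r = c then 1 else 0)"
    proof (intro sum.cong refl)
      fix r assume "r \<in> R"
      then have r: "r < m" using True by auto
      have "Matrix.row ?G r $ (block_offset n j + c) = ?G $$ (r, block_offset n j + c)"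
        using dims r block_offset_less_total[of j K c n, OF jc] by simp
      also have "\<dots> = (if \<phi> j r = c then 1 else 0)"
        using jc r block_maps_bound[OF h] by (intro maps_matrix_entry) auto
      finally show "Matrix.row ?G r $ (block_offset n j + c) = (if \<phi> j r = c then 1 else 0)" .
    qed
    also have "\<dots> = of_nat (card {r \<in> R. \<phi> j r = c})"
      using fR by (simp add: sum.If_cases Int_def)
    finally show "(\<Sum>r\<in>R. Matrix.row ?G r $ (block_offset n j + c)) = 0 \<longleftrightarrow> even (card {r \<in> R. \<phi> j r = c})"
      by (simp add: of_nat_bit_eq_0_iff)
  qed
  also have "\<dots> \<longleftrightarrow> \<phi> \<in> block_maps K m n R"
    using h by (auto simp: block_maps_def even_maps_def PiE_def Pi_def)
  finally show ?thesis using True by simp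
next
  case False
  then show ?thesis by (auto simp: critical_row_set_def maps_matrix_def)
qed

text \<open>Count pairs of a matrix and a critical row set by exchanging the sums. For fixed
  \<open>R\<close> the admissible tuples form a product over the blocks, so the probability factors.
  Positivity makes \<open>Psi K m n\<close> nonempty, without which \<open>pmf_of_set\<close> would
  not be uniform on it.\<close>

lemma expected_Z_eq:
  assumes pos: "\<And>j. j \<in> {1..K} \<Longrightarrow> cover_num m (n j) > 0"
  shows "expected_Z K m n l = (\<Sum>R | R \<subseteq> {..<m} \<and> card R = l.
     \<Prod>j\<in>{1..K}. real (card (even_maps {..<m} {..<n j} R)) / cover_num m (n j))"
proof -
  let ?B = "block_maps K m n {}"
  let ?S = "{R. R \<subseteq> {..<m} \<and> card R = l}"
  have cB: "real (card (block_maps K m n R)) = (\<Prod>j\<in>{1..K}. real (card (even_maps {..<m} {..<n j} R)))" for R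
    unfolding block_maps_def by (simp add: card_PiE)
  have fB: "finite (block_maps K m n R)" for R
    unfolding block_maps_def by (intro finite_PiE finite_even_maps) auto
  have cB0: "real (card ?B) = (\<Prod>j\<in>{1..K}. cover_num m (n j))"
    unfolding cB by (intro prod.cong) (auto simp: card_even_maps_empty)
  also have "\<dots> > 0" using pos by (intro prod_pos) auto
  finally have Bpos: "card ?B > 0" by simp
  have card_Psi: "card (Psi K m n) = card ?B"
    using bij_betw_same_card[OF bij_betw_maps_matrix] by simp
  have fin: "finite (Psi K m n)" "Psi K m n \<noteq> {}" using Bpos card_Psi card_gt_0_iff by metis+
  have fS: "finite ?S" by simp
  have "expected_Z K m n l = (\<Sum>\<Gamma>\<in>Psi K m n. real (Z_crit l \<Gamma>)) / real (card ?B)"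
    unfolding expected_Z_def using fin by (simp add: integral_pmf_of_set card_Psi)
  also have "(\<Sum>\<Gamma>\<in>Psi K m n. real (Z_crit l \<Gamma>)) = (\<Sum>\<phi>\<in>?B. real (Z_crit l (maps_matrix K m n \<phi>)))"
    by (rule sum.reindex_bij_betw[OF bij_betw_maps_matrix, symmetric])
  also have "\<dots> = (\<Sum>\<phi>\<in>?B. \<Sum>R\<in>?S. if \<phi> \<in> block_maps K m n R then 1 else 0)"
  proof (intro sum.cong refl)
    fix \<phi> assume h: "\<phi> \<in> ?B"
    have "{R. critical_row_set (maps_matrix K m n \<phi>) R \<and> card R = l} = {R \<in> ?S. \<phi> \<in> block_maps K m n R}"
      using critical_row_set_maps_matrix[OF h] by auto
    then show "real (Z_crit l (maps_matrix K m n \<phi>)) = (\<Sum>R\<in>?S. if \<phi> \<in> block_maps K m n R then 1 else 0)"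
      using fS by (simp add: Z_crit_def sum.If_cases Int_def)
  qed
  also have "\<dots> = (\<Sum>R\<in>?S. \<Sum>\<phi>\<in>?B. if \<phi> \<in> block_maps K m n R then 1 else 0)" by (rule sum.swap)
  also have "\<dots> = (\<Sum>R\<in>?S. real (card (block_maps K m n R)))"
  proof (intro sum.cong refl)
    fix R
    have "{\<phi> \<in> ?B. \<phi> \<in> block_maps K m n R} = block_maps K m n R"
      using block_maps_mono[of K m n R] by auto
    then show "(\<Sum>\<phi>\<in>?B. if \<phi> \<in> block_maps K m n R then 1 else 0) = real (card (block_maps K m n R))"
      using fB by (simp add: sum.If_cases Int_def)
  qed
  also have "\<dots> / real (card ?B) = (\<Sum>R\<in>?S. \<Prod>j\<in>{1..K}. real (card (even_maps {..<m} {..<n j} R)) / cover_num m (n j))"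
    unfolding cB0 unfolding cB by (simp add: sum_divide_distrib prod_dividef)
  finally show ?thesis .
qed

section \<open>Lower bounds for the number of maps with large fibres\<close>

text \<open>For z > 0, divided by \<open>exp_tail z ^ n\<close> this is the probability that
  \<open>n\<close> independent Poisson variables of parameter \<open>z\<close>, each conditioned to
  be at least two, add up to \<open>m\<close>.\<close>

definition cover_mass :: "nat \<Rightarrow> real \<Rightarrow> nat \<Rightarrow> real" where
  "cover_mass n z m = fps_nth (exp_tail_fps ^ n) m * z ^ m"

lemma cover_mass_nonneg: "0 \<le> z \<Longrightarrow> 0 \<le> cover_mass n z m"
  using cover_num_nonneg[of m n] unfolding cover_mass_def cover_num_def
  by (metis fact_gt_zero mult_nonneg_nonneg zero_le_mult_iff zero_le_power not_less)

lemma cover_mass_sums: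
  assumes "0 \<le> z"
  shows "cover_mass n z sums (exp_tail z ^ n)"
proof (induction n)
  case 0
  have "cover_mass 0 z = (\<lambda>m. if m = 0 then 1 else 0)" by (auto simp: cover_mass_def fun_eq_iff)
  then show ?case using sums_single[of 0 "\<lambda>_. 1::real"] by simp
next
  case (Suc n)
  let ?a = "\<lambda>k. fps_nth exp_tail_fps k * z ^ k"
  have "(\<lambda>k. z^k / fact k - (if k = 0 then 1 else 0) - (if k = 1 then z else 0)) sums (exp z - 1 - z)"
    using exp_converges[of z] sums_single[of 0 "\<lambda>_. 1::real"] sums_single[of 1 "\<lambda>_. z"]
    by (intro sums_diff) (simp_all add: divide_inverse mult.commute)
  moreover have "(\<lambda>k. z^k / fact k - (if k = 0 then 1 else 0) - (if k = 1 then z else 0)) = ?a"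
  proof
    fix k show "z^k / fact k - (if k = 0 then 1 else 0) - (if k = 1 then z else 0) = ?a k"
      by (cases "k = 0"; cases "k = 1") (auto simp: exp_tail_fps_nth)
  qed
  ultimately have a: "?a sums exp_tail z" by (simp add: exp_tail_def)
  have an: "0 \<le> ?a k" for k using assms by (auto simp: exp_tail_fps_nth)
  have "(\<lambda>k. \<Sum>i\<le>k. ?a i * cover_mass n z (k - i)) sums (suminf ?a * suminf (cover_mass n z))"
    using sums_summable[OF a] sums_summable[OF Suc] an cover_mass_nonneg[OF assms]
    by (intro Cauchy_product_sums) simp_all
  moreover have "(\<lambda>k. \<Sum>i\<le>k. ?a i * cover_mass n z (k - i)) = cover_mass (Suc n) z"
  proof
    fix k
    have "(\<Sum>i\<le>k. ?a i * cover_mass n z (k - i)) = (\<Sum>i\<le>k. fps_nth exp_tail_fps i * fps_nth (exp_tail_fps ^ n) (k - i) * z ^ k)"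
      by (intro sum.cong) (auto simp: cover_mass_def power_add[symmetric])
    then show "(\<Sum>i\<le>k. ?a i * cover_mass n z (k - i)) = cover_mass (Suc n) z k"
      by (simp add: cover_mass_def fps_mult_nth sum_distrib_right atLeast0AtMost)
  qed
  ultimately show ?case using sums_unique[OF a] sums_unique[OF Suc] by simp
qed

text \<open>By the recurrence for \<open>cover_num\<close>, passing from index i to i + 1 multiplies
  the mass by at least n z / (i + 1), which is at least \<open>b\<close> as long as i + 1 \<le>
  m.\<close>

lemma cover_mass_step:
  assumes "0 < z" "0 < n" "k \<le> m" "0 < b" "b \<le> 1" "b * real m \<le> real n * z"
  shows "b ^ (m - k) * cover_mass n z k \<le> cover_mass n z m"
  using assms(3,6)
proof (induction m rule: dec_induct)
  case base
  then show ?case by simp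
next
  case (step m)
  have c: "real n * cover_num m n \<le> cover_num (Suc m) n"
  proof (cases "m = 0")
    case True
    then show ?thesis using assms(2) cover_num_nonneg cover_num_nonneg[of 1 n] by (simp add: cover_num_def fps_power_zeroth exp_tail_fps_nth zero_power)
  next
    case False
    then show ?thesis using cover_num_removal(1)[of n "Suc m"] assms(2) by simp
  qed
  have "b * cover_mass n z m \<le> cover_mass n z (Suc m)"
  proof -
    have "fact m * (real n * fps_nth (exp_tail_fps ^ n) m) \<le> fact m * (real (Suc m) * fps_nth (exp_tail_fps ^ n) (Suc m))"
      using c by (simp add: cover_num_def algebra_simps)
    then have d: "real n * fps_nth (exp_tail_fps ^ n) m \<le> real (Suc m) * fps_nth (exp_tail_fps ^ n) (Suc m)"
      by (simp del: of_nat_Suc)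
    have "b * real (Suc m) * cover_mass n z m \<le> real n * z * cover_mass n z m"
      using step.prems cover_mass_nonneg assms(1) by (intro mult_right_mono) auto
    also have "\<dots> = real n * fps_nth (exp_tail_fps ^ n) m * z ^ Suc m" by (simp add: cover_mass_def)
    also have "\<dots> \<le> real (Suc m) * fps_nth (exp_tail_fps ^ n) (Suc m) * z ^ Suc m"
      using d assms(1) by (intro mult_right_mono) auto
    also have "\<dots> = real (Suc m) * cover_mass n z (Suc m)" by (simp add: cover_mass_def)
    finally have "real (Suc m) * (b * cover_mass n z m) \<le> real (Suc m) * cover_mass n z (Suc m)"
      by (simp add: mult_ac del: of_nat_Suc)
    then show ?thesis by (simp del: of_nat_Suc)
  qed
  moreover have "b * real m \<le> real n * z"
    using step.prems assms(4) by (simp add: algebra_simps)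
  then have "b * (b ^ (m - k) * cover_mass n z k) \<le> b * cover_mass n z m"
    using step assms by (intro mult_left_mono) auto
  ultimately show ?case using step.hyps by (simp add: Suc_diff_le mult.assoc)
qed

text \<open>The logarithm of f(y) / y^c, where f is \<open>exp_tail\<close>, has derivative (l - c)
  / z at y = z. So a small move of y away from z, upwards if c > l and downwards if c < l, lowers
  this quotient strictly.\<close>

lemma exp_tail_tilt:
  assumes z: "0 < z" and l: "z * (exp z - 1) = l * exp_tail z"
  shows "c > l \<Longrightarrow> \<exists>y>z. exp_tail y * (z / y) powr c < exp_tail z"
    and "c < l \<Longrightarrow> \<exists>y>0. y < z \<and> exp_tail y * (z / y) powr c < exp_tail z"
proof -
  define g where "g = (\<lambda>y. ln (exp_tail y) - c * ln y)"
  have f: "exp_tail z > 0" using exp_tail_pos z by simp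
  have "(g has_real_derivative (exp z - 1) / exp_tail z - c / z) (at z)"
    unfolding g_def exp_tail_def using f z
    by (auto intro!: derivative_eq_intros simp: exp_tail_def)
  moreover have "exp z - 1 = l * exp_tail z / z" using l z by (simp add: field_simps)
  then have "(exp z - 1) / exp_tail z - c / z = (l - c) / z" using f by (simp add: diff_divide_distrib)
  ultimately have d: "(g has_real_derivative (l - c) / z) (at z)" by simp
  have conv: "exp_tail y * (z / y) powr c < exp_tail z" if "g y < g z" "y > 0" for y
  proof -
    have fy: "exp_tail y > 0" using exp_tail_pos that by simp
    have "ln (exp_tail y * (z / y) powr c) = ln (exp_tail y) + c * (ln z - ln y)"
      using fy z that by (simp add: ln_mult ln_powr ln_div)
    also have "\<dots> < ln (exp_tail z)" using that(1) by (simp add: g_def algebra_simps)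
    finally show ?thesis using fy f z that by simp
  qed
  show "c > l \<Longrightarrow> \<exists>y>z. exp_tail y * (z / y) powr c < exp_tail z"
  proof -
    assume "c > l"
    then have "(l - c) / z < 0" using z by (simp add: divide_neg_pos)
    then obtain e where e: "e > 0" "\<forall>h>0. h < e \<longrightarrow> g (z + h) < g z"
      using DERIV_neg_dec_right[OF d] by (auto simp: algebra_simps)
    then have "g (z + e / 2) < g z" by simp
    then show ?thesis using conv[of "z + e/2"] e z by (intro exI[of _ "z + e/2"]) auto
  qed
  show "c < l \<Longrightarrow> \<exists>y>0. y < z \<and> exp_tail y * (z / y) powr c < exp_tail z"
  proof -
    assume "c < l"
    then have "(l - c) / z > 0" using z by simp
    then obtain e where e: "e > 0" "\<forall>h>0. h < e \<longrightarrow> g (z - h) < g z"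
      using DERIV_pos_inc_left[OF d] by (auto simp: algebra_simps)
    define h where "h = min (e / 2) (z / 2)"
    have h: "0 < h" "h < e" "h < z" using e z by (auto simp: h_def min_def)
    then show ?thesis using conv[of "z - h"] e by (intro exI[of _ "z - h"]) auto
  qed
qed

text \<open>
  Chernoff bounds at two points on either side of \<open>z\<close>.
\<close>

lemma cover_mass_concentration:
  assumes z: "0 < z" and l: "z * (exp z - 1) = l * exp_tail z" and c: "0 \<le> c1" "c1 < l" "l < c2"
  shows "\<exists>N. \<forall>n\<ge>N. \<forall>m. c2 * real n \<le> real m \<longrightarrow>
    exp_tail z ^ n / 2 \<le> (\<Sum>k | k \<le> m \<and> c1 * real n \<le> real k. cover_mass n z k)"
proof -
  have f: "exp_tail z > 0" using exp_tail_pos z by simp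
  obtain y1 where y1: "0 < y1" "y1 < z" "exp_tail y1 * (z / y1) powr c1 < exp_tail z"
    using exp_tail_tilt(2)[OF z l c(2)] by auto
  obtain y2 where y2: "z < y2" "exp_tail y2 * (z / y2) powr c2 < exp_tail z"
    using exp_tail_tilt(1)[OF z l c(3)] by auto
  define a1 where "a1 = (z / y1) powr c1"
  define a2 where "a2 = (z / y2) powr c2"
  \<comment> \<open>\<open>q\<close> bounds the exponential rates of both tails relative to
    \<open>exp_tail z\<close>. Once \<open>q ^ n\<close> is below 1/4, the two tails together carry
    at most half of the mass.\<close>
  define q where "q = max (exp_tail y1 * a1) (exp_tail y2 * a2) / exp_tail z"
  have fy: "exp_tail y1 > 0" "exp_tail y2 > 0" using exp_tail_pos y1 y2 z by auto
  have q: "0 \<le> q" "q < 1" using y1 y2 f fy by (auto simp: q_def a1_def a2_def max_def)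
  have q12: "exp_tail y1 * a1 \<le> q * exp_tail z" "exp_tail y2 * a2 \<le> q * exp_tail z" using f by (auto simp: q_def)
  have "(\<lambda>n. q ^ n) \<longlonglongrightarrow> 0" using q by (intro LIMSEQ_realpow_zero) auto
  then have "eventually (\<lambda>n. q ^ n < 1/4) sequentially" by (rule order_tendstoD) simp
  then obtain N where N: "\<And>n. n \<ge> N \<Longrightarrow> q ^ n < 1/4" by (auto simp: eventually_sequentially)
  show ?thesis
  proof (intro exI allI impI)
    fix n m assume n: "n \<ge> N" and m: "c2 * real n \<le> real m"
    let ?S = "{k. k \<le> m \<and> c1 * real n \<le> real k}"
    have fS: "finite ?S" by (rule finite_subset[of _ "{..m}"]) auto
    \<comment> \<open>Outside the window the coefficient is re-weighted from \<open>z\<close> to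
      \<open>y1\<close> or \<open>y2\<close>. An index neither in \<open>?S\<close> nor below
      \<open>c1 * real n\<close> exceeds \<open>m\<close>, hence also
      \<open>c2 * real n\<close>.\<close>
    have pw: "cover_mass n z k \<le> (if k \<in> ?S then cover_mass n z k else 0) +
        a1 ^ n * cover_mass n y1 k + a2 ^ n * cover_mass n y2 k" for k
    proof -
      have nn: "0 \<le> a1 ^ n * cover_mass n y1 k" "0 \<le> a2 ^ n * cover_mass n y2 k"
        using cover_mass_nonneg y1 y2 z by (auto simp: a1_def a2_def)
      have sh: "cover_mass n z k = cover_mass n y k * (z / y) ^ k" if "y > 0" for y
        using that by (simp add: cover_mass_def power_divide)
      consider "k \<in> ?S" | "real k < c1 * real n" | "c2 * real n \<le> real k"
        using m by force
      then show ?thesis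
      proof cases
        case 1
        then show ?thesis using nn by simp
      next
        case 2
        have "(z / y1) ^ k = (z / y1) powr real k" using z y1 by (simp add: powr_realpow)
        also have "\<dots> \<le> (z / y1) powr (c1 * real n)" using 2 y1 by (intro powr_mono) auto
        also have "\<dots> = a1 ^ n" using z y1 by (simp add: a1_def powr_powr[symmetric] powr_realpow)
        finally have "cover_mass n z k \<le> cover_mass n y1 k * a1 ^ n"
          unfolding sh[OF y1(1)] using cover_mass_nonneg y1 by (intro mult_left_mono) auto
        then show ?thesis using nn cover_mass_nonneg[of z n k] z by (auto simp: mult.commute)
      next
        case 3
        have "(z / y2) ^ k = (z / y2) powr real k" using z y2 by (simp add: powr_realpow)
        also have "\<dots> \<le> (z / y2) powr (c2 * real n)" using 3 y2 z by (intro powr_mono') auto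
        also have "\<dots> = a2 ^ n" using z y2 by (simp add: a2_def powr_powr[symmetric] powr_realpow)
        finally have "cover_mass n z k \<le> cover_mass n y2 k * a2 ^ n"
          using sh[of y2] cover_mass_nonneg[of y2 n k] y2 z by (auto intro: mult_left_mono)
        then show ?thesis using nn cover_mass_nonneg[of z n k] z by (auto simp: mult.commute)
      qed
    qed
    have "(\<lambda>k. if k \<in> ?S then cover_mass n z k else 0) sums (\<Sum>k\<in>?S. cover_mass n z k)"
      using fS by (rule sums_If_finite_set)
    moreover have "(\<lambda>k. a1 ^ n * cover_mass n y1 k) sums (a1 ^ n * exp_tail y1 ^ n)"
      using y1 by (intro sums_mult cover_mass_sums) auto
    moreover have "(\<lambda>k. a2 ^ n * cover_mass n y2 k) sums (a2 ^ n * exp_tail y2 ^ n)"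
      using y2 z by (intro sums_mult cover_mass_sums) auto
    ultimately have "(\<lambda>k. (if k \<in> ?S then cover_mass n z k else 0) +
        a1 ^ n * cover_mass n y1 k + a2 ^ n * cover_mass n y2 k) sums
        ((\<Sum>k\<in>?S. cover_mass n z k) + a1 ^ n * exp_tail y1 ^ n + a2 ^ n * exp_tail y2 ^ n)"
      by (intro sums_add)
    then have "exp_tail z ^ n \<le> (\<Sum>k\<in>?S. cover_mass n z k) + a1 ^ n * exp_tail y1 ^ n + a2 ^ n * exp_tail y2 ^ n"
      using z by (intro sums_le[OF pw cover_mass_sums]) auto
    also have "a1 ^ n * exp_tail y1 ^ n = (exp_tail y1 * a1) ^ n" by (simp add: power_mult_distrib)
    also have "a2 ^ n * exp_tail y2 ^ n = (exp_tail y2 * a2) ^ n" by (simp add: power_mult_distrib)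
    finally have "exp_tail z ^ n \<le> (\<Sum>k\<in>?S. cover_mass n z k) + (exp_tail y1 * a1) ^ n + (exp_tail y2 * a2) ^ n" .
    moreover have "(exp_tail y1 * a1) ^ n \<le> (q * exp_tail z) ^ n" "(exp_tail y2 * a2) ^ n \<le> (q * exp_tail z) ^ n"
      using q12 fy by (auto intro!: power_mono simp: a1_def a2_def)
    moreover have "(q * exp_tail z) ^ n \<le> 1/4 * exp_tail z ^ n"
      unfolding power_mult_distrib using N[OF n] f by (intro mult_right_mono) auto
    ultimately show "exp_tail z ^ n / 2 \<le> (\<Sum>k\<in>?S. cover_mass n z k)" by simp
  qed
qed

text \<open>
  The mass found below \<open>m\<close> is moved up to \<open>m\<close> by \<open>cover_mass_step\<close>, at the price of a factor \<open>b\<close> per step.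
\<close>

lemma cover_mass_lower_bound:
  assumes z: "0 < z" and l: "z * (exp z - 1) = l * exp_tail z" and c: "0 \<le> c1" "c1 < l" "l < c2"
    and b: "0 < b" "b \<le> 1"
  shows "\<exists>N. \<forall>n\<ge>N. \<forall>m. c2 * real n \<le> real m \<longrightarrow> b * real m \<le> real n * z \<longrightarrow>
    b powr (real m - c1 * real n) / (2 * (real m + 1)) * exp_tail z ^ n \<le> cover_mass n z m"
proof -
  obtain N where N: "\<And>n m. n \<ge> N \<Longrightarrow> c2 * real n \<le> real m \<Longrightarrow>
    exp_tail z ^ n / 2 \<le> (\<Sum>k | k \<le> m \<and> c1 * real n \<le> real k. cover_mass n z k)"
    using cover_mass_concentration[OF z l c] by auto
  show ?thesis
  proof (intro exI[of _ "max N 1"] allI impI)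
    fix n m assume n: "max N 1 \<le> n" and m: "c2 * real n \<le> real m" and bm: "b * real m \<le> real n * z"
    let ?S = "{k. k \<le> m \<and> c1 * real n \<le> real k}"
    let ?w = "b powr (real m - c1 * real n)"
    have "?w * cover_mass n z k \<le> cover_mass n z m" if k: "k \<in> ?S" for k
    proof -
      have "?w \<le> b powr (real (m - k))" using k b by (intro powr_mono') (auto simp: of_nat_diff)
      also have "\<dots> = b ^ (m - k)" using b by (simp add: powr_realpow)
      finally have "?w * cover_mass n z k \<le> b ^ (m - k) * cover_mass n z k"
        using cover_mass_nonneg z by (intro mult_right_mono) auto
      also have "\<dots> \<le> cover_mass n z m" using k n b bm z by (intro cover_mass_step) auto
      finally show ?thesis .
    qed
    then have "(\<Sum>k\<in>?S. ?w * cover_mass n z k) \<le> real (card ?S) * cover_mass n z m"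
      by (rule sum_bounded_above)
    also have "\<dots> \<le> (real m + 1) * cover_mass n z m"
    proof (intro mult_right_mono)
      have "card ?S \<le> card {..m}" by (intro card_mono) auto
      then show "real (card ?S) \<le> real m + 1" by simp
    qed (use cover_mass_nonneg z in auto)
    finally have "?w * (\<Sum>k\<in>?S. cover_mass n z k) \<le> (real m + 1) * cover_mass n z m"
      by (simp add: sum_distrib_left)
    moreover have "?w * (exp_tail z ^ n / 2) \<le> ?w * (\<Sum>k\<in>?S. cover_mass n z k)"
      using N[OF _ m] n by (intro mult_left_mono) auto
    ultimately have "?w * (exp_tail z ^ n / 2) \<le> (real m + 1) * cover_mass n z m" by linarith
    then show "?w / (2 * (real m + 1)) * exp_tail z ^ n \<le> cover_mass n z m"
      by (simp add: divide_le_eq algebra_simps)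
  qed
qed

section \<open>Exponential bounds for large row sets\<close>

text \<open>These are the weights of the binomial distribution with success probability l / m,
  scaled by m^m to stay in the natural numbers. Quotients of consecutive weights show that they
  increase up to \<open>l\<close> and decrease afterwards.\<close>

lemma binomial_weight_at_mode:
  assumes l: "l \<le> m" and k: "k \<le> m"
  shows "(m choose k) * l^k * (m - l)^(m - k) \<le> (m choose l) * l^l * (m - l)^(m - l)"
proof (cases "l = m")
  case True
  then show ?thesis using k by (cases "k = m") (auto simp: zero_power)
next
  case False
  let ?T = "\<lambda>k. (m choose k) * l^k * (m - l)^(m - k)"
  have rec: "(k + 1) * (m - l) * ?T (Suc k) = (m - k) * l * ?T k" if "k < m" for k
  proof -
    have c: "Suc k * (m choose Suc k) = (m - k) * (m choose k)"
      using binomial_absorb_comp[of m k] binomial_absorption[of k m] by simp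
    have d: "(m - l)^(m - k) = (m - l) * (m - l)^(m - Suc k)"
      using that by (simp add: Suc_diff_Suc[symmetric])
    have "(k + 1) * (m - l) * ?T (Suc k) = (Suc k * (m choose Suc k)) * (l * l^k) * ((m - l) * (m - l)^(m - Suc k))"
      unfolding Suc_eq_plus1[symmetric] power_Suc by (simp only: mult_ac)
    also have "\<dots> = (m - k) * l * ?T k" unfolding c d[symmetric] by (simp only: ac_simps)
    finally show ?thesis .
  qed
  have up: "?T k \<le> ?T (Suc k)" if "k < l" for k
  proof -
    have "(k + 1) * (m - l) \<le> l * (m - k)" using that l by (intro mult_mono) auto
    then have "(k + 1) * (m - l) * ?T k \<le> (m - k) * l * ?T k" by (simp add: mult.commute)
    also have "\<dots> = (k + 1) * (m - l) * ?T (Suc k)" using rec[of k] that l by simp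
    finally show ?thesis using False l by (simp only: mult_le_cancel1) auto
  qed
  have down: "?T (Suc k) \<le> ?T k" if "l \<le> k" "k < m" for k
  proof -
    have "(k + 1) * (m - l) * ?T (Suc k) = (m - k) * l * ?T k" using rec[of k] that by simp
    also have "\<dots> \<le> (k + 1) * (m - l) * ?T k"
    proof (intro mult_right_mono)
      have "(m - k) * l \<le> (m - l) * (k + 1)" using that l by (intro mult_mono) auto
      then show "(m - k) * l \<le> (k + 1) * (m - l)" by (simp only: mult.commute)
    qed simp
    finally show ?thesis using False l by (simp only: mult_le_cancel1) auto
  qed
  show ?thesis
  proof (cases "k \<le> l")
    case True
    then show ?thesis
    proof (induction k rule: inc_induct)
      case (step k)
      then show ?case using up[of k] by linarith
    qed simp
  next
    case False
    then have "l \<le> k" by simp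
    then show ?thesis using k
    proof (induction k rule: dec_induct)
      case (step k)
      have "?T (Suc k) \<le> ?T k" using step by (intro down) auto
      also have "?T k \<le> ?T l" using step by simp
      finally show ?case .
    qed simp
  qed
qed

text \<open>The m + 1 binomial probabilities add up to 1, so the largest of them is at least 1 / (m
  + 1).\<close>

lemma binomial_mode_prob:
  assumes l: "l \<le> m" "0 < m"
  shows "1 \<le> (real m + 1) * real (m choose l) * ((real l / real m)^l * (1 - real l / real m)^(m - l))"
proof -
  have "(\<Sum>k\<le>m. (m choose k) * l^k * (m - l)^(m - k)) = (l + (m - l))^m"
    by (subst binomial) simp
  then have "m^m = (\<Sum>k\<le>m. (m choose k) * l^k * (m - l)^(m - k))" using l by simp
  also have "\<dots> \<le> (\<Sum>k\<le>m. (m choose l) * l^l * (m - l)^(m - l))"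
    by (intro sum_mono binomial_weight_at_mode l) auto
  also have "\<dots> = (m + 1) * ((m choose l) * l^l * (m - l)^(m - l))" by simp
  finally have "real (m^m) \<le> real ((m + 1) * ((m choose l) * l^l * (m - l)^(m - l)))"
    by (rule of_nat_mono)
  then have "real m ^ m \<le> (real m + 1) * (real (m choose l) * real l^l * (real m - real l)^(m - l))"
    using l by (simp add: of_nat_diff distrib_right add.commute)
  also have "\<dots> = (real m + 1) * real (m choose l) * ((real l / real m)^l * (1 - real l / real m)^(m - l)) * real m ^ m"
  proof -
    have "real m ^ m = real m ^ l * real m ^ (m - l)" using l by (simp add: power_add[symmetric])
    moreover have "1 - real l / real m = (real m - real l) / real m" using l by (simp add: diff_divide_distrib)
    ultimately show ?thesis using l by (simp add: power_divide)
  qed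
  finally show ?thesis using l by simp
qed

section \<open>Saddle point bounds for the probability of being even\<close>

text \<open>For z > 0 and a in [0, 1], let N be Poisson with parameter \<open>z\<close>, conditioned
  on N \<ge> 2, and mark each of N points independently with probability \<open>a\<close>. This is
  the probability that the number of marks is even. It is also the base in
  \<open>card_even_maps_gf_bound\<close> at \<open>x = a * z\<close>,
  \<open>y = (1 - a) * z\<close>, divided by \<open>exp_tail z\<close>.\<close>

definition tilt :: "real \<Rightarrow> real \<Rightarrow> real" where
  "tilt z a = (1 + exp_tail ((1 - 2 * a) * z) / exp_tail z) / 2"

lemma exp_tail_nonneg: "0 \<le> exp_tail z"
  using exp_tail_pos[of z] by (cases "z = 0") (auto simp: exp_tail_def)

text \<open>The difference of the two sides is 2 (sinh z - z).\<close>

lemma exp_tail_minus_less: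
  assumes "0 < z"
  shows "exp_tail (- z) < exp_tail z"
proof -
  have "sinh 0 - 0 < sinh z - z"
  proof (rule DERIV_pos_imp_increasing_open[OF assms, of "\<lambda>z. sinh z - z"])
    fix x assume x: "0 < x" "x < z"
    have "((\<lambda>z. sinh z - z) has_real_derivative cosh x - 1) (at x)"
      by (auto intro!: derivative_eq_intros)
    moreover have "cosh x > 1" using cosh_real_strict_mono[of 0 x] x by simp
    ultimately show "\<exists>y. ((\<lambda>z. sinh z - z) has_real_derivative y) (at x) \<and> 0 < y" by force
  qed (auto intro!: continuous_intros)
  then show ?thesis by (simp add: exp_tail_def sinh_field_def)
qed

lemma exp_tail_minus_le: "0 \<le> z \<Longrightarrow> exp_tail (- z) \<le> exp_tail z"
  using exp_tail_minus_less[of z] by (cases "z = 0") auto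

lemma tilt_nonneg: "0 \<le> tilt z a"
  using exp_tail_nonneg by (simp add: tilt_def)

text \<open>Apply \<open>two_point_inequality\<close> at \<open>x = \<bar>1 - 2 * a\<bar>\<close>;
  for a > 1/2 first replace \<open>exp_tail (- (x * z))\<close> by the larger
  \<open>exp_tail (x * z)\<close>. The powers of two combine to a factor 2, which the definition of
  \<open>tilt\<close> absorbs.\<close>

lemma tilt_le:
  assumes z: "z > 0" and l: "z * (exp z - 1) = l * exp_tail z"
    and t: "0 < t" "t \<le> 5/9" and lt: "2 \<le> l" "t * (l - 1) \<le> 1" and a: "0 \<le> a" "a \<le> 1"
  shows "tilt z a \<le> (a powr (1 + t) + (1 - a) powr (1 + t)) powr (l / (1 + t))"
proof -
  let ?S = "a powr (1 + t) + (1 - a) powr (1 + t)"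
  define x where "x = \<bar>1 - 2 * a\<bar>"
  have x: "0 \<le> x" "x \<le> 1" using a by (auto simp: x_def)
  have f: "exp_tail z > 0" using exp_tail_pos z by simp
  have S: "0 \<le> ?S" by simp
  have h: "(2 * b) powr (1 + t) / 2 = 2 powr t * b powr (1 + t)" if "b \<ge> 0" for b
    using that by (simp add: powr_mult powr_add)
  have m: "pow_mean t x = 2 powr t * ?S"
  proof (cases "1 - 2 * a \<ge> 0")
    case True
    then have e: "1 + x = 2 * (1 - a)" "1 - x = 2 * a" by (auto simp: x_def)
    show ?thesis unfolding pow_mean_def e
      using h[of a] h[of "1 - a"] a by (simp only: add_divide_distrib distrib_left add.commute diff_ge_0_iff_ge)
  next
    case False
    then have e: "1 + x = 2 * a" "1 - x = 2 * (1 - a)" by (auto simp: x_def)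
    show ?thesis unfolding pow_mean_def e
      using h[of a] h[of "1 - a"] a by (simp only: add_divide_distrib distrib_left add.commute diff_ge_0_iff_ge)
  qed
  have "exp_tail ((1 - 2 * a) * z) \<le> exp_tail (x * z)"
  proof (cases "1 - 2 * a \<ge> 0")
    case False
    then have "(1 - 2 * a) * z = - (x * z)" by (simp add: x_def algebra_simps)
    then show ?thesis using exp_tail_minus_le[of "x * z"] x z by simp
  qed (simp add: x_def)
  then have "2 * tilt z a \<le> 1 + exp_tail (x * z) / exp_tail z" using f by (simp add: tilt_def divide_right_mono)
  also have "\<dots> \<le> 2 powr (1 - l * t / (1 + t)) * pow_mean t x powr (l / (1 + t))"
    by (rule two_point_inequality[OF z l t lt x])
  also have "\<dots> = 2 powr (1 - l * t / (1 + t)) * 2 powr (t * (l / (1 + t))) * ?S powr (l / (1 + t))"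
    unfolding m using S by (simp add: powr_mult powr_powr)
  also have "2 powr (1 - l * t / (1 + t)) * 2 powr (t * (l / (1 + t))) = (2::real)"
    by (simp add: powr_add[symmetric] mult.commute)
  finally show ?thesis by simp
qed

definition even_prob :: "nat \<Rightarrow> nat \<Rightarrow> nat set \<Rightarrow> real" where
  "even_prob m n R = real (card (even_maps {..<m} {..<n} R)) / cover_num m n"

text \<open>The numerator is bounded by \<open>card_even_maps_gf_bound\<close> at
  \<open>(a * z, (1 - a) * z)\<close>, the denominator by the assumption on \<open>tau\<close>,
  which measures the loss of the saddle point estimate. The factorials combine to a binomial
  coefficient.\<close>

lemma even_prob_le_tilt:
  assumes z: "z > 0" and R: "R \<subseteq> {..<m}" and tau: "tau > 0" "tau * exp_tail z ^ n \<le> cover_mass n z m"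
    and a: "0 \<le> a" "a \<le> 1" "a ^ card R * (1 - a) ^ (m - card R) > 0"
  shows "even_prob m n R \<le> tilt z a ^ n / (tau * real (m choose card R) * (a ^ card R * (1 - a) ^ (m - card R)))"
proof -
  define l where "l = card R"
  define N where "N = real (card (even_maps {..<m} {..<n} R))"
  define w where "w = a ^ l * (1 - a) ^ (m - l)"
  have f: "exp_tail z > 0" using exp_tail_pos z by simp
  have fR: "finite R" using R finite_subset by auto
  have lm: "l \<le> m" using card_mono[OF _ R] by (simp add: l_def)
  have cR: "card ({..<m} - R) = m - l" using R fR by (simp add: card_Diff_subset l_def)
  have w: "w > 0" using a by (simp add: w_def l_def)
  have H: "cosh (a * z) * exp ((1 - a) * z) - 1 - (1 - a) * z = exp_tail z * tilt z a"
  proof -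
    have "cosh (a * z) * exp ((1 - a) * z) = (exp z + exp ((1 - 2 * a) * z)) / 2"
      by (simp add: cosh_field_def add_divide_distrib distrib_right exp_add[symmetric] algebra_simps)
    moreover have "exp_tail z * tilt z a = (exp_tail z + exp_tail ((1 - 2 * a) * z)) / 2"
      using f by (simp add: tilt_def field_simps)
    ultimately show ?thesis by (simp add: exp_tail_def algebra_simps)
  qed
  have "N * ((a * z) ^ l / fact l) * (((1 - a) * z) ^ (m - l) / fact (m - l)) \<le> (exp_tail z * tilt z a) ^ n"
    using card_even_maps_gf_bound[of "{..<n}" "{..<m}" R "a * z" "(1 - a) * z"] R a z
    unfolding H cR l_def[symmetric] N_def by simp
  moreover have "N * ((a * z) ^ l / fact l) * (((1 - a) * z) ^ (m - l) / fact (m - l))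
     = N * w * z ^ m / (fact l * fact (m - l))"
  proof -
    have "z ^ m = z ^ l * z ^ (m - l)" using lm by (simp add: power_add[symmetric])
    then show ?thesis by (simp add: w_def power_mult_distrib)
  qed
  ultimately have "N * w * z ^ m / (fact l * fact (m - l)) \<le> (exp_tail z * tilt z a) ^ n"
    by (simp only:)
  then have "N * w * z ^ m \<le> (exp_tail z * tilt z a) ^ n * (fact l * fact (m - l))"
    by (subst (asm) pos_divide_le_eq) auto
  then have 1: "N * w * z ^ m \<le> (fact l * fact (m - l)) * (exp_tail z ^ n * tilt z a ^ n)"
    by (simp add: power_mult_distrib mult_ac)
  have cm: "cover_num m n * z ^ m = fact m * cover_mass n z m"
    by (simp add: cover_num_def cover_mass_def)
  have "0 < tau * exp_tail z ^ n" using tau f by simp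
  then have "0 < cover_mass n z m" using tau(2) by linarith
  then have "0 < cover_num m n * z ^ m" unfolding cm by simp
  then have cp: "0 < cover_num m n" using z by (simp add: zero_less_mult_iff)
  have fm: "fact m = real (m choose l) * (fact l * fact (m - l))"
    using arg_cong[OF binomial_fact_lemma[OF lm], of real] by (simp add: mult_ac)
  have ch: "real (m choose l) > 0" using lm by simp
  have "N * (tau * real (m choose l) * w) \<le> tilt z a ^ n * cover_num m n"
  proof -
    let ?g = "fact l * fact (m - l) :: real"
    have "(N * (tau * real (m choose l) * w)) * (z ^ m * exp_tail z ^ n) = (tau * real (m choose l) * exp_tail z ^ n) * (N * w * z ^ m)"
      by (simp add: mult_ac)
    also have "\<dots> \<le> (tau * real (m choose l) * exp_tail z ^ n) * (?g * (exp_tail z ^ n * tilt z a ^ n))"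
      using 1 tau f by (intro mult_left_mono) auto
    also have "\<dots> = (tau * exp_tail z ^ n) * (fact m * exp_tail z ^ n * tilt z a ^ n)"
      unfolding fm by (simp add: mult_ac)
    also have "\<dots> \<le> cover_mass n z m * (fact m * exp_tail z ^ n * tilt z a ^ n)"
      using tau f tilt_nonneg by (intro mult_right_mono) auto
    also have "\<dots> = (fact m * cover_mass n z m) * (exp_tail z ^ n * tilt z a ^ n)" by (simp add: mult_ac)
    also have "\<dots> = (tilt z a ^ n * cover_num m n) * (z ^ m * exp_tail z ^ n)"
      unfolding cm[symmetric] by (simp add: mult_ac)
    finally show ?thesis using z f by (simp add: mult_le_cancel_right)
  qed
  then have "N / cover_num m n \<le> tilt z a ^ n / (tau * real (m choose l) * w)"
    using cp tau ch w by (simp add: field_simps)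
  then show ?thesis by (simp add: even_prob_def N_def w_def l_def)
qed

text \<open>For a = |R| / m the binomial weight in \<open>even_prob_le_tilt\<close> is at least 1 /
  (m + 1) by \<open>binomial_mode_prob\<close>.\<close>

lemma even_prob_le_tilt_mean:
  assumes z: "z > 0" and R: "R \<subseteq> {..<m}" and m: "0 < m" and tau: "tau > 0" "tau * exp_tail z ^ n \<le> cover_mass n z m"
  shows "even_prob m n R \<le> (real m + 1) * tilt z (real (card R) / real m) ^ n / tau"
proof -
  define l where "l = card R"
  define a where "a = real l / real m"
  define w where "w = a ^ l * (1 - a) ^ (m - l)"
  have lm: "l \<le> m" using card_mono[OF _ R] by (simp add: l_def)
  have a: "0 \<le> a" "a \<le> 1" using lm m by (auto simp: a_def)
  have mode: "1 \<le> (real m + 1) * real (m choose l) * w"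
    using binomial_mode_prob[OF lm m] by (simp add: w_def a_def)
  have ch: "real (m choose l) > 0" using lm by simp
  have w: "w > 0"
  proof (rule ccontr)
    assume "\<not> w > 0"
    then have "(real m + 1) * real (m choose l) * w \<le> 0" by (intro mult_nonneg_nonpos) auto
    then show False using mode by simp
  qed
  have "even_prob m n R \<le> tilt z a ^ n / (tau * real (m choose l) * w)"
    using even_prob_le_tilt[OF z R tau a] w by (simp add: w_def l_def)
  also have "\<dots> = (tilt z a ^ n / tau) * (1 / (real (m choose l) * w))" by simp
  also have "\<dots> \<le> (tilt z a ^ n / tau) * (real m + 1)"
    using tilt_nonneg tau mode ch w by (intro mult_left_mono) (auto simp: divide_le_eq mult_ac)
  finally show ?thesis by (simp add: a_def l_def mult.commute)
qed

text \<open>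
  Here \<open>a\<close> is chosen with \<open>a powr (1 + t)\<close> proportional to \<open>card R / m\<close>, which makes the norm
  in \<open>tilt_le\<close> cancel against the weight \<open>a\<^bsup>l\<^esup> (1 - a)\<^bsup>m-l\<^esup>\<close> up to a power of \<open>m choose l\<close>.
\<close>

lemma even_prob_le_binomial_powr:
  assumes z: "z > 0" and l: "z * (exp z - 1) = lam * exp_tail z"
    and t: "0 < t" "t \<le> 5/9" and lt: "2 \<le> lam" "t * (lam - 1) \<le> 1"
    and R: "R \<subseteq> {..<m}" and m: "0 < m" "lam * real n \<le> real m"
    and tau: "tau > 0" "tau * exp_tail z ^ n \<le> cover_mass n z m"
  shows "even_prob m n R \<le> 2 powr (real m - lam * real n) * (real m + 1) / tau * real (m choose card R) powr (- (t / (1 + t)))"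
proof -
  define l where "l = card R"
  define r where "r = 1 + t"
  define al where "al = real l / real m"
  define B where "B = al ^ l * (1 - al) ^ (m - l)"
  define P where "P = al powr (1 / r)"
  define Q where "Q = (1 - al) powr (1 / r)"
  define s where "s = P + Q"
  define a where "a = P / s"
  define w where "w = a ^ l * (1 - a) ^ (m - l)"
  have r: "r \<ge> 1" "r > 0" using t by (auto simp: r_def)
  have lm: "l \<le> m" using card_mono[OF _ R] by (simp add: l_def)
  have al: "0 \<le> al" "al \<le> 1" using lm m by (auto simp: al_def)
  have ch: "real (m choose l) \<ge> 1" using lm by (simp add: Suc_le_eq)
  have mode: "1 \<le> (real m + 1) * real (m choose l) * B"
    using binomial_mode_prob[OF lm m(1)] by (simp add: B_def al_def)
  have B: "B > 0"
  proof (rule ccontr)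
    assume "\<not> B > 0"
    then have "(real m + 1) * real (m choose l) * B \<le> 0" by (intro mult_nonneg_nonpos) auto
    then show False using mode by simp
  qed
  have pw: "b \<le> b powr (1 / r)" "b powr (1 / r) \<le> 1" if "0 \<le> b" "b \<le> 1" for b
  proof -
    show "b powr (1 / r) \<le> 1" using that r by (intro powr_le1) auto
    have "b powr 1 \<le> b powr (1 / r)" if "b \<noteq> 0"
      using that \<open>0 \<le> b\<close> \<open>b \<le> 1\<close> r by (intro powr_mono') (auto simp: divide_le_eq)
    then show "b \<le> b powr (1 / r)" using that by (cases "b = 0") auto
  qed
  have PQ: "0 \<le> P" "0 \<le> Q" by (simp_all add: P_def Q_def)
  have s: "1 \<le> s" "s \<le> 2" using pw[of al] pw[of "1 - al"] al by (auto simp: s_def P_def Q_def)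
  have a: "0 \<le> a" "a \<le> 1" and a1: "1 - a = Q / s"
    using s PQ by (auto simp: a_def s_def field_simps)
  have "P powr r = al" "Q powr r = 1 - al" using al r by (simp_all add: P_def Q_def powr_powr)
  then have "a powr r + (1 - a) powr r = 1 / s powr r"
    using s PQ unfolding a1 unfolding a_def by (simp add: powr_divide add_divide_distrib[symmetric])
  then have "tilt z a \<le> (1 / s powr r) powr (lam / r)"
    using tilt_le[OF z l t lt a] by (simp add: r_def)
  also have "\<dots> = s powr (- lam)" using s r by (simp add: powr_divide powr_powr powr_minus_divide)
  finally have "tilt z a ^ n \<le> (s powr (- lam)) ^ n" using tilt_nonneg by (intro power_mono)
  also have "\<dots> = s powr (- (lam * real n))" using s by (simp add: powr_powr[symmetric] powr_realpow[symmetric] powr_powr)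
  finally have T: "tilt z a ^ n \<le> s powr (- (lam * real n))" .
  have e: "(b powr (1 / r)) ^ k = (b ^ k) powr (1 / r)" if "0 \<le> b" for b k
    using that by (induction k) (auto simp: powr_mult)
  have w: "w = B powr (1 / r) / s ^ m"
  proof -
    have "s ^ m = s ^ l * s ^ (m - l)" using lm by (simp add: power_add[symmetric])
    then show ?thesis unfolding w_def a1 unfolding a_def B_def P_def Q_def
      using al by (simp add: power_divide e powr_mult)
  qed
  have w0: "w > 0" unfolding w using B s by simp
  have "even_prob m n R \<le> tilt z a ^ n / (tau * real (m choose l) * w)"
    using even_prob_le_tilt[OF z R tau a] w0 by (simp add: w_def l_def)
  also have "\<dots> \<le> s powr (- (lam * real n)) / (tau * real (m choose l) * w)"
    using T tau ch w0 by (intro divide_right_mono) auto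
  \<comment> \<open>The tilt contributes \<open>s powr (- (lam * real n))\<close> and the weight
    \<open>s ^ m\<close>. Only the difference of these exponents survives, and
    \<open>s \<le> 2\<close>. By \<open>mode\<close>, 1 / B is at most (m + 1) times the binomial
    coefficient.\<close>
  also have "\<dots> = s powr (real m - lam * real n) * (1 / B) powr (1 / r) / (tau * real (m choose l))"
    unfolding w using s B by (simp add: powr_diff powr_minus_divide powr_realpow powr_divide)
  also have "\<dots> \<le> 2 powr (real m - lam * real n) * ((real m + 1) * real (m choose l)) powr (1 / r) / (tau * real (m choose l))"
  proof (intro divide_right_mono mult_mono)
    show "s powr (real m - lam * real n) \<le> 2 powr (real m - lam * real n)"
      using s m by (intro powr_mono2) auto
    show "(1 / B) powr (1 / r) \<le> ((real m + 1) * real (m choose l)) powr (1 / r)"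
      using B r mode by (intro powr_mono2) (auto simp: divide_le_eq)
  qed (use tau ch in auto)
  also have "\<dots> \<le> 2 powr (real m - lam * real n) * ((real m + 1) * real (m choose l) powr (1 / r)) / (tau * real (m choose l))"
  proof -
    have "(real m + 1) powr (1 / r) \<le> (real m + 1) powr 1" using r by (intro powr_mono) auto
    then show ?thesis using tau ch
      by (intro divide_right_mono mult_left_mono) (auto simp: powr_mult intro!: mult_right_mono)
  qed
  also have "\<dots> = 2 powr (real m - lam * real n) * (real m + 1) / tau * (real (m choose l) powr (1 / r) / real (m choose l) powr 1)"
    using ch by simp
  also have "real (m choose l) powr (1 / r) / real (m choose l) powr 1 = real (m choose l) powr (1 / r - 1)"
    by (rule powr_diff[symmetric])
  also have "1 / r - 1 = - (t / (1 + t))" using t by (simp add: r_def field_simps)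
  finally show ?thesis by (simp add: l_def)
qed

section \<open>Uniformity of the bounds along the limit\<close>

text \<open>The quotient z f'(z) / f(z), with f = \<open>exp_tail\<close>, is below c at
  \<open>zl\<close> and at least c at c, so the intermediate value theorem applies. The point is
  that all saddle points for l slightly below c lie in one compact interval away from 0.\<close>

lemma exp_tail_mean_window:
  fixes c :: real
  assumes "2 < c"
  obtains zl l0 where "0 < zl" "zl < c" "l0 < c"
    "\<And>l. l0 < l \<Longrightarrow> l < c \<Longrightarrow> \<exists>z\<in>{zl..c}. z * (exp z - 1) = l * exp_tail z"
proof -
  define g where "g = (\<lambda>z. z * (exp z - 1) / exp_tail z)"
  \<comment> \<open>The quotient is at most 2 exp z for z > 0, and this choice makes
    \<open>2 * exp zl < c\<close>.\<close>
  define zl where "zl = ln (c / 2) / 2"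
  have zl: "0 < zl" using assms by (simp add: zl_def)
  have "ln (c / 2) \<le> c / 2 - 1" using assms by (intro ln_le_minus_one) auto
  then have zlc: "zl < c" using assms by (simp add: zl_def)
  have f: "exp_tail z > 0" if "z > 0" for z using exp_tail_pos that by simp
  have nz: "exp z - 1 - z \<noteq> 0" if "z > 0" for z :: real using f[OF that] by (simp add: exp_tail_def)
  have "zl * (exp zl - 1) < c * exp_tail zl"
  proof -
    have q: "zl^2 / 2 \<le> exp_tail zl" using exp_lower_Taylor_quadratic[of zl] zl by (simp add: exp_tail_def)
    have "1 - zl \<le> exp (- zl)" using exp_ge_add_one_self[of "- zl"] by simp
    then have "(1 - zl) * exp zl \<le> exp (- zl) * exp zl" by (intro mult_right_mono) auto
    then have "exp zl - 1 \<le> zl * exp zl" by (simp add: algebra_simps exp_add[symmetric])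
    then have "zl * (exp zl - 1) \<le> zl * (zl * exp zl)" using zl by (intro mult_left_mono) auto
    also have "\<dots> = (zl^2 / 2) * (2 * exp zl)" by (simp add: power2_eq_square)
    also have "\<dots> \<le> exp_tail zl * (2 * exp zl)" using q by (intro mult_right_mono) auto
    also have "\<dots> < exp_tail zl * c"
    proof (intro mult_strict_left_mono f zl)
      have "exp zl < exp (ln (c / 2))" using zl by (subst exp_less_cancel_iff) (simp add: zl_def)
      then show "2 * exp zl < c" using assms by simp
    qed
    finally show ?thesis by (simp add: mult.commute)
  qed
  then have gl: "g zl < c" using f[OF zl] by (simp add: g_def divide_less_eq)
  have "exp_tail c \<le> exp c - 1" using assms by (simp add: exp_tail_def)
  then have "c * exp_tail c \<le> c * (exp c - 1)" using assms by (intro mult_left_mono) auto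
  then have gc: "c \<le> g c" using f[of c] assms by (simp add: g_def le_divide_eq)
  have cont: "continuous_on {zl..c} g"
    unfolding g_def exp_tail_def using nz zl by (intro continuous_intros) auto
  have "\<exists>z\<in>{zl..c}. z * (exp z - 1) = l * exp_tail z" if "g zl < l" "l < c" for l
  proof -
    have "\<exists>z\<ge>zl. z \<le> c \<and> g z = l" using that gc zlc by (intro IVT'[OF _ _ _ cont]) auto
    then obtain z where z: "zl \<le> z" "z \<le> c" "g z = l" by blast
    then show ?thesis using f[of z] zl by (intro bexI[of _ z]) (auto simp: g_def field_simps)
  qed
  then show ?thesis using that[OF zl zlc gl] by blast
qed

lemma exp_tail_scale_le:
  assumes "0 \<le> x" "x \<le> 1"
  shows "exp_tail (x * z) \<le> x * exp_tail z"
proof -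
  have "exp ((1 - x) *\<^sub>R 0 + x *\<^sub>R z) \<le> (1 - x) * exp 0 + x * exp z"
    using assms by (intro convex_onD[OF exp_convex]) auto
  then show ?thesis by (simp add: exp_tail_def algebra_simps)
qed

text \<open>For a \<le> 1/2 convexity bounds the quotient in \<open>tilt\<close> by 1 - 2 a. For a >
  1/2 it is at most f(-z) / f(z), with f = \<open>exp_tail\<close>; this is continuous and below 1,
  so its maximum over the compact interval is below 1 as well.\<close>

lemma tilt_bounded_away:
  assumes "0 < zl" "zl \<le> zh" "0 < d" "d < 1"
  obtains g where "0 < g" "g < 1" "\<And>z a. zl \<le> z \<Longrightarrow> z \<le> zh \<Longrightarrow> d \<le> a \<Longrightarrow> a \<le> 1 \<Longrightarrow> tilt z a \<le> g"
proof -
  have f: "exp_tail z > 0" if "z > 0" for z using exp_tail_pos that by simp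
  have nz: "exp z - 1 - z \<noteq> 0" if "z > 0" for z :: real using f[OF that] by (simp add: exp_tail_def)
  have "continuous_on {zl..zh} (\<lambda>z. exp_tail (- z) / exp_tail z)"
    unfolding exp_tail_def using nz assms by (intro continuous_intros) auto
  then obtain z0 where z0: "z0 \<in> {zl..zh}" "\<And>z. z \<in> {zl..zh} \<Longrightarrow> exp_tail (- z) / exp_tail z \<le> exp_tail (- z0) / exp_tail z0"
    using continuous_attains_sup[of "{zl..zh}" "\<lambda>z. exp_tail (- z) / exp_tail z"] assms by auto
  define q where "q = exp_tail (- z0) / exp_tail z0"
  have q: "0 \<le> q" "q < 1" using z0 assms f[of z0] exp_tail_minus_less[of z0] exp_tail_nonneg
    by (auto simp: q_def)
  define M where "M = max q (1 - 2 * d)"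
  have M: "0 \<le> M" "M < 1" using q assms by (auto simp: M_def)
  have "tilt z a \<le> (1 + M) / 2" if z: "zl \<le> z" "z \<le> zh" and a: "d \<le> a" "a \<le> 1" for z a
  proof -
    have fz: "exp_tail z > 0" using f z assms by simp
    have "exp_tail ((1 - 2 * a) * z) / exp_tail z \<le> M"
    proof (cases "1 - 2 * a \<ge> 0")
      case True
      have "exp_tail ((1 - 2 * a) * z) \<le> (1 - 2 * a) * exp_tail z" using True a assms by (intro exp_tail_scale_le) auto
      also have "\<dots> \<le> M * exp_tail z" using a fz by (intro mult_right_mono) (auto simp: M_def)
      finally show ?thesis using fz by (simp add: divide_le_eq)
    next
      case False
      have "exp_tail ((2 * a - 1) * (- z)) \<le> (2 * a - 1) * exp_tail (- z)" using False a by (intro exp_tail_scale_le) auto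
      also have "\<dots> \<le> 1 * exp_tail (- z)" using a exp_tail_nonneg by (intro mult_right_mono) auto
      also have "\<dots> \<le> q * exp_tail z" using z0(2)[of z] z fz by (simp add: q_def[symmetric] divide_le_eq)
      also have "\<dots> \<le> M * exp_tail z" using fz by (intro mult_right_mono) (auto simp: M_def)
      finally show ?thesis using fz by (simp add: divide_le_eq algebra_simps)
    qed
    then show ?thesis unfolding tilt_def by (intro divide_right_mono add_left_mono) auto
  qed
  then show ?thesis using M by (intro that[of "(1 + M) / 2"]) auto
qed

text \<open>The saddle point is taken for a mean \<open>lam\<close> slightly below \<open>c\<close>,
  so that the mass bound \<open>cover_mass_lower_bound\<close> applies eventually. All losses are
  exponential in a small multiple of m and go into exp(eta m). The rate \<open>rho\<close> is
  independent of \<open>eta\<close>, so \<open>eta\<close> can be chosen afterwards depending on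
  it.\<close>

lemma even_prob_asymptotic:
  fixes m n :: "nat \<Rightarrow> nat" and c kap d :: real
  assumes m: "filterlim m at_top sequentially" and n: "filterlim n at_top sequentially"
    and lim: "(\<lambda>s. real (m s) / real (n s)) \<longlonglongrightarrow> c"
    and c: "2 < c" "c < kap" and kap: "14/5 \<le> kap" and d: "0 < d" "d < 1"
  obtains rho where "0 < rho" "rho < 1"
    "\<And>eta. 0 < eta \<Longrightarrow> eventually (\<lambda>s. \<forall>R\<subseteq>{..<m s}.
       even_prob (m s) (n s) R \<le> exp (eta * real (m s)) * real (m s choose card R) powr (- 1 / kap) \<and>
       (d * real (m s) \<le> real (card R) \<longrightarrow>
         even_prob (m s) (n s) R \<le> exp (eta * real (m s)) * rho powr real (m s))) sequentially"
proof -
  obtain zl l0 where zl: "0 < zl" "zl < c" and l0: "l0 < c"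
    and win: "\<And>l. l0 < l \<Longrightarrow> l < c \<Longrightarrow> \<exists>z\<in>{zl..c}. z * (exp z - 1) = l * exp_tail z"
    using exp_tail_mean_window[OF c(1)] by metis
  obtain g where g: "0 < g" "g < 1"
    and tg: "\<And>z a. zl \<le> z \<Longrightarrow> z \<le> c \<Longrightarrow> d \<le> a \<Longrightarrow> a \<le> 1 \<Longrightarrow> tilt z a \<le> g"
    using tilt_bounded_away[of zl c d] zl d by (metis less_imp_le)
  \<comment> \<open>Eventually m \<le> (c + 1) n, which converts the bound \<open>g ^ n\<close> into
    \<open>rho powr m\<close>.\<close>
  define rho where "rho = g powr (1 / (c + 1))"
  have "g powr (1 / (c + 1)) < 1 powr (1 / (c + 1))" using g c by (intro powr_less_mono2) auto
  then have rho: "0 < rho" "rho < 1" using g by (auto simp: rho_def)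
  \<comment> \<open>Then t / (1 + t) = 1 / kap, and \<open>kap \<ge> 14/5\<close> becomes
    \<open>t \<le> 5/9\<close>.\<close>
  define t where "t = 1 / (kap - 1)"
  have t: "0 < t" "t \<le> 5/9" using kap by (auto simp: t_def field_simps)
  have tk: "t / (1 + t) = 1 / kap" using kap by (simp add: t_def field_simps)
  define b where "b = min 1 (zl / (c + 1))"
  have b: "0 < b" "b \<le> 1" using zl c by (auto simp: b_def)
  define L where "L = - ln b"
  have L: "0 \<le> L" using b by (simp add: L_def)
  have "eventually (\<lambda>s. \<forall>R\<subseteq>{..<m s}.
       even_prob (m s) (n s) R \<le> exp (eta * real (m s)) * real (m s choose card R) powr (- 1 / kap) \<and>
       (d * real (m s) \<le> real (card R) \<longrightarrow>
         even_prob (m s) (n s) R \<le> exp (eta * real (m s)) * rho powr real (m s))) sequentially"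
    if eta: "0 < eta" for eta
  proof -
    \<comment> \<open>The bound (c - l0) / 2 keeps \<open>lam\<close> above \<open>l0\<close>, and
      (c - 2) / 2 keeps \<open>lam\<close> and \<open>c1\<close> at least 2. The last bound limits
      the total exponent e (2 + 3 L) of the losses to eta / 2.\<close>
    define e where "e = Min {1, (c - l0) / 2, (c - 2) / 2, eta / (2 * (2 + 3 * L))}"
    have e: "0 < e" "e \<le> 1" "e \<le> (c - l0) / 2" "e \<le> (c - 2) / 2" "e \<le> eta / (2 * (2 + 3 * L))"
    proof -
      have "e \<le> x" if "x \<in> {1, (c - l0) / 2, (c - 2) / 2, eta / (2 * (2 + 3 * L))}" for x
        unfolding e_def using that by (intro Min_le) auto
      then show "e \<le> 1" "e \<le> (c - l0) / 2" "e \<le> (c - 2) / 2" "e \<le> eta / (2 * (2 + 3 * L))" by blast+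
      show "0 < e" using l0 c eta L by (simp add: e_def)
    qed
    have eL: "e * (2 + 3 * L) \<le> eta / 2"
      using e(5) L by (simp add: field_simps)
    define lam where "lam = c - e"
    define c1 where "c1 = c - 2 * e"
    define c2 where "c2 = c - e / 2"
    have cc: "0 \<le> c1" "c1 < lam" "lam < c2" "c2 < c" using e c by (auto simp: c1_def c2_def lam_def)
    have lam: "l0 < lam" "lam < c" "2 \<le> lam" using e l0 c by (auto simp: lam_def field_simps)
    have lt: "t * (lam - 1) \<le> 1" using lam c kap by (simp add: t_def field_simps)
    obtain z where z: "zl \<le> z" "z \<le> c" and zlam: "z * (exp z - 1) = lam * exp_tail z"
      using win[OF lam(1,2)] by auto
    have z0: "z > 0" using z zl by simp
    obtain N where N: "\<And>n m. n \<ge> N \<Longrightarrow> c2 * real n \<le> real m \<Longrightarrow> b * real m \<le> real n * z \<Longrightarrow>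
       b powr (real m - c1 * real n) / (2 * (real m + 1)) * exp_tail z ^ n \<le> cover_mass n z m"
      using cover_mass_lower_bound[OF z0 zlam cc(1,2,3) b] by blast
    have ev1: "eventually (\<lambda>s. max N 1 \<le> n s) sequentially"
      using n[unfolded filterlim_at_top] by blast
    have ev2: "eventually (\<lambda>s. c2 < real (m s) / real (n s)) sequentially"
      using order_tendstoD(1)[OF lim] cc by blast
    have ev3: "eventually (\<lambda>s. real (m s) / real (n s) < c + e) sequentially"
      using order_tendstoD(2)[OF lim] e by simp
    have fm: "filterlim (\<lambda>s. real (m s)) at_top sequentially"
      using filterlim_compose[OF filterlim_real_sequentially m] .
    have "eventually (\<lambda>x::real. 2 * (x + 1)^2 \<le> exp (eta / 2 * x)) at_top"
      using eta by real_asymp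
    then have ev4: "eventually (\<lambda>s. 2 * (real (m s) + 1)^2 \<le> exp (eta / 2 * real (m s))) sequentially"
      by (rule eventually_compose_filterlim[OF _ fm])
    show ?thesis using ev1 ev2 ev3 ev4
    proof eventually_elim
      case (elim s)
      define M where "M = m s"
      define n' where "n' = n s"
      have n1: "N \<le> n'" "1 \<le> n'" using elim by (auto simp: n'_def)
      have r: "c2 * real n' \<le> real M" "real M \<le> (c + e) * real n'"
        using elim n1 by (auto simp: M_def n'_def field_simps)
      have nM: "real n' \<le> real M"
      proof -
        have "1 * real n' \<le> c2 * real n'" using cc lam by (intro mult_right_mono) auto
        then show ?thesis using r by simp
      qed
      have M0: "0 < M" using nM n1 by simp
      have lM: "lam * real n' \<le> real M"
        using mult_right_mono[of lam c2 "real n'"] cc r by simp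
      have Mc: "real M \<le> (c + 1) * real n'"
        using mult_right_mono[of "c + e" "c + 1" "real n'"] e r by simp
      have bz: "b * real M \<le> real n' * z"
      proof -
        have "b * real M \<le> zl / (c + 1) * ((c + 1) * real n')"
          using Mc zl c by (intro mult_mono) (auto simp: b_def)
        also have "\<dots> = real n' * zl" using c by simp
        also have "\<dots> \<le> real n' * z" using z by (intro mult_left_mono) auto
        finally show ?thesis .
      qed
      define tau where "tau = b powr (real M - c1 * real n') / (2 * (real M + 1))"
      have tau: "tau > 0" "tau * exp_tail z ^ n' \<le> cover_mass n' z M"
        using b N[OF n1(1) r(1) bz] by (auto simp: tau_def)
      have x1: "real M - lam * real n' \<le> 2 * e * real M"
      proof -
        have "real M - lam * real n' \<le> 2 * e * real n'" using r(2) by (simp add: lam_def algebra_simps)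
        also have "\<dots> \<le> 2 * e * real M" using nM e by (intro mult_left_mono) auto
        finally show ?thesis .
      qed
      have x2: "real M - c1 * real n' \<le> 3 * e * real M"
      proof -
        have "real M - c1 * real n' \<le> 3 * e * real n'" using r(2) by (simp add: c1_def algebra_simps)
        also have "\<dots> \<le> 3 * e * real M" using nM e by (intro mult_left_mono) auto
        finally show ?thesis .
      qed
      have t1: "2 powr (real M - lam * real n') \<le> exp (2 * e * real M)"
      proof -
        have "(real M - lam * real n') * ln 2 \<le> (2 * e * real M) * 1"
          using x1 lM ln_2_less_1 e by (intro mult_mono) auto
        then show ?thesis by (simp add: powr_def)
      qed
      have t2: "1 / tau \<le> 2 * (real M + 1) * exp (3 * e * L * real M)"
      proof -
        have "(real M - c1 * real n') * L \<le> (3 * e * real M) * L" using x2 L by (intro mult_right_mono)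
        then have "exp ((real M - c1 * real n') * L) \<le> exp (3 * e * L * real M)" by (simp add: mult_ac)
        moreover have "1 / (b powr (real M - c1 * real n')) = exp ((real M - c1 * real n') * L)"
          using b by (simp add: powr_def L_def exp_minus divide_inverse)
        moreover have "1 / tau = 2 * (real M + 1) * (1 / (b powr (real M - c1 * real n')))"
          by (simp add: tau_def)
        ultimately show ?thesis by (simp add: mult_left_mono)
      qed
      have E: "exp (2 * e * real M) * (real M + 1) * (2 * (real M + 1) * exp (3 * e * L * real M)) \<le> exp (eta * real M)"
      proof -
        have "exp (2 * e * real M) * (real M + 1) * (2 * (real M + 1) * exp (3 * e * L * real M))
          = (2 * (real M + 1)^2) * exp (e * (2 + 3 * L) * real M)"
          by (simp add: power2_eq_square exp_add[symmetric] algebra_simps)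
        also have "\<dots> \<le> exp (eta / 2 * real M) * exp (eta / 2 * real M)"
          using elim(4) mult_right_mono[OF eL, of "real M"] by (intro mult_mono) (simp_all add: M_def)
        also have "\<dots> = exp (eta * real M)" by (simp add: exp_add[symmetric])
        finally show ?thesis .
      qed
      have main: "even_prob M n' R \<le> exp (eta * real M) * real (M choose card R) powr (- 1 / kap) \<and>
         (d * real M \<le> real (card R) \<longrightarrow> even_prob M n' R \<le> exp (eta * real M) * rho powr real M)"
        if R: "R \<subseteq> {..<M}" for R
      proof (intro conjI impI)
        let ?C = "real (M choose card R) powr (- 1 / kap)"
        have "even_prob M n' R \<le> 2 powr (real M - lam * real n') * (real M + 1) / tau * real (M choose card R) powr (- (t / (1 + t)))"
          by (rule even_prob_le_binomial_powr[OF z0 zlam t lam(3) lt R M0 lM tau])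
        also have "\<dots> = 2 powr (real M - lam * real n') * (real M + 1) * (1 / tau) * ?C"
          unfolding tk by simp
        also have "\<dots> \<le> exp (2 * e * real M) * (real M + 1) * (2 * (real M + 1) * exp (3 * e * L * real M)) * ?C"
          using t1 t2 tau by (intro mult_mono) auto
        also have "\<dots> \<le> exp (eta * real M) * ?C" using E by (intro mult_right_mono) auto
        finally show "even_prob M n' R \<le> exp (eta * real M) * ?C" .
      next
        assume dR: "d * real M \<le> real (card R)"
        have lM: "card R \<le> M" using card_mono[OF _ R] by simp
        have "even_prob M n' R \<le> (real M + 1) * tilt z (real (card R) / real M) ^ n' / tau"
          by (rule even_prob_le_tilt_mean[OF z0 R M0 tau])
        also have "\<dots> = 1 * (real M + 1) * (1 / tau) * tilt z (real (card R) / real M) ^ n'" by simp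
        also have "\<dots> \<le> exp (2 * e * real M) * (real M + 1) * (2 * (real M + 1) * exp (3 * e * L * real M)) * rho powr real M"
        proof (intro mult_mono t2)
          have "tilt z (real (card R) / real M) ^ n' \<le> g ^ n'"
            using z dR lM M0 tilt_nonneg by (intro power_mono tg) (auto simp: le_divide_eq)
          also have "\<dots> = g powr real n'" using g by (simp add: powr_realpow)
          also have "\<dots> \<le> g powr (1 / (c + 1) * real M)"
            using g Mc c by (intro powr_mono') (auto simp: field_simps)
          also have "\<dots> = rho powr real M" by (simp add: rho_def powr_powr)
          finally show "tilt z (real (card R) / real M) ^ n' \<le> rho powr real M" .
        qed (use e tau tilt_nonneg in auto)
        also have "\<dots> \<le> exp (eta * real M) * rho powr real M" using E by (intro mult_right_mono) auto
        finally show "even_prob M n' R \<le> exp (eta * real M) * rho powr real M" .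
      qed
      then show ?case by (simp add: M_def n'_def)
    qed
  qed
  then show ?thesis using that rho by blast
qed

section \<open>Summation over all sizes\<close>

lemma power_le_fact_exp:
  fixes x :: real
  assumes "0 \<le> x"
  shows "x ^ k \<le> fact k * exp x"
proof -
  have "x ^ k / fact k \<le> exp x"
    using sum_le_suminf[OF sums_summable[OF exp_converges[of x]], of "{k}"] assms
      sums_unique[OF exp_converges[of x]]
    by (simp add: divide_inverse mult.commute)
  then show ?thesis by (simp add: divide_le_eq mult.commute)
qed

lemma binomial_le_exp_power:
  assumes "0 < l"
  shows "real (m choose l) \<le> (exp 1 * real m / real l) ^ l"
proof -
  have "real l ^ l \<le> fact l * exp (real l)" by (rule power_le_fact_exp) simp
  also have "exp (real l) = exp 1 ^ l" by (simp add: exp_of_nat_mult[symmetric])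
  finally have 1: "real l ^ l \<le> fact l * exp 1 ^ l" .
  have "real ((m choose l) * fact l) \<le> real (m ^ l)" by (intro of_nat_mono binomial_fact_pow)
  then have 2: "real (m choose l) * fact l \<le> real m ^ l" by simp
  have "real (m choose l) * real l ^ l \<le> real (m choose l) * (fact l * exp 1 ^ l)"
    using 1 by (intro mult_left_mono) auto
  also have "\<dots> = (real (m choose l) * fact l) * exp 1 ^ l" by simp
  also have "\<dots> \<le> real m ^ l * exp 1 ^ l" using 2 by (intro mult_right_mono) auto
  finally show ?thesis using assms by (simp add: power_divide power_mult_distrib le_divide_eq mult.commute)
qed

lemma cover_num_pos:
  assumes "0 < n" "2 * n \<le> m"
  shows "0 < cover_num m n"
  using assms
proof (induction n arbitrary: m)
  case 0
  then show ?case by simp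
next
  case (Suc n)
  then obtain m' where m: "m = Suc m'" by (cases m) auto
  have rec: "cover_num m (Suc n) = real (Suc n) * (cover_num m' (Suc n) + real m' * cover_num (m' - 1) n)"
    unfolding m by (rule cover_num_Suc_Suc)
  show ?case
  proof (cases "n = 0")
    case True
    then show ?thesis using Suc.prems by (simp add: cover_num_def exp_tail_fps_nth)
  next
    case False
    then have "0 < cover_num (m' - 1) n" using Suc m by simp
    then have "0 < real m' * cover_num (m' - 1) n" using Suc.prems m by (intro mult_pos_pos) auto
    then show ?thesis unfolding rec using cover_num_nonneg[of m' "Suc n"]
      by (intro mult_pos_pos) auto
  qed
qed

lemma even_prob_nonneg: "0 \<le> even_prob m n R"
  using cover_num_nonneg by (simp add: even_prob_def)

text \<open>\<open>R\<close> is the disjoint union of its intersections with the fibres, all of even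
  size.\<close>

lemma even_prob_odd:
  assumes "R \<subseteq> {..<m}" "odd (card R)"
  shows "even_prob m n R = 0"
proof -
  have "even_maps {..<m} {..<n} R = {}"
  proof (rule ccontr)
    assume "even_maps {..<m} {..<n} R \<noteq> {}"
    then obtain \<phi> where p: "\<phi> \<in> even_maps {..<m} {..<n} R" by blast
    have fR: "finite R" using assms finite_subset by auto
    have "(\<Sum>c\<in>{..<n}. card {r \<in> R. \<phi> r = c}) = card (\<Union>c\<in>{..<n}. {r \<in> R. \<phi> r = c})"
      using fR by (intro card_UN_disjoint[symmetric]) auto
    also have "(\<Union>c\<in>{..<n}. {r \<in> R. \<phi> r = c}) = R"
      using p assms by (auto simp: even_maps_def PiE_def Pi_def)
    finally have "card R = (\<Sum>c\<in>{..<n}. card {r \<in> R. \<phi> r = c})" ..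
    moreover have "even (\<Sum>c\<in>{..<n}. card {r \<in> R. \<phi> r = c})"
      using p by (intro dvd_sum) (auto simp: even_maps_def)
    ultimately show False using assms by simp
  qed
  then show ?thesis by (simp add: even_prob_def)
qed

text \<open>Use \<open>card_even_maps_small\<close> with n0 = n - q and m0 = m - 2 q. The
  assumptions give 2 q \<le> n and 4 q \<le> m, so at least half of the columns and rows survive all
  removals.\<close>

lemma even_prob_small:
  assumes R: "R \<subseteq> {..<m}" "card R = 2 * q" and K: "0 < K" and n: "2 * n \<le> m" "m \<le> K * n"
    and q: "2 * K * q \<le> m" "0 < m"
  shows "even_prob m n R \<le> (real (2 * q) * (4 * real K + 2) / real m) ^ q"
proof -
  have npos: "0 < n" using n q by (cases n) auto
  have qn: "2 * q \<le> n"
  proof -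
    have "K * (2 * q) = 2 * K * q" by simp
    also have "\<dots> \<le> K * n" using n(2) q(1) by (rule order_trans[rotated])
    finally show ?thesis using K by (simp only: mult_le_cancel1)
  qed
  have qm: "4 * q \<le> m" using qn n by simp
  define n0 where "n0 = n - q"
  define m0 where "m0 = m - 2 * q"
  have pos: "0 < n0" "0 < m0" using qn npos qm q by (auto simp: n0_def m0_def)
  have c: "0 < cover_num m n" using cover_num_pos npos n by simp
  have "real (card (even_maps {..<m} {..<n} R)) \<le>
      (real (2 * q) * (1 / real n0 + 1 / real m0)) ^ q * cover_num (card {..<m}) (card {..<n})"
    using R qn qm pos by (intro card_even_maps_small) (auto simp: n0_def m0_def)
  then have "even_prob m n R \<le> (real (2 * q) * (1 / real n0 + 1 / real m0)) ^ q"
    using c by (simp add: even_prob_def divide_le_eq)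
  also have "\<dots> \<le> (real (2 * q) * (4 * real K + 2) / real m) ^ q"
  proof (intro power_mono)
    have "real m \<le> real K * (2 * real n0)"
    proof -
      have "K * n \<le> K * (2 * n0)" using qn by (intro mult_left_mono) (auto simp: n0_def)
      then have "m \<le> K * (2 * n0)" using n by linarith
      then have "real m \<le> real (K * (2 * n0))" by (rule of_nat_mono)
      then show ?thesis by simp
    qed
    then have 1: "1 / real n0 \<le> 2 * real K / real m"
      using pos q by (simp add: field_simps)
    have "real m \<le> 2 * real m0" using qm by (simp add: m0_def)
    then have 2: "1 / real m0 \<le> 2 / real m"
      using pos q by (simp add: field_simps)
    have "1 / real n0 + 1 / real m0 \<le> (4 * real K + 2) / real m"
    proof -
      have "2 * real K / real m \<le> 4 * real K / real m" by (intro divide_right_mono) auto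
      then show ?thesis using 1 2 by (simp add: add_divide_distrib)
    qed
    then have "real (2 * q) * (1 / real n0 + 1 / real m0) \<le> real (2 * q) * ((4 * real K + 2) / real m)"
      by (intro mult_left_mono) auto
    then show "real (2 * q) * (1 / real n0 + 1 / real m0) \<le> real (2 * q) * (4 * real K + 2) / real m" by simp
  qed simp
  finally show ?thesis .
qed

section \<open>Contributions of small and of large row sets\<close>

lemma expected_Z_even_prob:
  assumes "\<And>j. j \<in> {1..K} \<Longrightarrow> 0 < n j \<and> 2 * n j \<le> m"
  shows "expected_Z K m n l = (\<Sum>R | R \<subseteq> {..<m} \<and> card R = l. \<Prod>j\<in>{1..K}. even_prob m (n j) R)"
  using assms unfolding even_prob_def by (intro expected_Z_eq cover_num_pos) auto

lemma card_row_sets: "card {R. R \<subseteq> {..<m} \<and> card R = l} = m choose l"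
  using n_subsets[of "{..<m}" l] by simp

text \<open>With v = l / m, every two rows of \<open>R\<close> contribute (e / v)^2 for the choice
  of the set and (v (4 K + 2))^K for the blocks, that is A v^(K-2). One of these l / 2 factors is
  kept and the others are at most 1/2. Odd sizes contribute nothing.\<close>

lemma expected_Z_small:
  fixes K m l :: nat and A :: real
  defines "A \<equiv> exp 2 * (4 * real K + 2) ^ K"
  assumes K: "3 \<le> K" and n: "\<And>j. j \<in> {1..K} \<Longrightarrow> 2 * n j \<le> m \<and> m \<le> K * n j" and m: "0 < m"
    and l: "2 \<le> l" and small: "2 * A * real l \<le> real m"
  shows "expected_Z K m n l \<le> A * real l ^ (K - 2) / real m ^ (K - 2) * (1 / 2) ^ (l div 2 - 1)"
proof -
  have A: "1 \<le> A" "real K \<le> A"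
  proof -
    have "real K \<le> 4 * real K + 2" by simp
    also have "\<dots> \<le> (4 * real K + 2) ^ K" using K by (intro self_le_power) auto
    also have "\<dots> \<le> A" unfolding A_def by (simp add: mult_le_cancel_right1)
    finally show "real K \<le> A" .
    then show "1 \<le> A" using K by simp
  qed
  have "0 < n j \<and> 2 * n j \<le> m" if "j \<in> {1..K}" for j using n[OF that] m by (cases "n j") auto
  then have EZ: "expected_Z K m n l = (\<Sum>R | R \<subseteq> {..<m} \<and> card R = l. \<Prod>j\<in>{1..K}. even_prob m (n j) R)"
    by (rule expected_Z_even_prob)
  show ?thesis
  proof (cases "even l")
    case False
    have "expected_Z K m n l = 0"
      unfolding EZ
    proof (intro sum.neutral ballI)
      fix R assume "R \<in> {R. R \<subseteq> {..<m} \<and> card R = l}"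
      then have "even_prob m (n 1) R = 0" using False by (intro even_prob_odd) auto
      then show "(\<Prod>j\<in>{1..K}. even_prob m (n j) R) = 0" using K by (intro prod_zero) (auto intro!: bexI[of _ 1])
    qed
    then show ?thesis using A by simp
  next
    case True
    then obtain q where lq: "l = 2 * q" by auto
    have q: "1 \<le> q" using l lq by simp
    have Kq: "2 * K * q \<le> m"
    proof -
      have "real (2 * K * q) = real K * real l" using lq by simp
      also have "\<dots> \<le> A * real l" using A by (intro mult_right_mono) auto
      also have "\<dots> \<le> 2 * A * real l" using A by simp
      also have "\<dots> \<le> real m" by (rule small)
      finally show ?thesis unfolding of_nat_le_iff .
    qed
    define v where "v = real l / real m"
    have v: "0 < v" "A * v \<le> 1 / 2" "v \<le> 1"
    proof -
      show "0 < v" using l m by (simp add: v_def)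
      show "A * v \<le> 1 / 2" using small m by (simp add: v_def field_simps)
      moreover have "1 * v \<le> A * v" using A \<open>0 < v\<close> by (intro mult_right_mono) auto
      ultimately show "v \<le> 1" by linarith
    qed
    let ?b = "(v * (4 * real K + 2)) ^ q"
    have "expected_Z K m n l \<le> (\<Sum>R | R \<subseteq> {..<m} \<and> card R = l. \<Prod>j\<in>{1..K}. ?b)"
      unfolding EZ
    proof (intro sum_mono prod_mono conjI even_prob_nonneg)
      fix R j assume "R \<in> {R. R \<subseteq> {..<m} \<and> card R = l}" "j \<in> {1..K}"
      then show "even_prob m (n j) R \<le> ?b"
        using even_prob_small[of R m q K "n j"] n[of j] K Kq m lq by (simp add: v_def)
    qed
    also have "\<dots> = real (m choose l) * ?b ^ K" by (simp add: card_row_sets)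
    also have "\<dots> \<le> (exp 1 * real m / real l) ^ l * ?b ^ K"
      using l v by (intro mult_right_mono binomial_le_exp_power) auto
    also have "(exp 1 * real m / real l) ^ l * ?b ^ K = (A * v ^ (K - 2)) ^ q"
    proof -
      have "(exp 1 * real m / real l) ^ l = ((exp 1 / v)^2) ^ q"
        unfolding lq power_mult v_def by simp
      moreover have "?b ^ K = ((v * (4 * real K + 2)) ^ K) ^ q"
        by (simp only: power_mult[symmetric] mult.commute)
      moreover have "(exp 1 / v)^2 * (v * (4 * real K + 2)) ^ K = A * v ^ (K - 2)"
      proof -
        have "v ^ K = v^2 * v ^ (K - 2)"
        proof -
          have "2 + (K - 2) = K" using K by simp
          then show ?thesis using power_add[of v 2 "K - 2"] by (simp only:)
        qed
        moreover have "(exp 1 :: real)^2 = exp 2" by (simp add: exp_of_nat_mult[symmetric])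
        ultimately show ?thesis using v by (simp add: A_def power_divide power_mult_distrib)
      qed
      ultimately show ?thesis by (simp only: power_mult_distrib[symmetric])
    qed
    also have "\<dots> \<le> (A * v ^ (K - 2)) * (1 / 2) ^ (q - 1)"
    proof -
      have "v ^ (K - 2) \<le> v ^ 1" using v K by (intro power_decreasing) auto
      then have "A * v ^ (K - 2) \<le> A * v" using A by (intro mult_left_mono) auto
      then have h: "A * v ^ (K - 2) \<le> 1 / 2" using v by simp
      have "(A * v ^ (K - 2)) ^ q = (A * v ^ (K - 2)) * (A * v ^ (K - 2)) ^ (q - 1)"
        using q by (cases q) auto
      also have "\<dots> \<le> (A * v ^ (K - 2)) * (1 / 2) ^ (q - 1)"
        using h A v by (intro mult_left_mono power_mono) auto
      finally show ?thesis .
    qed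
    finally show ?thesis using lq by (simp add: v_def power_divide)
  qed
qed

text \<open>The power of l is at most a constant times exp(l / 4), and exp(1/4) is below the square
  root of 2, so a geometric series dominates.\<close>

lemma polynomial_half_power_sum:
  obtains S where "0 < S" "\<And>m. (\<Sum>l=2..m. real l ^ k * (1 / 2) ^ (l div 2 - 1)) \<le> S"
proof -
  define x where "x = (exp (1/4 :: real)) * (1 / 2) powr (1 / 2)"
  have x: "0 < x" "x < 1"
  proof -
    have "x = exp (1/4 - ln 2 / 2)" by (simp add: x_def powr_def exp_add[symmetric] ln_div)
    moreover have "ln 2 > (1/2 :: real)" using ln2_ge_two_thirds by simp
    ultimately show "0 < x" "x < 1" by simp_all
  qed
  define D where "D = 4 * (4 ^ k * fact k :: real)"
  have "real l ^ k * (1 / 2) ^ (l div 2 - 1) \<le> D * x ^ l" if "2 \<le> l" for l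
  proof -
    have "(real l / 4) ^ k \<le> fact k * exp (real l / 4)" by (rule power_le_fact_exp) simp
    then have 1: "real l ^ k \<le> 4 ^ k * fact k * exp (real l / 4)"
      by (simp add: power_divide divide_le_eq mult_ac)
    have "(1 / 2 :: real) ^ (l div 2 - 1) = (1 / 2) powr real (l div 2 - 1)" by (simp add: powr_realpow)
    also have "\<dots> \<le> (1 / 2) powr (real l / 2 - 2)" using that by (intro powr_mono') linarith+
    also have "\<dots> = 4 * (1 / 2) powr (real l / 2)" by (simp add: powr_diff power_divide)
    finally have 2: "(1 / 2 :: real) ^ (l div 2 - 1) \<le> 4 * (1 / 2) powr (real l / 2)" .
    have "real l ^ k * (1 / 2) ^ (l div 2 - 1) \<le> (4 ^ k * fact k * exp (real l / 4)) * (4 * (1 / 2) powr (real l / 2))"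
      using 1 2 by (intro mult_mono) auto
    also have "\<dots> = D * x ^ l"
    proof -
      have "exp (real l / 4) = exp (1/4) ^ l" by (simp add: exp_of_nat_mult[symmetric])
      moreover have "(1 / 2 :: real) powr (real l / 2) = ((1 / 2) powr (1 / 2)) ^ l"
        by (simp add: powr_realpow[symmetric] powr_powr)
      ultimately show ?thesis by (simp add: D_def x_def power_mult_distrib)
    qed
    finally show ?thesis .
  qed
  then have "(\<Sum>l=2..m. real l ^ k * (1 / 2) ^ (l div 2 - 1)) \<le> D * (1 / (1 - x))" for m
  proof -
    assume h: "\<And>l. 2 \<le> l \<Longrightarrow> real l ^ k * (1 / 2) ^ (l div 2 - 1) \<le> D * x ^ l"
    have "(\<Sum>l=2..m. real l ^ k * (1 / 2) ^ (l div 2 - 1)) \<le> (\<Sum>l=2..m. D * x ^ l)"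
      using h by (intro sum_mono) auto
    also have "\<dots> = D * (\<Sum>l=2..m. x ^ l)" by (simp add: sum_distrib_left)
    also have "(\<Sum>l=2..m. x ^ l) \<le> (\<Sum>l. x ^ l)"
      using x by (intro sum_le_suminf summable_geometric) auto
    also have "(\<Sum>l. x ^ l) = 1 / (1 - x)" using x by (intro suminf_geometric) auto
    finally show ?thesis by (simp add: D_def)
  qed
  moreover have "0 < D * (1 / (1 - x))" using x by (simp add: D_def)
  ultimately show ?thesis using that by blast
qed

text \<open>Block 1 is bounded by the geometric mean of both estimates with weight s = K - kap on
  the second. The first estimate then has total exponent (1 - s) + (K - 1) = kap, which turns the
  binomial factor into 1 / (m choose l) and cancels the number of row sets exactly. What remains is
  \<open>rho powr (s * m)\<close>.\<close>

lemma expected_Z_large: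
  fixes K m l :: nat and kap d rho X :: real
  assumes n: "\<And>j. j \<in> {1..K} \<Longrightarrow> 0 < n j \<and> 2 * n j \<le> m"
    and K: "1 \<le> K" "real K - 1 \<le> kap" "kap < real K" "0 < kap" and X: "0 < X" and rho: "0 < rho"
    and b1: "\<And>j R. j \<in> {1..K} \<Longrightarrow> R \<subseteq> {..<m} \<Longrightarrow>
      even_prob m (n j) R \<le> X * real (m choose card R) powr (- 1 / kap)"
    and b2: "\<And>R. R \<subseteq> {..<m} \<Longrightarrow> d * real m \<le> real (card R) \<Longrightarrow>
      even_prob m (n 1) R \<le> X * rho powr real m"
    and l: "l \<le> m" "d * real m \<le> real l"
  shows "expected_Z K m n l \<le> X ^ K * rho powr ((real K - kap) * real m)"
proof -
  define C where "C = real (m choose l)"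
  define s where "s = real K - kap"
  define Y where "Y = X * C powr (- 1 / kap)"
  define W where "W = X * rho powr real m"
  have C: "1 \<le> C" using l by (simp add: C_def Suc_le_eq)
  have Y: "0 < Y" and W: "0 < W" using C X rho by (simp_all add: Y_def W_def)
  have s: "0 < s" "s \<le> 1" using K by (auto simp: s_def)
  have prod_le: "(\<Prod>j\<in>{1..K}. even_prob m (n j) R) \<le> (Y powr (1 - s) * W powr s) * Y ^ (K - 1)"
    if R: "R \<subseteq> {..<m}" "card R = l" for R
  proof -
    let ?p = "\<lambda>j. even_prob m (n j) R"
    have "?p 1 \<le> Y powr (1 - s) * W powr s"
    proof (cases "?p 1 = 0")
      case True
      then show ?thesis by simp
    next
      case False
      then have p: "0 < ?p 1" using even_prob_nonneg[of m "n 1" R] by simp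
      have "?p 1 = ?p 1 powr (1 - s) * ?p 1 powr s" using p by (simp add: powr_add[symmetric])
      also have "\<dots> \<le> Y powr (1 - s) * W powr s"
        using b1[of 1 R] b2[of R] R l K p s
        by (intro mult_mono powr_mono2) (auto simp: Y_def W_def C_def)
      finally show ?thesis .
    qed
    moreover have "(\<Prod>j\<in>{1..K} - {1}. ?p j) \<le> (\<Prod>j\<in>{1..K} - {1}. Y)"
      using b1[OF _ R(1)] R(2) by (intro prod_mono) (auto simp: even_prob_nonneg Y_def C_def)
    ultimately have "?p 1 * (\<Prod>j\<in>{1..K} - {1}. ?p j) \<le> (Y powr (1 - s) * W powr s) * (\<Prod>j\<in>{1..K} - {1}. Y)"
      using Y by (intro mult_mono prod_nonneg) (auto simp: even_prob_nonneg)
    moreover have "(\<Prod>j\<in>{1..K}. ?p j) = ?p 1 * (\<Prod>j\<in>{1..K} - {1}. ?p j)"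
      using K by (intro prod.remove) auto
    moreover have "(\<Prod>j\<in>{1..K} - {1}. Y) = Y ^ (K - 1)" using K by simp
    ultimately show ?thesis by (simp only:)
  qed
  have "expected_Z K m n l = (\<Sum>R | R \<subseteq> {..<m} \<and> card R = l. \<Prod>j\<in>{1..K}. even_prob m (n j) R)"
    using n by (rule expected_Z_even_prob)
  also have "\<dots> \<le> (\<Sum>R | R \<subseteq> {..<m} \<and> card R = l. (Y powr (1 - s) * W powr s) * Y ^ (K - 1))"
    using prod_le by (intro sum_mono) auto
  also have "\<dots> = C * ((Y powr (1 - s) * W powr s) * Y ^ (K - 1))" by (simp add: card_row_sets C_def)
  also have "\<dots> = X ^ K * rho powr (s * real m)"
  proof -
    have "Y ^ (K - 1) = Y powr (real K - 1)" using Y K by (simp add: powr_realpow[symmetric] of_nat_diff)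
    then have "Y powr (1 - s) * Y ^ (K - 1) = Y powr kap" by (simp add: powr_add[symmetric] s_def)
    also have "\<dots> = X powr kap * C powr (- 1)" using X C K by (simp add: Y_def powr_mult powr_powr)
    finally have "Y powr (1 - s) * Y ^ (K - 1) = X powr kap / C" using C by (simp add: powr_minus divide_inverse)
    moreover have "W powr s = X powr s * rho powr (s * real m)"
      using X rho by (simp add: W_def powr_mult powr_powr mult.commute)
    moreover have "X powr kap * X powr s = X ^ K"
      using X by (simp add: powr_add[symmetric] s_def powr_realpow)
    moreover have "C * ((Y powr (1 - s) * W powr s) * Y ^ (K - 1)) = C * (Y powr (1 - s) * Y ^ (K - 1)) * W powr s"
      by (simp only: mult_ac)
    ultimately have "C * ((Y powr (1 - s) * W powr s) * Y ^ (K - 1)) = X powr kap * (X powr s * rho powr (s * real m))"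
      using C by simp
    then show ?thesis using \<open>X powr kap * X powr s = X ^ K\<close> by (simp only: mult.assoc[symmetric])
  qed
  finally show ?thesis by (simp add: s_def)
qed

lemma mult_exp_le_inverse_power:
  fixes c :: real
  assumes "0 < c" "0 < m"
  shows "real m * exp (- c * real m) \<le> fact (k + 1) / c ^ (k + 1) / real m ^ k"
proof -
  have "(c * real m) ^ (k + 1) \<le> fact (k + 1) * exp (c * real m)"
    using assms by (intro power_le_fact_exp) auto
  then have "(c * real m) ^ (k + 1) * exp (- c * real m) \<le> fact (k + 1) * exp (c * real m) * exp (- c * real m)"
    by (intro mult_right_mono) auto
  also have "\<dots> = fact (k + 1)" by (simp add: mult.assoc exp_add[symmetric])
  finally have "c ^ (k + 1) * real m ^ k * (real m * exp (- c * real m)) \<le> fact (k + 1)"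
    by (simp add: power_mult_distrib mult_ac)
  then show ?thesis using assms by (simp add: field_simps)
qed

text \<open>The joint limit is expressed along an arbitrary sequence indexed by \<open>t\<close>.
  The second conjunct renders the second equality of O-terms; the two exponents coincide.\<close>

theorem theorem5p1:
  fixes K :: nat and m :: "nat \<Rightarrow> nat" and n :: "nat \<Rightarrow> nat \<Rightarrow> nat"
    and lim_ratio :: "nat \<Rightarrow> real"
  assumes "K \<ge> 3"
    and "filterlim m at_top sequentially"
    and "\<And>i. i \<in> {1..K} \<Longrightarrow> filterlim (\<lambda>t. n t i) at_top sequentially"
    and "\<And>i. i \<in> {1..K} \<Longrightarrow> (\<lambda>t. real (m t) / real (n t i)) \<longlonglongrightarrow> lim_ratio i"
    and "\<And>i. i \<in> {1..K} \<Longrightarrow> lim_ratio i \<in> {2<..<real K}"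
  shows "(\<lambda>t. \<Sum>l=2..m t. expected_Z K (m t) (n t) l)
           \<in> O(\<lambda>t. real (m t) powr (- 2 * real K * (1 / 2 - 1 / real K)))
       \<and> O(\<lambda>t. real (m t) powr (- 2 * real K * (1 / 2 - 1 / real K)))
           \<subseteq> O(\<lambda>t. real (m t) powr (2 - real K))"
proof -
  have K: "3 \<le> K" by (rule assms(1))
  have expo: "- 2 * real K * (1 / 2 - 1 / real K) = 2 - real K" using K by (simp add: field_simps)
  \<comment> \<open>The midpoint of \<open>Max F\<close> and K lies strictly above all limit ratios
    and strictly below K. The other two elements of \<open>F\<close> provide the lower bounds on
    \<open>kap\<close> required by \<open>even_prob_asymptotic\<close> and
    \<open>expected_Z_large\<close>.\<close>
  define F where "F = {14/5, real K - 1} \<union> lim_ratio ` {1..K}"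
  define M where "M = Max F"
  have F: "finite F" "F \<noteq> {}" "\<And>x. x \<in> F \<Longrightarrow> x < real K"
    using K assms(5) by (auto simp: F_def)
  have M: "14/5 \<le> M" "real K - 1 \<le> M" "\<And>i. i \<in> {1..K} \<Longrightarrow> lim_ratio i \<le> M"
    unfolding M_def using F(1) by (intro Max_ge; auto simp: F_def)+
  have MK: "M < real K"
    unfolding M_def using F by (subst Max_less_iff) auto
  define kap where "kap = (M + real K) / 2"
  have kap: "14/5 \<le> kap" "real K - 1 \<le> kap" "kap < real K" "0 < kap" "\<And>i. i \<in> {1..K} \<Longrightarrow> lim_ratio i < kap"
    using M MK K by (force simp: kap_def)+
  define A where "A = exp 2 * (4 * real K + 2) ^ K"
  have A1: "1 \<le> A"
  proof -
    have "1 * 1 \<le> exp 2 * (4 * real K + 2) ^ K" by (intro mult_mono one_le_power) auto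
    then show ?thesis by (simp add: A_def)
  qed
  \<comment> \<open>The threshold l < d m between the two regimes is then exactly the strict form of
    the smallness assumption of \<open>expected_Z_small\<close>.\<close>
  define d where "d = 1 / (2 * A)"
  have d: "0 < d" "d < 1" using A1 by (auto simp: d_def field_simps)
  define P where "P = (\<lambda>j rho eta. eventually (\<lambda>t. \<forall>R\<subseteq>{..<m t}.
       even_prob (m t) (n t j) R \<le> exp (eta * real (m t)) * real (m t choose card R) powr (- 1 / kap) \<and>
       (d * real (m t) \<le> real (card R) \<longrightarrow>
         even_prob (m t) (n t j) R \<le> exp (eta * real (m t)) * rho powr real (m t))) sequentially)"
  have "\<exists>rho. 0 < rho \<and> rho < 1 \<and> (\<forall>eta>0. P j rho eta)" if j: "j \<in> {1..K}" for j
  proof -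
    have c: "2 < lim_ratio j" using assms(5)[OF j] by simp
    show ?thesis
    proof (rule even_prob_asymptotic[OF assms(2) assms(3)[OF j] assms(4)[OF j] c kap(5)[OF j] kap(1) d])
      fix rho :: real
      assume "0 < rho" "rho < 1" and h: "\<And>eta. 0 < eta \<Longrightarrow> eventually (\<lambda>t. \<forall>R\<subseteq>{..<m t}.
         even_prob (m t) (n t j) R \<le> exp (eta * real (m t)) * real (m t choose card R) powr (- 1 / kap) \<and>
         (d * real (m t) \<le> real (card R) \<longrightarrow>
           even_prob (m t) (n t j) R \<le> exp (eta * real (m t)) * rho powr real (m t))) sequentially"
      moreover from h have "P j rho eta" if "0 < eta" for eta unfolding P_def using that .
      ultimately show ?thesis by blast
    qed
  qed
  then have "\<forall>j\<in>{1..K}. \<exists>rho. 0 < rho \<and> rho < 1 \<and> (\<forall>eta>0. P j rho eta)" by blast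
  from bchoice[OF this] obtain rho
    where rho: "\<And>j. j \<in> {1..K} \<Longrightarrow> 0 < rho j \<and> rho j < 1"
      and ev: "\<And>j eta. j \<in> {1..K} \<Longrightarrow> 0 < eta \<Longrightarrow> P j (rho j) eta"
    by blast
  define s where "s = real K - kap"
  define r where "r = - ln (rho 1)"
  \<comment> \<open>The large regime decays like exp(-2 c m). The K error factors exp(eta m) with
    eta = c / K use up half of this rate.\<close>
  define c where "c = s * r / 2"
  define eta where "eta = c / real K"
  have r1: "0 < rho 1" "rho 1 < 1" using rho[of 1] K by auto
  have "0 < r" using r1 by (simp add: r_def)
  then have c: "0 < c" using kap(3) by (simp add: c_def s_def)
  have eta: "0 < eta" using c K by (simp add: eta_def)
  obtain S where S: "0 < S" "\<And>m. (\<Sum>l=2..m. real l ^ (K - 2) * (1 / 2) ^ (l div 2 - 1)) \<le> S"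
    using polynomial_half_power_sum by blast
  \<comment> \<open>The first summand comes from the small sizes, the second from at most m terms
    exp(-c m) by \<open>mult_exp_le_inverse_power\<close>.\<close>
  define T where "T = A * S + fact (K - 2 + 1) / c ^ (K - 2 + 1)"
  have ev1: "eventually (\<lambda>t. \<forall>j\<in>{1..K}. \<forall>R\<subseteq>{..<m t}.
       even_prob (m t) (n t j) R \<le> exp (eta * real (m t)) * real (m t choose card R) powr (- 1 / kap) \<and>
       (d * real (m t) \<le> real (card R) \<longrightarrow>
         even_prob (m t) (n t j) R \<le> exp (eta * real (m t)) * rho j powr real (m t))) sequentially"
    using ev[OF _ eta] unfolding P_def by (intro eventually_ball_finite ballI) auto
  have ev2: "eventually (\<lambda>t. \<forall>j\<in>{1..K}. 0 < n t j \<and> 2 * n t j \<le> m t \<and> m t \<le> K * n t j) sequentially"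
  proof (intro eventually_ball_finite ballI)
    fix j assume j: "j \<in> {1..K}"
    have "eventually (\<lambda>t. 0 < n t j) sequentially"
      using assms(3)[OF j, unfolded filterlim_at_top, rule_format, of 1] by (auto elim: eventually_mono)
    moreover have "eventually (\<lambda>t. 2 < real (m t) / real (n t j)) sequentially"
      "eventually (\<lambda>t. real (m t) / real (n t j) < real K) sequentially"
      using order_tendstoD[OF assms(4)[OF j]] assms(5)[OF j] by auto
    ultimately show "eventually (\<lambda>t. 0 < n t j \<and> 2 * n t j \<le> m t \<and> m t \<le> K * n t j) sequentially"
    proof eventually_elim
      case (elim t)
      then have "real (2 * n t j) < real (m t)" "real (m t) < real (K * n t j)"
        by (auto simp: field_simps)
      then show ?case using elim by linarith
    qed
  qed auto
  have "eventually (\<lambda>t. 0 < m t) sequentially"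
    using assms(2)[unfolded filterlim_at_top, rule_format, of 1] by (auto elim: eventually_mono)
  with ev1 ev2 have bound: "eventually (\<lambda>t. norm (\<Sum>l=2..m t. expected_Z K (m t) (n t) l)
     \<le> T * norm (real (m t) powr (2 - real K))) sequentially"
  proof eventually_elim
    case (elim t)
    define N where "N = m t"
    have N: "0 < N" using elim by (simp add: N_def)
    have nn: "0 < n t j \<and> 2 * n t j \<le> N" if "j \<in> {1..K}" for j using elim that by (auto simp: N_def)
    have nonneg: "0 \<le> expected_Z K N (n t) l" for l
    proof -
      have "expected_Z K N (n t) l = (\<Sum>R | R \<subseteq> {..<N} \<and> card R = l. \<Prod>j\<in>{1..K}. even_prob N (n t j) R)"
        using nn by (rule expected_Z_even_prob)
      then show ?thesis by (simp add: sum_nonneg prod_nonneg even_prob_nonneg)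
    qed
    \<comment> \<open>Both regimes are covered by the sum of their nonnegative bounds, so the
      summation over \<open>l\<close> needs no splitting.\<close>
    have each: "expected_Z K N (n t) l \<le> A * (real l ^ (K - 2) * (1 / 2) ^ (l div 2 - 1)) / real N ^ (K - 2) + exp (- c * real N)"
      if l: "l \<in> {2..N}" for l
    proof (cases "d * real N \<le> real l")
      case True
      have "expected_Z K N (n t) l \<le> exp (eta * real N) ^ K * rho 1 powr ((real K - kap) * real N)"
      proof (rule expected_Z_large[where d = d])
        show "even_prob N (n t j) R \<le> exp (eta * real N) * real (N choose card R) powr (- 1 / kap)"
          if "j \<in> {1..K}" "R \<subseteq> {..<N}" for j R using elim that by (auto simp: N_def)
        show "even_prob N (n t 1) R \<le> exp (eta * real N) * rho 1 powr real N"
          if "R \<subseteq> {..<N}" "d * real N \<le> real (card R)" for R using elim that K by (auto simp: N_def)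
      qed (use nn K kap r1 l True in auto)
      also have "\<dots> = exp (- c * real N)"
      proof -
        have "exp (eta * real N) ^ K = exp (c * real N)"
          using K by (simp add: exp_of_nat_mult[symmetric] eta_def)
        moreover have "rho 1 powr ((real K - kap) * real N) = exp (- (2 * c) * real N)"
        proof -
          have c2: "- (2 * c) = s * ln (rho 1)" by (simp add: c_def r_def)
          show ?thesis unfolding c2 using r1 by (simp add: powr_def s_def mult_ac)
        qed
        ultimately show ?thesis by (simp add: exp_add[symmetric] algebra_simps)
      qed
      also have "\<dots> \<le> A * (real l ^ (K - 2) * (1 / 2) ^ (l div 2 - 1)) / real N ^ (K - 2) + exp (- c * real N)"
        using A1 by simp
      finally show ?thesis .
    next
      case False
      have "expected_Z K N (n t) l \<le> A * real l ^ (K - 2) / real N ^ (K - 2) * (1 / 2) ^ (l div 2 - 1)"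
        unfolding A_def
      proof (rule expected_Z_small[OF K _ N])
        show "2 * n t j \<le> N \<and> N \<le> K * n t j" if "j \<in> {1..K}" for j using elim that by (auto simp: N_def)
        show "2 * (exp 2 * (4 * real K + 2) ^ K) * real l \<le> real N"
          using False A1 unfolding A_def[symmetric] by (simp add: d_def field_simps)
      qed (use l in auto)
      also have "\<dots> = A * (real l ^ (K - 2) * (1 / 2) ^ (l div 2 - 1)) / real N ^ (K - 2)" by simp
      finally show ?thesis by (smt (verit) exp_gt_zero)
    qed
    have "(\<Sum>l=2..N. expected_Z K N (n t) l) \<le>
      (\<Sum>l=2..N. A * (real l ^ (K - 2) * (1 / 2) ^ (l div 2 - 1)) / real N ^ (K - 2) + exp (- c * real N))"
      by (intro sum_mono each)
    also have "\<dots> = A * (\<Sum>l=2..N. real l ^ (K - 2) * (1 / 2) ^ (l div 2 - 1)) / real N ^ (K - 2)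
       + real (card {2..N}) * exp (- c * real N)"
      by (simp add: sum.distrib sum_distrib_left sum_divide_distrib)
    also have "\<dots> \<le> A * S / real N ^ (K - 2) + fact (K - 2 + 1) / c ^ (K - 2 + 1) / real N ^ (K - 2)"
    proof (intro add_mono divide_right_mono mult_left_mono S(2))
      have "real (card {2..N}) * exp (- c * real N) \<le> real N * exp (- c * real N)"
        by (intro mult_right_mono) auto
      also have "\<dots> \<le> fact (K - 2 + 1) / c ^ (K - 2 + 1) / real N ^ (K - 2)"
        using c N by (rule mult_exp_le_inverse_power)
      finally show "real (card {2..N}) * exp (- c * real N) \<le> fact (K - 2 + 1) / c ^ (K - 2 + 1) / real N ^ (K - 2)" .
    qed (use A1 in auto)
    also have "\<dots> = T / real N ^ (K - 2)" by (simp add: T_def add_divide_distrib)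
    also have "\<dots> = T * real N powr (2 - real K)"
    proof -
      have "real N powr (2 - real K) = real N powr (- real (K - 2))" using K by (simp add: of_nat_diff)
      also have "\<dots> = 1 / real N ^ (K - 2)" using N by (simp add: powr_minus_divide powr_realpow)
      finally show ?thesis by simp
    qed
    finally show ?case using nonneg unfolding N_def[symmetric] by (simp add: sum_nonneg)
  qed
  show ?thesis unfolding expo using bigoI[OF bound] by simp
qed

end
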